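(* Let $\{|\psi[B_j,Q_j,L_j]\rangle\}_{j=1}^m$ be $m$ pairwise orthonormal continuous matrix product states (cMPS) in the bosonic Fock space over $L^2(I)$, the $j$-th having bond dimension $D_j$, and let $P_j=|\psi[B_j,Q_j,L_j]\rangle\langle\psi[B_j,Q_j,L_j]|$ be the corresponding rank-one projectors. Let $a_1,\dots,a_m\in\mathbb R$. Then the operator $$U_{(m)}=\mathbb 1+\sum_{j=1}^m\big(e^{ia_j}-1\big)P_j$$ is a unitary continuous matrix product operator (cMPU) with bond dimension $D=1+\sum_{j=1}^mD_j^2$, a cMPO representation being given by the direct sum of the respective tensors of the summands.
   Context: Setting. $I=[x_-,x_+]=[-\ell/2,\ell/2]$ is an interval, $\mathfrak F=\bigoplus_{N\ge 0} L^2(I)^{\odot N}$ is the bosonic Fock space, $\psi(x)$ is the bosonic field operator with $[\psi(x),\psi^\dagger(y)]=\delta(x-y)$, and $|\Omega\rangle$ is the Fock vacuum. For a matrix-valued function $Q$, $V_x^y=\mathcal P\exp\int_x^y Q(z)\,dz$, ordered so that $\partial_yV_x^y=V_x^yQ(y)$, $V_x^yV_y^z=V_x^z$; $V_i^{i+1}=V_{x_i}^{x_{i+1}}$, $V_-^1=V_{x_-}^{x_1}$, $V_n^+=V_{x_n}^{x_+}$. Matrix-valued functions are assumed regular enough that all expressions make sense. cMPS. For $B\in M_D(\mathbb C)$ and $Q,L:I\to M_D(\mathbb C)$, the cMPS with bond dimension $D$ is $$|\psi[B,Q,L]\rangle=\sum_{j\ge0}\int_{x_1<\dots<x_j}\!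 d^jx\ \mathrm{Tr}\big(BV_-^1L(x_1)V_1^2\cdots L(x_j)V_j^+\big)\psi^\dagger(x_1)\cdots\psi^\dagger(x_j)|\Omega\rangle .$$ cMPO. For $B\in M_D(\mathbb C)$ and $Q,L,R,T:I\to M_D(\mathbb C)$, the cMPO with bond dimension $D$ is $$O[B,Q,L,R,T]=\mathrm{Tr}_D\Big(B\,\mathcal P e^{\int_I dx\,(Q(x)\otimes \mathrm{Id}+L(x)\otimes l_x+R(x)\otimes r_x+T(x)\otimes \mathrm{Ad}_x)}\Big)\big(|\Omega\rangle\langle\Omega|\big),$$ with supermaps $l_x[X]=\psi^\dagger(x)X$, $r_x[X]=X\psi(x)$, $\mathrm{Ad}_x[X]=\psi^\dagger(x)X\psi(x)$, $\mathrm{Id}[X]=X$; i.e. the Dyson expansion $$O=\sum_{n\ge0}\ \sum_{\alpha\in\{L,R,A\}^n}\int_{x_1<\dots<x_n}\! d^nx\ \mathrm{Tr}\big(B\,V_-^1K^{\alpha_1}(x_1)V_1^2\cdots K^{\alpha_n}(x_n)V_n^+\big)\; s^{\alpha_1}_{x_1}\cdots s^{\alpha_n}_{x_n}\big[|\Omega\rangle\langle\Omega|\big],$$ with $K^L=L$, $K^R=R$, $K^A=T$, $s^L_x=l_x$, $s^R_x=r_x$, $s^A_x=\mathrm{Ad}_x$. Operators are understood through their matrix elements between particle-number sectors. The identity $\mathbb 1$ is the cMPO of bond dimension $1$ with $B=T=1$, $Q=L=R=0$. A cMPU is a unitary cMPO. "With bond dimension $D$" means that the operator admits a representation with $D\times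 D$ matrices (not asserted minimal). *)

theory Defs
  imports "HOL-Analysis.Analysis" "HOL-Combinatorics.Permutations" "Jordan_Normal_Form.Matrix"
begin

section \<open>Bosonic Fock space over \<open>L\<^sup>2(I)\<close>, \<open>I = [-\<ell>/2, \<ell>/2]\<close>\<close>

definition interval_measure :: "real \<Rightarrow> real measure" where
  "interval_measure ell = restrict_space lborel {- ell / 2 .. ell / 2}"

definition config :: "real \<Rightarrow> nat \<Rightarrow> (nat \<Rightarrow> real) measure" where
  "config ell N = Pi\<^sub>M {..<N} (\<lambda>_. interval_measure ell)"

text \<open>A Fock vector is given by a representative: the \<open>N\<close>-th component is an \<open>N\<close>-particle wave
  function on \<open>I\<^sup>N\<close>, and two representatives give the same vector iff they are related by
  \<open>fock_eq\<close>. The space \<open>I\<^sup>0\<close> has the single point \<open>\<lambda>_. undefined\<close>.\<close>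

type_synonym fockvec = "nat \<Rightarrow> (nat \<Rightarrow> real) \<Rightarrow> complex"

definition fock :: "real \<Rightarrow> fockvec set" where
  "fock ell = {\<phi>.
     (\<forall>N. \<phi> N \<in> borel_measurable (config ell N)
        \<and> integrable (config ell N) (\<lambda>x. (cmod (\<phi> N x))\<^sup>2)
        \<and> (\<forall>\<sigma>. \<sigma> permutes {..<N} \<longrightarrow> (AE x in config ell N. \<phi> N (x \<circ> \<sigma>) = \<phi> N x)))
     \<and> summable (\<lambda>N. LINT x|config ell N. (cmod (\<phi> N x))\<^sup>2)}"

definition fock_eq :: "real \<Rightarrow> fockvec \<Rightarrow> fockvec \<Rightarrow> bool" where
  "fock_eq ell \<phi> \<eta> \<longleftrightarrow> (\<forall>N. AE x in config ell N. \<phi> N x = \<eta> N x)"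

definition fock_inner :: "real \<Rightarrow> fockvec \<Rightarrow> fockvec \<Rightarrow> complex" where
  "fock_inner ell \<eta> \<phi> = (\<Sum>N. LINT x|config ell N. cnj (\<eta> N x) * \<phi> N x)"

definition fock_sector :: "real \<Rightarrow> nat \<Rightarrow> fockvec set" where
  "fock_sector ell N = {\<phi> \<in> fock ell. \<forall>k x. k \<noteq> N \<longrightarrow> \<phi> k x = 0}"

definition fock_operator :: "real \<Rightarrow> (fockvec \<Rightarrow> fockvec) \<Rightarrow> bool" where
  "fock_operator ell A \<longleftrightarrow>
     (\<forall>\<phi>\<in>fock ell. A \<phi> \<in> fock ell) \<and>
     (\<forall>\<phi>\<in>fock ell. \<forall>\<eta>\<in>fock ell. fock_eq ell \<phi> \<eta> \<longrightarrow> fock_eq ell (A \<phi>) (A \<eta>)) \<and>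
     (\<forall>\<phi>\<in>fock ell. \<forall>\<eta>\<in>fock ell. \<forall>b c.
        fock_eq ell (A (\<lambda>N x. b * \<phi> N x + c * \<eta> N x)) (\<lambda>N x. b * A \<phi> N x + c * A \<eta> N x))"

definition fock_unitary :: "real \<Rightarrow> (fockvec \<Rightarrow> fockvec) \<Rightarrow> bool" where
  "fock_unitary ell U \<longleftrightarrow> fock_operator ell U \<and>
     (\<exists>V. fock_operator ell V
        \<and> (\<forall>\<phi>\<in>fock ell. \<forall>\<eta>\<in>fock ell. fock_inner ell (V \<eta>) \<phi> = fock_inner ell \<eta> (U \<phi>))
        \<and> (\<forall>\<phi>\<in>fock ell. fock_eq ell (V (U \<phi>)) \<phi> \<and> fock_eq ell (U (V \<phi>)) \<phi>))"

definition fock_scale :: "complex \<Rightarrow> (fockvec \<Rightarrow> fockvec) \<Rightarrow> fockvec \<Rightarrow> fockvec" where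
  "fock_scale c A = (\<lambda>\<phi> N x. c * A \<phi> N x)"

definition rank_one_proj :: "real \<Rightarrow> fockvec \<Rightarrow> fockvec \<Rightarrow> fockvec" where
  "rank_one_proj ell \<psi> = (\<lambda>\<phi> N x. fock_inner ell \<psi> \<phi> * \<psi> N x)"

text \<open>The annihilation operator-valued distribution \<open>\<psi>(x)\<close>, acting on representatives:
  \<open>(\<psi>(x) \<phi>)\<^sub>N (x\<^sub>1, \<dots>, x\<^sub>N) = sqrt (N + 1) \<phi>\<^sub>N\<^sub>+\<^sub>1 (x, x\<^sub>1, \<dots>, x\<^sub>N)\<close>.
  It only ever occurs under an integral over \<open>x\<close>.\<close>

definition annih :: "real \<Rightarrow> fockvec \<Rightarrow> fockvec" where
  "annih x \<phi> = (\<lambda>N y. complex_of_real (sqrt (real (Suc N))) * \<phi> (Suc N) (case_nat x y))"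

text \<open>The wave function of the smeared \<open>N\<close>-particle state
  \<open>\<integral>\<^bsub>x\<^sub>1 < \<dots> < x\<^sub>N\<^esub> f(x) \<psi>\<^sup>\<dagger>(x\<^sub>1) \<cdots> \<psi>\<^sup>\<dagger>(x\<^sub>N) |\<Omega>\<rangle>\<close>: since \<open>\<psi>\<^sup>\<dagger>(x\<^sub>1) \<cdots> \<psi>\<^sup>\<dagger>(x\<^sub>N) |\<Omega>\<rangle>\<close> has wave function
  \<open>(N!)\<^sup>-\<^sup>1\<^sup>/\<^sup>2 \<Sum>\<^sub>\<sigma> \<Prod>\<^sub>i \<delta>(x\<^sub>i - y\<^sub>\<sigma>\<^sub>(\<^sub>i\<^sub>))\<close>, the integral over the simplex leaves, for each \<open>\<sigma>\<close>,
  the value of \<open>f\<close> at \<open>y \<circ> \<sigma>\<close> if that point is increasing, and \<open>0\<close> otherwise.\<close>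

definition smeared_creation :: "nat \<Rightarrow> ((nat \<Rightarrow> real) \<Rightarrow> complex) \<Rightarrow> (nat \<Rightarrow> real) \<Rightarrow> complex" where
  "smeared_creation N f y =
     (\<Sum>\<sigma> | \<sigma> permutes {..<N}. if strict_mono_on {..<N} (y \<circ> \<sigma>) then f (y \<circ> \<sigma>) else 0)
       / complex_of_real (sqrt (fact N))"

section \<open>Path-ordered exponentials\<close>

definition mat_trace :: "complex mat \<Rightarrow> complex" where
  "mat_trace A = (\<Sum>i<dim_row A. A $$ (i, i))"

text \<open>Dyson series of the path-ordered exponential, later positions standing to the right:
  the \<open>n\<close>-th term is the integral of \<open>Q(z\<^sub>1) \<cdots> Q(z\<^sub>n)\<close> over \<open>x \<le> z\<^sub>1 \<le> \<dots> \<le> z\<^sub>n \<le> y\<close>, so that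
  \<open>\<partial>\<^sub>y V = V Q(y)\<close>. It is only used for \<open>x \<le> y\<close>.\<close>

fun dyson_term :: "nat \<Rightarrow> (real \<Rightarrow> complex mat) \<Rightarrow> nat \<Rightarrow> real \<Rightarrow> real \<Rightarrow> complex mat" where
  "dyson_term D Q 0 x y = 1\<^sub>m D"
| "dyson_term D Q (Suc n) x y =
     Matrix.mat D D (\<lambda>(i, j). LINT z:{x..y}|lborel. (dyson_term D Q n x z * Q z) $$ (i, j))"

definition path_exp :: "nat \<Rightarrow> (real \<Rightarrow> complex mat) \<Rightarrow> real \<Rightarrow> real \<Rightarrow> complex mat" where
  "path_exp D Q x y = Matrix.mat D D (\<lambda>(i, j). \<Sum>n. dyson_term D Q n x y $$ (i, j))"

text \<open>\<open>V\<^bsub>x\<^sub>0\<^esub>\<^bsup>x\<^sub>1\<^esup> K\<^sub>1 V\<^bsub>x\<^sub>1\<^esub>\<^bsup>x\<^sub>2\<^esup> K\<^sub>2 \<cdots> K\<^sub>n V\<^bsub>x\<^sub>n\<^esub>\<^bsup>z\<^esup>\<close> for the list \<open>[(x\<^sub>1, K\<^sub>1), \<dots>, (x\<^sub>n, K\<^sub>n)]\<close>.\<close>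

fun path_word :: "nat \<Rightarrow> (real \<Rightarrow> complex mat) \<Rightarrow> real \<Rightarrow> real \<Rightarrow> (real \<times> complex mat) list \<Rightarrow> complex mat"
  where
  "path_word D Q x\<^sub>0 z [] = path_exp D Q x\<^sub>0 z"
| "path_word D Q x\<^sub>0 z ((x, K) # ws) = path_exp D Q x\<^sub>0 x * K * path_word D Q x z ws"

text \<open>Regularity classes, entrywise. With \<open>Q\<close> integrable, \<open>L\<close> and \<open>R\<close> square-integrable and \<open>T\<close> bounded,
  all integrals and series below converge absolutely.\<close>

definition mat_integrable :: "real \<Rightarrow> nat \<Rightarrow> (real \<Rightarrow> complex mat) \<Rightarrow> bool" where
  "mat_integrable ell D Q \<longleftrightarrow> (\<forall>x. Q x \<in> carrier_mat D D) \<and>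
     (\<forall>i<D. \<forall>j<D. integrable (interval_measure ell) (\<lambda>x. Q x $$ (i, j)))"

definition mat_sq_integrable :: "real \<Rightarrow> nat \<Rightarrow> (real \<Rightarrow> complex mat) \<Rightarrow> bool" where
  "mat_sq_integrable ell D L \<longleftrightarrow> (\<forall>x. L x \<in> carrier_mat D D) \<and>
     (\<forall>i<D. \<forall>j<D. (\<lambda>x. L x $$ (i, j)) \<in> borel_measurable (interval_measure ell) \<and>
        integrable (interval_measure ell) (\<lambda>x. (cmod (L x $$ (i, j)))\<^sup>2))"

definition mat_bounded :: "real \<Rightarrow> nat \<Rightarrow> (real \<Rightarrow> complex mat) \<Rightarrow> bool" where
  "mat_bounded ell D T \<longleftrightarrow> (\<forall>x. T x \<in> carrier_mat D D) \<and>
     (\<forall>i<D. \<forall>j<D. (\<lambda>x. T x $$ (i, j)) \<in> borel_measurable (interval_measure ell) \<and>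
        (\<exists>C. \<forall>x\<in>{- ell / 2 .. ell / 2}. cmod (T x $$ (i, j)) \<le> C))"

section \<open>Continuous matrix product states\<close>

definition cmps_tensors ::
  "real \<Rightarrow> nat \<Rightarrow> complex mat \<Rightarrow> (real \<Rightarrow> complex mat) \<Rightarrow> (real \<Rightarrow> complex mat) \<Rightarrow> bool" where
  "cmps_tensors ell D B Q L \<longleftrightarrow>
     B \<in> carrier_mat D D \<and> mat_integrable ell D Q \<and> mat_sq_integrable ell D L"

definition cmps ::
  "real \<Rightarrow> nat \<Rightarrow> complex mat \<Rightarrow> (real \<Rightarrow> complex mat) \<Rightarrow> (real \<Rightarrow> complex mat) \<Rightarrow> fockvec" where
  "cmps ell D B Q L = (\<lambda>N. smeared_creation N (\<lambda>x.
     mat_trace (B * path_word D Q (- ell / 2) (ell / 2) (map (\<lambda>i. (x i, L (x i))) [0..<N]))))"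

section \<open>Continuous matrix product operators\<close>

record cmpo =
  cmpo_B :: "complex mat"
  cmpo_Q :: "real \<Rightarrow> complex mat"
  cmpo_L :: "real \<Rightarrow> complex mat"
  cmpo_R :: "real \<Rightarrow> complex mat"
  cmpo_T :: "real \<Rightarrow> complex mat"

definition cmpo_tensors :: "real \<Rightarrow> nat \<Rightarrow> cmpo \<Rightarrow> bool" where
  "cmpo_tensors ell D W \<longleftrightarrow> cmpo_B W \<in> carrier_mat D D \<and> mat_integrable ell D (cmpo_Q W) \<and>
     mat_sq_integrable ell D (cmpo_L W) \<and> mat_sq_integrable ell D (cmpo_R W) \<and>
     mat_bounded ell D (cmpo_T W)"

datatype leg = Left | Right | Adj

fun leg_mat :: "cmpo \<Rightarrow> leg \<Rightarrow> real \<Rightarrow> complex mat" where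
  "leg_mat W Left = cmpo_L W"
| "leg_mat W Right = cmpo_R W"
| "leg_mat W Adj = cmpo_T W"

text \<open>Operators \<open>X\<close> are represented by their sesquilinear forms \<open>(\<eta>, \<phi>) \<mapsto> \<langle>\<eta>| X |\<phi>\<rangle>\<close>, so that
  \<open>\<psi>\<^sup>\<dagger>(x)\<close> on the left of \<open>X\<close> becomes \<open>\<psi>(x)\<close> acting on \<open>\<eta>\<close>.\<close>

fun supermap :: "leg \<Rightarrow> real \<Rightarrow> (fockvec \<Rightarrow> fockvec \<Rightarrow> complex) \<Rightarrow> fockvec \<Rightarrow> fockvec \<Rightarrow> complex" where
  "supermap Left x X \<eta> \<phi> = X (annih x \<eta>) \<phi>"
| "supermap Right x X \<eta> \<phi> = X \<eta> (annih x \<phi>)"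
| "supermap Adj x X \<eta> \<phi> = X (annih x \<eta>) (annih x \<phi>)"

definition vacuum_proj_form :: "fockvec \<Rightarrow> fockvec \<Rightarrow> complex" where
  "vacuum_proj_form \<eta> \<phi> = cnj (\<eta> 0 (\<lambda>_. undefined)) * \<phi> 0 (\<lambda>_. undefined)"

text \<open>Matrix elements of the Dyson expansion. For \<open>\<eta>\<close> and \<open>\<phi>\<close> of fixed particle numbers only finitely
  many \<open>n\<close> contribute.\<close>

definition cmpo_form :: "real \<Rightarrow> nat \<Rightarrow> cmpo \<Rightarrow> fockvec \<Rightarrow> fockvec \<Rightarrow> complex" where
  "cmpo_form ell D W \<eta> \<phi> = (\<Sum>n. \<Sum>\<alpha> | length \<alpha> = n.
     LINT x:{x. strict_mono_on {..<n} x}|config ell n.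
       mat_trace (cmpo_B W * path_word D (cmpo_Q W) (- ell / 2) (ell / 2)
         (map (\<lambda>i. (x i, leg_mat W (\<alpha> ! i) (x i))) [0..<n]))
       * foldr (\<lambda>i. supermap (\<alpha> ! i) (x i)) [0..<n] vacuum_proj_form \<eta> \<phi>)"

definition cmpo_represents :: "real \<Rightarrow> nat \<Rightarrow> cmpo \<Rightarrow> (fockvec \<Rightarrow> fockvec) \<Rightarrow> bool" where
  "cmpo_represents ell D W A \<longleftrightarrow> cmpo_tensors ell D W \<and> fock_operator ell A \<and>
     (\<forall>N M. \<forall>\<eta>\<in>fock_sector ell N. \<forall>\<phi>\<in>fock_sector ell M.
        fock_inner ell \<eta> (A \<phi>) = cmpo_form ell D W \<eta> \<phi>)"

definition is_cmpu :: "real \<Rightarrow> nat \<Rightarrow> (fockvec \<Rightarrow> fockvec) \<Rightarrow> bool" where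
  "is_cmpu ell D U \<longleftrightarrow> fock_unitary ell U \<and> (\<exists>W. cmpo_represents ell D W U)"

section \<open>The tensors of the summands and their direct sum\<close>

definition id_cmpo :: cmpo where
  "id_cmpo = \<lparr>cmpo_B = 1\<^sub>m 1, cmpo_Q = (\<lambda>_. 0\<^sub>m 1 1), cmpo_L = (\<lambda>_. 0\<^sub>m 1 1),
     cmpo_R = (\<lambda>_. 0\<^sub>m 1 1), cmpo_T = (\<lambda>_. 1\<^sub>m 1)\<rparr>"

definition kron :: "complex mat \<Rightarrow> complex mat \<Rightarrow> complex mat" where
  "kron A B = Matrix.mat (dim_row A * dim_row B) (dim_col A * dim_col B) (\<lambda>(i, j).
     A $$ (i div dim_row B, j div dim_col B) * B $$ (i mod dim_row B, j mod dim_col B))"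

abbreviation mat_cnj :: "complex mat \<Rightarrow> complex mat" where
  "mat_cnj \<equiv> map_mat cnj"

text \<open>Tensors of \<open>|\<psi>[B, Q, L]\<rangle>\<langle>\<psi>[B, Q, L]|\<close>: the ket supplies \<open>L\<close>, the bra the conjugated \<open>R\<close>; positions
  of the ket and of the bra coincide only on a null set, so \<open>T = 0\<close>.\<close>

definition proj_cmpo ::
  "nat \<Rightarrow> complex mat \<Rightarrow> (real \<Rightarrow> complex mat) \<Rightarrow> (real \<Rightarrow> complex mat) \<Rightarrow> cmpo" where
  "proj_cmpo D B Q L = \<lparr>cmpo_B = kron B (mat_cnj B),
     cmpo_Q = (\<lambda>x. kron (Q x) (1\<^sub>m D) + kron (1\<^sub>m D) (mat_cnj (Q x))),
     cmpo_L = (\<lambda>x. kron (L x) (1\<^sub>m D)),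
     cmpo_R = (\<lambda>x. kron (1\<^sub>m D) (mat_cnj (L x))),
     cmpo_T = (\<lambda>_. 0\<^sub>m (D\<^sup>2) (D\<^sup>2))\<rparr>"

definition scale_cmpo :: "complex \<Rightarrow> cmpo \<Rightarrow> cmpo" where
  "scale_cmpo c W = W\<lparr>cmpo_B := c \<cdot>\<^sub>m cmpo_B W\<rparr>"

definition direct_sum_cmpo :: "cmpo list \<Rightarrow> cmpo" where
  "direct_sum_cmpo Ws = \<lparr>cmpo_B = diag_block_mat (map cmpo_B Ws),
     cmpo_Q = (\<lambda>x. diag_block_mat (map (\<lambda>W. cmpo_Q W x) Ws)),
     cmpo_L = (\<lambda>x. diag_block_mat (map (\<lambda>W. cmpo_L W x) Ws)),
     cmpo_R = (\<lambda>x. diag_block_mat (map (\<lambda>W. cmpo_R W x) Ws)),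
     cmpo_T = (\<lambda>x. diag_block_mat (map (\<lambda>W. cmpo_T W x) Ws))\<rparr>"

definition phase_operator ::
  "real \<Rightarrow> nat \<Rightarrow> (nat \<Rightarrow> real) \<Rightarrow> (nat \<Rightarrow> fockvec) \<Rightarrow> fockvec \<Rightarrow> fockvec" where
  "phase_operator ell m a \<psi> = (\<lambda>\<phi> N x. \<phi> N x +
     (\<Sum>j<m. (exp (\<i> * complex_of_real (a j)) - 1) * rank_one_proj ell (\<psi> j) \<phi> N x))"

end

theory Submission
  imports Defs
begin

text \<open>The \<open>n\<close>-th term of the Dyson expansion of the cMPO with tensors
  \<open>Q \<otimes> 1 + 1 \<otimes> Q\<^sup>*\<close>, \<open>L \<otimes> 1\<close>, \<open>1 \<otimes> L\<^sup>*\<close> is a sum over words in the two legs. Since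
  the path-ordered exponential of \<open>Q \<otimes> 1 + 1 \<otimes> Q\<^sup>*\<close> factorizes, each word contributes the product of a ket
  amplitude at the left positions and a conjugated bra amplitude at the right positions, and
  summing over all interleavings of the two groups of positions turns the integrals over the large simplex
  into the product of the two integrals over the small simplices. That gives the rank-one projector.
  Block diagonal tensors add amplitudes, whence the direct sum, and orthonormality
  makes the phase operator with the opposite phases an adjoint two-sided inverse.\<close>

section \<open>The inner product of Fock space\<close>

text \<open>The tensors are only integrable, so a path-ordered exponential solves its differential
  equation merely almost everywhere. Identities between exponentials are therefore proved for Dyson
  terms and summed as Cauchy products. The factorization rests on integration by parts in Fubini
  form: a square is cut along its diagonal, and iterating this turns the Dyson terms of a Kronecker
  sum into the convolution of those of its summands. Words with \<open>N\<close> left and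
  \<open>M\<close> right legs are (N, M)-shuffles: up to a null set, the product of the two small
  simplices is the union of the images of the large simplex under the shuffle permutations. The
  factorials balance. Annihilating all \<open>N\<close> particles gives
  \<open>sqrt (fact N)\<close>, undoing the normalization of \<open>smeared_creation\<close> gives
  it once more, and \<open>fact N\<close> simplices fill the cube over which the inner product
  integrates.\<close>

lemma integrable_cnj_mult:
  fixes f g :: "'a \<Rightarrow> complex"
  assumes "f \<in> borel_measurable M" "g \<in> borel_measurable M"
    and "integrable M (\<lambda>x. (cmod (f x))\<^sup>2)" "integrable M (\<lambda>x. (cmod (g x))\<^sup>2)"
  shows "integrable M (\<lambda>x. cnj (f x) * g x)"
    and "cmod (LINT x|M. cnj (f x) * g x) \<le> (LINT x|M. (cmod (f x))\<^sup>2) + (LINT x|M. (cmod (g x))\<^sup>2)"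
proof -
  \<comment> \<open>This pointwise bound stands in for Cauchy-Schwarz: a sum of squared norms,
    unlike a product of norms, is summable over the particle number as the sum of two convergent
    series.\<close>
  have *: "cmod (cnj z * w) \<le> (cmod z)\<^sup>2 + (cmod w)\<^sup>2" for z w
  proof -
    have "cmod z * cmod w \<ge> 0" by simp
    moreover have "2 * (cmod z * cmod w) \<le> (cmod z)\<^sup>2 + (cmod w)\<^sup>2"
      using sum_squares_bound[of "cmod z" "cmod w"] by (simp add: mult.assoc)
    ultimately show ?thesis unfolding norm_mult complex_mod_cnj by linarith
  qed
  have s: "integrable M (\<lambda>x. (cmod (f x))\<^sup>2 + (cmod (g x))\<^sup>2)"
    using assms by simp
  have cm: "(\<lambda>x. cnj (f x)) \<in> borel_measurable M"
    using assms(1) by (rule borel_measurable_continuous_on[OF continuous_on_cnj[OF continuous_on_id], simplified])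
  show i: "integrable M (\<lambda>x. cnj (f x) * g x)"
    by (rule Bochner_Integration.integrable_bound[OF s]) (use cm assms * in auto)
  have "cmod (LINT x|M. cnj (f x) * g x) \<le> (LINT x|M. cmod (cnj (f x) * g x))"
    by (rule integral_norm_bound)
  also have "\<dots> \<le> (LINT x|M. (cmod (f x))\<^sup>2 + (cmod (g x))\<^sup>2)"
    using i s * by (intro integral_mono) auto
  also have "\<dots> = (LINT x|M. (cmod (f x))\<^sup>2) + (LINT x|M. (cmod (g x))\<^sup>2)"
    using assms by simp
  finally show "cmod (LINT x|M. cnj (f x) * g x) \<le> (LINT x|M. (cmod (f x))\<^sup>2) + (LINT x|M. (cmod (g x))\<^sup>2)" .
qed

lemma fockD:
  assumes "\<phi> \<in> fock ell"
  shows "\<phi> N \<in> borel_measurable (config ell N)"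
    and "integrable (config ell N) (\<lambda>x. (cmod (\<phi> N x))\<^sup>2)"
    and "\<sigma> permutes {..<N} \<Longrightarrow> AE x in config ell N. \<phi> N (x \<circ> \<sigma>) = \<phi> N x"
    and "summable (\<lambda>N. LINT x|config ell N. (cmod (\<phi> N x))\<^sup>2)"
  using assms unfolding fock_def by auto

lemma fock_integrable:
  assumes "\<phi> \<in> fock ell" "\<eta> \<in> fock ell"
  shows "integrable (config ell N) (\<lambda>x. cnj (\<eta> N x) * \<phi> N x)"
  by (intro integrable_cnj_mult fockD assms)

abbreviation sq_norm :: "real \<Rightarrow> fockvec \<Rightarrow> nat \<Rightarrow> real" where
  "sq_norm ell \<phi> N \<equiv> LINT x|config ell N. (cmod (\<phi> N x))\<^sup>2"

lemma fock_inner_summable: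
  assumes "\<phi> \<in> fock ell" "\<eta> \<in> fock ell"
  shows "summable (\<lambda>N. LINT x|config ell N. cnj (\<eta> N x) * \<phi> N x)"
proof (rule summable_comparison_test)
  show "summable (\<lambda>N. sq_norm ell \<eta> N + sq_norm ell \<phi> N)"
    using assms by (intro summable_add fockD)
  show "\<exists>n0. \<forall>N\<ge>n0. norm (LINT x|config ell N. cnj (\<eta> N x) * \<phi> N x)
      \<le> sq_norm ell \<eta> N + sq_norm ell \<phi> N"
    using assms by (intro exI allI impI integrable_cnj_mult fockD)
qed

lemma fock_scaled:
  assumes "\<phi> \<in> fock ell" shows "(\<lambda>N x. c * \<phi> N x) \<in> fock ell"
proof -
  have "AE x in config ell N. c * \<phi> N (x \<circ> \<sigma>) = c * \<phi> N x" if "\<sigma> permutes {..<N}" for N \<sigma>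
    using fockD(3)[OF assms that] by eventually_elim simp
  then show ?thesis
    using fockD(1,2,4)[OF assms]
    by (auto simp: fock_def norm_mult power_mult_distrib summable_mult)
qed

lemma fock_add:
  assumes "\<phi> \<in> fock ell" "\<eta> \<in> fock ell" shows "(\<lambda>N x. \<phi> N x + \<eta> N x) \<in> fock ell"
proof -
  have sq: "(cmod (z + w))\<^sup>2 \<le> 2 * (cmod z)\<^sup>2 + 2 * (cmod w)\<^sup>2" for z w
  proof -
    have "(cmod (z + w))\<^sup>2 \<le> (cmod z + cmod w)\<^sup>2"
      by (intro power_mono norm_triangle_ineq) simp
    also have "\<dots> \<le> 2 * (cmod z)\<^sup>2 + 2 * (cmod w)\<^sup>2"
      using sum_squares_bound[of "cmod z" "cmod w"] by (simp add: power2_sum)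
    finally show ?thesis .
  qed
  have m: "(\<lambda>x. \<phi> N x + \<eta> N x) \<in> borel_measurable (config ell N)" for N
    using fockD(1)[OF assms(1)] fockD(1)[OF assms(2)] by simp
  have b: "integrable (config ell N) (\<lambda>x. 2 * (cmod (\<phi> N x))\<^sup>2 + 2 * (cmod (\<eta> N x))\<^sup>2)" for N
    using fockD(2)[OF assms(1)] fockD(2)[OF assms(2)] by simp
  have i: "integrable (config ell N) (\<lambda>x. (cmod (\<phi> N x + \<eta> N x))\<^sup>2)" for N
    by (rule Bochner_Integration.integrable_bound[OF b]) (use m sq in \<open>auto\<close>)
  have "AE x in config ell N. \<phi> N (x \<circ> \<sigma>) + \<eta> N (x \<circ> \<sigma>) = \<phi> N x + \<eta> N x"
    if "\<sigma> permutes {..<N}" for N \<sigma>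
    using fockD(3)[OF assms(1) that] fockD(3)[OF assms(2) that] by eventually_elim simp
  moreover have "summable (\<lambda>N. LINT x|config ell N. (cmod (\<phi> N x + \<eta> N x))\<^sup>2)"
  proof (rule summable_comparison_test)
    show "summable (\<lambda>N. 2 * sq_norm ell \<phi> N + 2 * sq_norm ell \<eta> N)"
      using assms by (intro summable_add summable_mult fockD)
    have "(LINT x|config ell N. (cmod (\<phi> N x + \<eta> N x))\<^sup>2)
        \<le> 2 * sq_norm ell \<phi> N + 2 * sq_norm ell \<eta> N" for N
    proof -
      have "(LINT x|config ell N. (cmod (\<phi> N x + \<eta> N x))\<^sup>2)
          \<le> (LINT x|config ell N. 2 * (cmod (\<phi> N x))\<^sup>2 + 2 * (cmod (\<eta> N x))\<^sup>2)"
        using i b sq by (intro integral_mono)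
      then show ?thesis using assms by (simp add: fockD)
    qed
    then show "\<exists>n0. \<forall>N\<ge>n0. norm (LINT x|config ell N. (cmod (\<phi> N x + \<eta> N x))\<^sup>2)
        \<le> 2 * sq_norm ell \<phi> N + 2 * sq_norm ell \<eta> N"
      by (simp add: integral_nonneg_AE)
  qed
  ultimately show ?thesis using m i by (auto simp: fock_def)
qed

lemma fock_zero: "(\<lambda>N x. 0) \<in> fock ell"
  by (simp add: fock_def)

lemma fock_sum:
  fixes m :: nat
  assumes "\<And>j. j < m \<Longrightarrow> \<psi> j \<in> fock ell"
  shows "(\<lambda>N x. \<Sum>j<m. c j * \<psi> j N x) \<in> fock ell"
  using assms
proof (induction m)
  case (Suc m)
  then show ?case
    using fock_add[OF Suc.IH fock_scaled[of "\<psi> m" ell "c m"]] by simp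
qed (simp add: fock_zero)

lemma fock_inner_scaled_right:
  assumes "\<phi> \<in> fock ell" "\<eta> \<in> fock ell"
  shows "fock_inner ell \<eta> (\<lambda>N x. c * \<phi> N x) = c * fock_inner ell \<eta> \<phi>"
proof -
  have "(LINT x|config ell N. cnj (\<eta> N x) * (c * \<phi> N x)) = c * (LINT x|config ell N. cnj (\<eta> N x) * \<phi> N x)" for N
    by (simp add: mult.left_commute)
  then show ?thesis
    using suminf_mult[OF fock_inner_summable[OF assms], of c] by (simp add: fock_inner_def)
qed

lemma fock_inner_add_right:
  assumes "\<phi> \<in> fock ell" "\<phi>' \<in> fock ell" "\<eta> \<in> fock ell"
  shows "fock_inner ell \<eta> (\<lambda>N x. \<phi> N x + \<phi>' N x) = fock_inner ell \<eta> \<phi> + fock_inner ell \<eta> \<phi>'"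
  using suminf_add[OF fock_inner_summable[OF assms(1,3)] fock_inner_summable[OF assms(2,3)]] assms
  by (simp add: fock_inner_def distrib_left fock_integrable)

lemma fock_inner_sum_right:
  fixes m :: nat
  assumes "\<And>j. j < m \<Longrightarrow> \<psi> j \<in> fock ell" "\<eta> \<in> fock ell"
  shows "fock_inner ell \<eta> (\<lambda>N x. \<Sum>j<m. c j * \<psi> j N x) = (\<Sum>j<m. c j * fock_inner ell \<eta> (\<psi> j))"
  using assms
proof (induction m)
  case 0
  then show ?case by (simp add: fock_inner_def)
next
  case (Suc m)
  then show ?case
    using fock_inner_add_right[OF fock_sum[of m \<psi> ell c] fock_scaled[of "\<psi> m" ell "c m"], of \<eta>]
    by (simp add: fock_inner_scaled_right)
qed

lemma fock_inner_commute:
  assumes "\<phi> \<in> fock ell" "\<eta> \<in> fock ell"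
  shows "fock_inner ell \<phi> \<eta> = cnj (fock_inner ell \<eta> \<phi>)"
proof -
  have "cnj (LINT x|config ell N. cnj (\<eta> N x) * \<phi> N x) = (LINT x|config ell N. cnj (\<phi> N x) * \<eta> N x)" for N
    by (simp flip: Bochner_Integration.integral_cnj add: mult.commute)
  moreover have "(\<lambda>N. cnj (LINT x|config ell N. cnj (\<eta> N x) * \<phi> N x)) sums cnj (fock_inner ell \<eta> \<phi>)"
    unfolding sums_cnj fock_inner_def by (rule summable_sums[OF fock_inner_summable[OF assms]])
  ultimately show ?thesis
    by (simp add: fock_inner_def sums_unique[symmetric])
qed

lemma fock_inner_cong:
  assumes "\<phi> \<in> fock ell" "\<phi>' \<in> fock ell" "\<eta> \<in> fock ell" "fock_eq ell \<phi> \<phi>'"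
  shows "fock_inner ell \<eta> \<phi> = fock_inner ell \<eta> \<phi>'"
proof -
  have "(LINT x|config ell N. cnj (\<eta> N x) * \<phi> N x) = (LINT x|config ell N. cnj (\<eta> N x) * \<phi>' N x)" for N
  proof (rule integral_cong_AE)
    show "AE x in config ell N. cnj (\<eta> N x) * \<phi> N x = cnj (\<eta> N x) * \<phi>' N x"
      using assms(4)[unfolded fock_eq_def, rule_format, of N] by eventually_elim simp
  qed (use assms borel_measurable_integrable[OF fock_integrable] in auto)
  then show ?thesis by (simp add: fock_inner_def)
qed

section \<open>Operators on Fock space\<close>

lemma fock_operator_id: "fock_operator ell (\<lambda>\<phi>. \<phi>)"
  by (simp add: fock_operator_def fock_eq_def)

lemma fock_operator_rank_one:
  assumes "\<psi> \<in> fock ell"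
  shows "fock_operator ell (fock_scale c (rank_one_proj ell \<psi>))"
proof -
  have *: "fock_scale c (rank_one_proj ell \<psi>) \<phi> = (\<lambda>N x. (c * fock_inner ell \<psi> \<phi>) * \<psi> N x)" for \<phi>
    by (simp add: fock_scale_def rank_one_proj_def mult.assoc)
  show ?thesis
    unfolding fock_operator_def *
  proof (intro conjI ballI allI impI)
    show "fock_eq ell (\<lambda>N x. c * fock_inner ell \<psi> \<phi> * \<psi> N x) (\<lambda>N x. c * fock_inner ell \<psi> \<eta> * \<psi> N x)"
      if "\<phi> \<in> fock ell" "\<eta> \<in> fock ell" "fock_eq ell \<phi> \<eta>" for \<phi> \<eta>
      unfolding fock_inner_cong[OF that(1,2) assms that(3)] by (simp add: fock_eq_def)
    show "(\<lambda>N x. c * fock_inner ell \<psi> \<phi> * \<psi> N x) \<in> fock ell" for \<phi>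
      using assms by (rule fock_scaled)
  qed (use assms in \<open>simp_all add: fock_scaled fock_eq_def fock_inner_add_right fock_inner_scaled_right
        distrib_left distrib_right mult_ac\<close>)
qed

section \<open>Unitarity of the phase operator\<close>

lemma phase_operator_eq:
  "phase_operator ell m a \<psi> \<phi> = (\<lambda>N x. \<phi> N x +
     (\<Sum>j<m. ((exp (\<i> * complex_of_real (a j)) - 1) * fock_inner ell (\<psi> j) \<phi>) * \<psi> j N x))"
  by (simp add: phase_operator_def rank_one_proj_def mult.assoc)

lemma fock_operator_phase:
  assumes \<psi>: "\<And>j. j < m \<Longrightarrow> \<psi> j \<in> fock ell"
  shows "fock_operator ell (phase_operator ell m a \<psi>)"
  unfolding fock_operator_def
proof (intro conjI ballI allI impI)
  show "phase_operator ell m a \<psi> \<phi> \<in> fock ell" if "\<phi> \<in> fock ell" for \<phi>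
    unfolding phase_operator_eq by (intro fock_add that fock_sum \<psi>)
  show "fock_eq ell (phase_operator ell m a \<psi> \<phi>) (phase_operator ell m a \<psi> \<eta>)"
    if "\<phi> \<in> fock ell" "\<eta> \<in> fock ell" "fock_eq ell \<phi> \<eta>" for \<phi> \<eta>
  proof -
    have "(\<Sum>j<m. ((exp (\<i> * complex_of_real (a j)) - 1) * fock_inner ell (\<psi> j) \<phi>) * \<psi> j N x)
        = (\<Sum>j<m. ((exp (\<i> * complex_of_real (a j)) - 1) * fock_inner ell (\<psi> j) \<eta>) * \<psi> j N x)" for N x
      by (intro sum.cong refl) (simp add: fock_inner_cong[OF that(1,2) \<psi> that(3)])
    then show ?thesis
      using that(3) by (simp add: phase_operator_eq fock_eq_def)
  qed
  show "fock_eq ell (phase_operator ell m a \<psi> (\<lambda>N x. b * \<phi> N x + c * \<eta> N x))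
     (\<lambda>N x. b * phase_operator ell m a \<psi> \<phi> N x + c * phase_operator ell m a \<psi> \<eta> N x)"
    if "\<phi> \<in> fock ell" "\<eta> \<in> fock ell" for \<phi> \<eta> b c
  proof -
    have "fock_inner ell (\<psi> j) (\<lambda>N x. b * \<phi> N x + c * \<eta> N x)
        = b * fock_inner ell (\<psi> j) \<phi> + c * fock_inner ell (\<psi> j) \<eta>" if "j < m" for j
      using \<open>\<phi> \<in> fock ell\<close> \<open>\<eta> \<in> fock ell\<close> \<psi>[OF that]
      by (simp add: fock_inner_add_right fock_inner_scaled_right fock_scaled)
    then show ?thesis
      by (simp add: phase_operator_eq fock_eq_def algebra_simps sum_distrib_left sum.distrib sum_subtractf)
  qed
qed

text \<open>On the span of the orthonormal vectors the two operators are diagonal with eigenvalues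
  \<open>1 + c j\<close> and \<open>1 + d j\<close>, mutually inverse phases; off the span both are
  the identity. The identity holds for representatives themselves, not only up to
  \<open>fock_eq\<close>. Keeping \<open>b\<close> general makes both orders of composition
  instances.\<close>

lemma phase_operator_inverse:
  assumes \<psi>: "\<And>j. j < m \<Longrightarrow> \<psi> j \<in> fock ell"
    and on: "\<And>i j. i < m \<Longrightarrow> j < m \<Longrightarrow> fock_inner ell (\<psi> i) (\<psi> j) = (if i = j then 1 else 0)"
    and "\<phi> \<in> fock ell" and b: "\<And>j. b j = - a j"
  shows "phase_operator ell m b \<psi> (phase_operator ell m a \<psi> \<phi>) = \<phi>"
proof -
  let ?U = "phase_operator ell m a \<psi>"
  define c d where "c j = exp (\<i> * complex_of_real (a j)) - 1" and "d j = exp (\<i> * complex_of_real (b j)) - 1" for j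
  \<comment> \<open>This is \<open>(1 + c j) * (1 + d j) = 1\<close>, solved for the correction that
    the second operator adds.\<close>
  have cd: "d j * (1 + c j) = - c j" for j
    by (simp add: c_def d_def b exp_minus field_simps)
  have "fock_inner ell (\<psi> i) (?U \<phi>) = (1 + c i) * fock_inner ell (\<psi> i) \<phi>"
    if "i < m" for i
  proof -
    have "fock_inner ell (\<psi> i) (?U \<phi>)
        = fock_inner ell (\<psi> i) \<phi> + (\<Sum>j<m. (c j * fock_inner ell (\<psi> j) \<phi>) * fock_inner ell (\<psi> i) (\<psi> j))"
      unfolding phase_operator_eq c_def[symmetric]
      using \<psi> that assms(3) by (simp add: fock_inner_add_right fock_sum fock_inner_sum_right)
    also have "(\<Sum>j<m. (c j * fock_inner ell (\<psi> j) \<phi>) * fock_inner ell (\<psi> i) (\<psi> j))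
        = (\<Sum>j<m. if j = i then c j * fock_inner ell (\<psi> j) \<phi> else 0)"
      using that on by (intro sum.cong) auto
    finally show ?thesis using that by (simp add: distrib_right)
  qed
  then have "(\<Sum>j<m. (d j * fock_inner ell (\<psi> j) (?U \<phi>)) * \<psi> j N x)
      = (\<Sum>j<m. - ((c j * fock_inner ell (\<psi> j) \<phi>) * \<psi> j N x))" for N x
    using cd by (intro sum.cong) (auto simp flip: mult.assoc)
  then show ?thesis
    unfolding phase_operator_eq[of _ _ b] d_def[symmetric]
    by (simp add: phase_operator_eq sum_negf flip: c_def)
qed

lemma fock_unitary_phase:
  assumes \<psi>: "\<And>j. j < m \<Longrightarrow> \<psi> j \<in> fock ell"
    and on: "\<And>i j. i < m \<Longrightarrow> j < m \<Longrightarrow> fock_inner ell (\<psi> i) (\<psi> j) = (if i = j then 1 else 0)"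
  shows "fock_unitary ell (phase_operator ell m a \<psi>)"
  unfolding fock_unitary_def
proof (intro conjI exI[of _ "phase_operator ell m (\<lambda>j. - a j) \<psi>"] ballI)
  let ?U = "phase_operator ell m a \<psi>" and ?V = "phase_operator ell m (\<lambda>j. - a j) \<psi>"
  let ?c = "\<lambda>j. exp (\<i> * complex_of_real (a j)) - 1"
  let ?d = "\<lambda>j. exp (\<i> * complex_of_real (- a j)) - 1"
  show "fock_inner ell (?V \<eta>) \<phi> = fock_inner ell \<eta> (?U \<phi>)"
    if [simp]: "\<phi> \<in> fock ell" "\<eta> \<in> fock ell" for \<phi> \<eta>
  proof -
    have d: "cnj (?d j) = ?c j" for j by (simp add: exp_cnj)
    have V: "?V \<eta> \<in> fock ell"
      using \<psi> that unfolding phase_operator_eq by (intro fock_add fock_sum)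
    \<comment> \<open>Expansion is available in the second argument only, so
      \<open>?V \<eta>\<close> is moved there by conjugate symmetry and the terms are moved back one
      by one.\<close>
    have "fock_inner ell (?V \<eta>) \<phi>
        = cnj (fock_inner ell \<phi> (?V \<eta>))"
      by (rule fock_inner_commute[OF V that(1)])
    also have "\<dots> = cnj (fock_inner ell \<phi> \<eta>) + (\<Sum>j<m. (cnj (?d j) * cnj (fock_inner ell (\<psi> j) \<eta>)) * cnj (fock_inner ell \<phi> (\<psi> j)))"
      unfolding phase_operator_eq using \<psi>
      by (simp add: fock_inner_add_right fock_sum fock_inner_sum_right del: complex_cnj_diff)
    also have "\<dots> = fock_inner ell \<eta> \<phi> + (\<Sum>j<m. (?c j * fock_inner ell (\<psi> j) \<phi>) * fock_inner ell \<eta> (\<psi> j))"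
      unfolding d using \<psi> fock_inner_commute[OF that(2,1)] fock_inner_commute[OF _ that(1)] fock_inner_commute[OF that(2)]
      by (intro arg_cong2[where f = "(+)"] sum.cong) simp_all
    also have "\<dots> = fock_inner ell \<eta> (?U \<phi>)"
      unfolding phase_operator_eq using \<psi>
      by (simp add: fock_inner_add_right fock_sum fock_inner_sum_right)
    finally show ?thesis .
  qed
  show "fock_eq ell (?V (?U \<phi>)) \<phi>"
    "fock_eq ell (?U (?V \<phi>)) \<phi>"
    if "\<phi> \<in> fock ell" for \<phi>
    using \<psi> on that by (simp_all add: phase_operator_inverse fock_eq_def)
qed (rule fock_operator_phase; use \<psi> in simp)+

section \<open>Integration over configurations\<close>

lemma finite_interval_measure: "finite_measure (interval_measure ell)"
  by (rule finite_measureI) (simp add: interval_measure_def emeasure_restrict_space space_restrict_space emeasure_lborel_Icc_eq)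

lemma space_interval_measure [simp]: "space (interval_measure ell) = {- ell / 2..ell / 2}"
  by (simp add: interval_measure_def space_restrict_space)

lemma product_sigma_finite_interval: "product_sigma_finite (\<lambda>_. interval_measure ell)"
proof -
  interpret finite_measure "interval_measure ell" by (rule finite_interval_measure)
  show ?thesis by (simp add: product_sigma_finite_def sigma_finite_measure_axioms)
qed

lemma sigma_finite_config: "sigma_finite_measure (config ell n)"
proof -
  interpret finite_product_sigma_finite "\<lambda>_. interval_measure ell" "{..<n}"
    using product_sigma_finite_interval by (simp add: finite_product_sigma_finite_def finite_product_sigma_finite_axioms_def)
  show ?thesis unfolding config_def by (rule sigma_finite_measure_axioms)
qed

lemma space_config: "space (config ell n) = (\<Pi>\<^sub>E i\<in>{..<n}. {- ell / 2..ell / 2})"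
  by (simp add: config_def space_PiM)

lemma measurable_config_component:
  assumes "i < n"
  shows "(\<lambda>x. x i) \<in> borel_measurable (config ell n)"
proof -
  have "(\<lambda>x. x i) \<in> measurable (config ell n) (interval_measure ell)"
    using assms unfolding config_def by simp
  moreover have "(\<lambda>x. x) \<in> measurable (interval_measure ell) borel"
    by (simp add: interval_measure_def measurable_restrict_space1)
  ultimately show ?thesis by (rule measurable_compose)
qed

lemma measurable_strict_mono [measurable]:
  assumes [simp]: "p permutes {..<n}"
  shows "Measurable.pred (config ell n) (\<lambda>x. strict_mono_on {..<n} (x \<circ> p))"
proof -
  have "p r < n" if "r < n" for r using permutes_in_image[OF assms, of r] that by simp
  then have m: "(\<lambda>x. x (p r)) \<in> borel_measurable (config ell n)" if "r \<in> {..<n}" for r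
    using that by (intro measurable_config_component) simp
  have "strict_mono_on {..<n} (x \<circ> p) \<longleftrightarrow> (\<forall>r\<in>{..<n}. \<forall>s\<in>{..<n}. r < s \<longrightarrow> x (p r) < x (p s))" for x :: "nat \<Rightarrow> real"
    by (auto simp: strict_mono_on_def)
  then show ?thesis
    by (simp only:) (intro pred_intros_finite pred_intros_logic borel_measurable_pred_less finite_lessThan m borel_measurable_const)
qed

lemma measurable_strict_mono_id [measurable]:
  "Measurable.pred (config ell n) (\<lambda>x. strict_mono_on {..<n} x)"
  using measurable_strict_mono[OF permutes_id, of n ell] by simp

text \<open>A product measure is determined by its values on boxes. Permuting coordinates turns a
  box into the box with permuted sides, and all factors carry the same measure.\<close>

lemma config_perm:
  assumes p: "p permutes {..<n}"
  shows "(\<lambda>x. x \<circ> p) \<in> measurable (config ell n) (config ell n)"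
    and "distr (config ell n) (config ell n) (\<lambda>x. x \<circ> p) = config ell n"
proof -
  interpret product_sigma_finite "\<lambda>_. interval_measure ell" by (rule product_sigma_finite_interval)
  have lt: "p i < n \<longleftrightarrow> i < n" for i using permutes_in_image[OF p, of i] by simp
  have lt': "(inv_into UNIV p) i < n \<longleftrightarrow> i < n" for i using permutes_in_image[OF permutes_inv[OF p], of i] by simp
  note inverses = permutes_inverses[OF p]
  have "(\<lambda>x. \<lambda>i\<in>{..<n}. x (p i)) \<in> measurable (config ell n) (config ell n)"
    unfolding config_def by (rule measurable_restrict, rule measurable_component_singleton) (simp add: lt)
  \<comment> \<open>The restriction is harmless: points of the space are \<open>undefined\<close>
    outside \<open>{..<n}\<close>, and \<open>p\<close> fixes every index there.\<close>
  also have "?this \<longleftrightarrow> (\<lambda>x. x \<circ> p) \<in> measurable (config ell n) (config ell n)"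
    using lt by (intro measurable_cong) (auto simp: space_config PiE_def extensional_def restrict_def fun_eq_iff)
  finally show m: "(\<lambda>x. x \<circ> p) \<in> measurable (config ell n) (config ell n)" .
  show "distr (config ell n) (config ell n) (\<lambda>x. x \<circ> p) = config ell n"
    unfolding config_def
  proof (rule PiM_eqI)
    fix A :: "nat \<Rightarrow> real set" assume A: "\<And>i. i \<in> {..<n} \<Longrightarrow> A i \<in> sets (interval_measure ell)"
    have bs: "Pi\<^sub>E {..<n} A \<in> sets (config ell n)"
      unfolding config_def using A by (intro sets_PiM_I_finite) auto
    have sub: "A i \<subseteq> {- ell / 2..ell / 2}" if "i < n" for i
      using sets.sets_into_space[OF A, of i] that by simp
    have box: "(\<lambda>x. x \<circ> p) -` Pi\<^sub>E {..<n} A \<inter> space (config ell n) = Pi\<^sub>E {..<n} (\<lambda>i. A ((inv_into UNIV p) i))"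
    proof (intro Set.set_eqI iffI)
      fix x assume x: "x \<in> (\<lambda>x. x \<circ> p) -` Pi\<^sub>E {..<n} A \<inter> space (config ell n)"
      then have "x (p ((inv_into UNIV p) i)) \<in> A ((inv_into UNIV p) i)" if "i < n" for i
        using that lt' by (auto simp: PiE_def Pi_def)
      with x show "x \<in> Pi\<^sub>E {..<n} (\<lambda>i. A ((inv_into UNIV p) i))"
        by (auto simp: inverses space_config PiE_def)
    next
      fix x assume x: "x \<in> Pi\<^sub>E {..<n} (\<lambda>i. A ((inv_into UNIV p) i))"
      have "x (p i) \<in> A i" if "i < n" for i
        using x that lt PiE_mem[OF x, of "p i"] by (simp add: inverses)
      moreover have "x i \<in> {- ell / 2..ell / 2}" if "i < n" for i
        using x that lt' sub[of "(inv_into UNIV p) i"] PiE_mem[OF x, of i] by auto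
      ultimately show "x \<in> (\<lambda>x. x \<circ> p) -` Pi\<^sub>E {..<n} A \<inter> space (config ell n)"
        using x lt by (auto simp: space_config PiE_def extensional_def)
    qed
    have "emeasure (distr (config ell n) (config ell n) (\<lambda>x. x \<circ> p)) (Pi\<^sub>E {..<n} A)
        = emeasure (config ell n) (Pi\<^sub>E {..<n} (\<lambda>i. A ((inv_into UNIV p) i)))"
      by (simp only: emeasure_distr[OF m bs] box)
    also have "\<dots> = (\<Prod>i\<in>{..<n}. emeasure (interval_measure ell) (A ((inv_into UNIV p) i)))"
      unfolding config_def using A lt' by (intro emeasure_PiM) auto
    also have "\<dots> = (\<Prod>i\<in>{..<n}. emeasure (interval_measure ell) (A i))"
      by (rule prod.reindex_bij_betw[OF permutes_imp_bij[OF permutes_inv[OF p]], of "\<lambda>i. emeasure (interval_measure ell) (A i)"])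
    finally show "emeasure (distr (Pi\<^sub>M {..<n} (\<lambda>_. interval_measure ell)) (Pi\<^sub>M {..<n} (\<lambda>_. interval_measure ell)) (\<lambda>x. x \<circ> p)) (Pi\<^sub>E {..<n} A)
        = (\<Prod>i\<in>{..<n}. emeasure (interval_measure ell) (A i))"
      by (simp add: config_def)
  qed (simp_all)
qed

text \<open>Concatenation identifies the product of an \<open>N\<close>-particle and an
  \<open>M\<close>-particle configuration space with the \<open>(N + M)\<close>-particle one; again
  boxes decide.\<close>

lemma config_append:
  defines "app \<equiv> \<lambda>N M (x :: nat \<Rightarrow> real, y :: nat \<Rightarrow> real). \<lambda>i\<in>{..<N + M}. if i < N then x i else y (i - N)"
  shows "app N M \<in> measurable (config ell N \<Otimes>\<^sub>M config ell M) (config ell (N + M))"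
    and "distr (config ell N \<Otimes>\<^sub>M config ell M) (config ell (N + M)) (app N M) = config ell (N + M)"
proof -
  let ?NM = "config ell N \<Otimes>\<^sub>M config ell M"
  interpret product_sigma_finite "\<lambda>_. interval_measure ell" by (rule product_sigma_finite_interval)
  interpret M: sigma_finite_measure "config ell M" by (rule sigma_finite_config)
  show m: "app N M \<in> measurable ?NM (config ell (N + M))"
    unfolding app_def config_def case_prod_beta
  proof (rule measurable_restrict)
    fix i assume "i \<in> {..<N + M}"
    then show "(\<lambda>z. if i < N then fst z i else snd z (i - N)) \<in> measurable
        (Pi\<^sub>M {..<N} (\<lambda>_. interval_measure ell) \<Otimes>\<^sub>M Pi\<^sub>M {..<M} (\<lambda>_. interval_measure ell)) (interval_measure ell)"
      by (cases "i < N") auto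
  qed
  show "distr ?NM (config ell (N + M)) (app N M) = config ell (N + M)"
    unfolding config_def[of ell "N + M"]
  proof (rule PiM_eqI)
    fix A :: "nat \<Rightarrow> real set" assume A: "\<And>i. i \<in> {..<N + M} \<Longrightarrow> A i \<in> sets (interval_measure ell)"
    have bs: "Pi\<^sub>E {..<N + M} A \<in> sets (config ell (N + M))"
      unfolding config_def using A by (intro sets_PiM_I_finite) auto
    have sub: "A i \<subseteq> {- ell / 2..ell / 2}" if "i < N + M" for i
      using sets.sets_into_space[OF A, of i] that by simp
    have box: "app N M -` Pi\<^sub>E {..<N + M} A \<inter> space ?NM
        = Pi\<^sub>E {..<N} A \<times> Pi\<^sub>E {..<M} (\<lambda>i. A (N + i))"
    proof (intro Set.set_eqI iffI)
      fix z assume z: "z \<in> app N M -` Pi\<^sub>E {..<N + M} A \<inter> space ?NM"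
      have *: "app N M z \<in> Pi\<^sub>E {..<N + M} A" using z by simp
      have "fst z i \<in> A i" if "i < N" for i
        using PiE_mem[OF *, of i] that by (simp add: app_def case_prod_beta)
      moreover have "snd z i \<in> A (N + i)" if "i < M" for i
        using PiE_mem[OF *, of "N + i"] that by (simp add: app_def case_prod_beta)
      ultimately show "z \<in> Pi\<^sub>E {..<N} A \<times> Pi\<^sub>E {..<M} (\<lambda>i. A (N + i))"
        using z by (auto simp: space_pair_measure space_config PiE_def)
    next
      fix z assume z: "z \<in> Pi\<^sub>E {..<N} A \<times> Pi\<^sub>E {..<M} (\<lambda>i. A (N + i))"
      then have zM: "snd z \<in> Pi\<^sub>E {..<M} (\<lambda>i. A (N + i))" by auto
      have "fst z i \<in> A i" if "i < N" for i using that z by auto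
      moreover have "snd z (i - N) \<in> A i" if "i < N + M" "\<not> i < N" for i
      proof -
        have "snd z (i - N) \<in> A (N + (i - N))" using that PiE_mem[OF zM, of "i - N"] by simp
        then show ?thesis using that by simp
      qed
      moreover have "fst z i \<in> {- ell / 2..ell / 2}" if "i < N" for i
        using z that sub[of i] by auto
      moreover have "snd z i \<in> {- ell / 2..ell / 2}" if "i < M" for i
      proof -
        have "snd z i \<in> A (N + i)" using that PiE_mem[OF zM, of i] by simp
        then show ?thesis using sub[of "N + i"] that by auto
      qed
      ultimately show "z \<in> app N M -` Pi\<^sub>E {..<N + M} A \<inter> space ?NM"
        using z by (auto simp: app_def space_pair_measure space_config PiE_def extensional_def)
    qed
    have "emeasure (distr ?NM (config ell (N + M)) (app N M)) (Pi\<^sub>E {..<N + M} A)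
        = emeasure ?NM (Pi\<^sub>E {..<N} A \<times> Pi\<^sub>E {..<M} (\<lambda>i. A (N + i)))"
      by (simp only: emeasure_distr[OF m bs] box)
    also have "\<dots> = emeasure (config ell N) (Pi\<^sub>E {..<N} A) * emeasure (config ell M) (Pi\<^sub>E {..<M} (\<lambda>i. A (N + i)))"
      using A by (intro M.emeasure_pair_measure_Times) (auto simp: config_def intro!: sets_PiM_I_finite)
    also have "\<dots> = (\<Prod>i\<in>{..<N}. emeasure (interval_measure ell) (A i)) * (\<Prod>i\<in>{..<M}. emeasure (interval_measure ell) (A (N + i)))"
      unfolding config_def using A
      by (intro arg_cong2[where f = "(*)"] emeasure_PiM) auto
    also have "\<dots> = (\<Prod>i\<in>{..<N + M}. emeasure (interval_measure ell) (A i))"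
      by (induction M) (simp_all add: mult.assoc[symmetric])
    finally show "emeasure (distr ?NM (Pi\<^sub>M {..<N + M} (\<lambda>_. interval_measure ell)) (app N M)) (Pi\<^sub>E {..<N + M} A)
        = (\<Prod>i\<in>{..<N + M}. emeasure (interval_measure ell) (A i))"
      by (simp add: config_def)
  qed simp_all
qed

text \<open>Fubini for a product of functions of the first \<open>N\<close> and the last
  \<open>M\<close> coordinates, transported along concatenation.\<close>

lemma integrable_config_append:
  fixes u v :: "(nat \<Rightarrow> real) \<Rightarrow> complex"
  assumes u: "integrable (config ell N) u" and v: "integrable (config ell M) v"
  defines "h \<equiv> \<lambda>x. u (\<lambda>i\<in>{..<N}. x i) * v (\<lambda>i\<in>{..<M}. x (N + i))"
  shows "integrable (config ell (N + M)) h"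
    and "(LINT x|config ell (N + M). h x) = (LINT x|config ell N. u x) * (LINT x|config ell M. v x)"
proof -
  let ?NM = "config ell N \<Otimes>\<^sub>M config ell M"
  interpret N: sigma_finite_measure "config ell N" by (rule sigma_finite_config)
  interpret M: sigma_finite_measure "config ell M" by (rule sigma_finite_config)
  interpret pair_sigma_finite "config ell N" "config ell M" ..
  have [measurable]: "u \<in> borel_measurable (config ell N)" "v \<in> borel_measurable (config ell M)"
    using u v by simp_all
  define app where "app = (\<lambda>(x :: nat \<Rightarrow> real, y :: nat \<Rightarrow> real). \<lambda>i\<in>{..<N + M}. if i < N then x i else y (i - N))"
  note app = config_append[where N = N and M = M and ell = ell, folded app_def]
  have [measurable]: "(\<lambda>x. \<lambda>i\<in>{..<N}. x i) \<in> measurable (config ell (N + M)) (config ell N)"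
    "(\<lambda>x. \<lambda>i\<in>{..<M}. x (N + i)) \<in> measurable (config ell (N + M)) (config ell M)"
    unfolding config_def by (rule measurable_restrict, simp)+
  have hm: "h \<in> borel_measurable (config ell (N + M))" unfolding h_def by measurable
  have happ: "h (app z) = u (fst z) * v (snd z)" if "z \<in> space ?NM" for z
  proof -
    have "(\<lambda>i\<in>{..<N}. app z i) = fst z" "(\<lambda>i\<in>{..<M}. app z (N + i)) = snd z"
      using that by (auto simp: app_def space_pair_measure space_config PiE_def extensional_def fun_eq_iff case_prod_beta)
    then show ?thesis by (simp add: h_def)
  qed
  have uv: "integrable ?NM (\<lambda>z. u (fst z) * v (snd z))"
    by (rule Fubini_integrable) (use u v in \<open>auto simp: norm_mult\<close>)
  have "integrable ?NM (\<lambda>z. h (app z))"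
    using uv by (subst Bochner_Integration.integrable_cong[OF refl happ])
  then show "integrable (config ell (N + M)) h"
    using integrable_distr_eq[OF app(1) hm] app(2) by simp
  have "(LINT x|config ell (N + M). h x) = (LINT z|?NM. h (app z))"
    using integral_distr[OF app(1) hm] app(2) by simp
  also have "\<dots> = (LINT z|?NM. u (fst z) * v (snd z))"
    by (intro Bochner_Integration.integral_cong refl happ)
  also have "\<dots> = (LINT x|config ell N. u x) * (LINT x|config ell M. v x)"
    using integral_fst'[OF uv] by simp
  finally show "(LINT x|config ell (N + M). h x) = (LINT x|config ell N. u x) * (LINT x|config ell M. v x)" .
qed

lemma integral_config_perm:
  fixes h :: "(nat \<Rightarrow> real) \<Rightarrow> complex"
  assumes p: "p permutes {..<n}" and h: "h \<in> borel_measurable (config ell n)"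
  shows "(LINT x|config ell n. h (x \<circ> p)) = (LINT x|config ell n. h x)"
    and "integrable (config ell n) (\<lambda>x. h (x \<circ> p)) \<longleftrightarrow> integrable (config ell n) h"
  using integral_distr[OF config_perm(1)[OF p] h] integrable_distr_eq[OF config_perm(1)[OF p] h]
  by (simp_all add: config_perm(2)[OF p])

text \<open>Coordinate \<open>i\<close> is integrated out first: with the others fixed, the diagonal
  meets the fibre in at most the point \<open>x j\<close>, which is Lebesgue-null.\<close>

lemma AE_config_neq:
  assumes "i < n" "j < n" "i \<noteq> j"
  shows "AE x in config ell n. x i \<noteq> x j"
proof -
  interpret product_sigma_finite "\<lambda>_. interval_measure ell" by (rule product_sigma_finite_interval)
  have ins: "{..<n} = insert i ({..<n} - {i})" using assms by auto
  have m: "{x \<in> space (config ell n). x i = x j} \<in> sets (config ell n)"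
  proof -
    have [measurable]: "(\<lambda>x. x i) \<in> borel_measurable (config ell n)" "(\<lambda>x. x j) \<in> borel_measurable (config ell n)"
      using assms by (simp_all add: measurable_config_component)
    show ?thesis by measurable
  qed
  define F :: "(nat \<Rightarrow> real) \<Rightarrow> ennreal" where "F = indicator {x \<in> space (config ell n). x i = x j}"
  have F: "F \<in> borel_measurable (config ell n)" using m by (simp add: F_def)
  have "emeasure (config ell n) {x \<in> space (config ell n). x i = x j} = (\<integral>\<^sup>+x. F x \<partial>config ell n)"
    using m by (simp add: F_def)
  also have "\<dots> = (\<integral>\<^sup>+x. F x \<partial>PiM (insert i ({..<n} - {i})) (\<lambda>_. interval_measure ell))"
    by (simp only: config_def ins[symmetric])
  also have "\<dots> = (\<integral>\<^sup>+x. \<integral>\<^sup>+y. F (x(i := y)) \<partial>interval_measure ell \<partial>PiM ({..<n} - {i}) (\<lambda>_. interval_measure ell))"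
    by (rule product_nn_integral_insert) (use F in \<open>simp_all only: config_def ins[symmetric], simp_all\<close>)
  also have "\<dots> = (\<integral>\<^sup>+x. 0 \<partial>PiM ({..<n} - {i}) (\<lambda>_. interval_measure ell))"
  proof (rule nn_integral_cong)
    fix x
    have "(\<integral>\<^sup>+y. F (x(i := y)) \<partial>interval_measure ell) \<le> (\<integral>\<^sup>+y. indicator ({x j} \<inter> {- ell / 2..ell / 2}) y \<partial>interval_measure ell)"
      using assms by (intro nn_integral_mono) (auto simp: indicator_def F_def)
    also have "\<dots> = emeasure (interval_measure ell) ({x j} \<inter> {- ell / 2..ell / 2})"
    proof (rule nn_integral_indicator)
      show "{x j} \<inter> {- ell / 2..ell / 2} \<in> sets (interval_measure ell)"
        unfolding interval_measure_def sets_restrict_space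
        by (rule image_eqI[of _ _ "{x j}"]) (simp_all add: Int_commute)
    qed
    also have "\<dots> = 0"
      by (simp add: interval_measure_def emeasure_restrict_space emeasure_lborel_countable)
    finally show "(\<integral>\<^sup>+y. F (x(i := y)) \<partial>interval_measure ell) = 0" by simp
  qed
  finally have "emeasure (config ell n) {x \<in> space (config ell n). x i = x j} = 0" by simp
  then have "{x \<in> space (config ell n). x i = x j} \<in> null_sets (config ell n)"
    using m by (auto simp: null_sets_def)
  then show ?thesis by (rule AE_I') auto
qed

lemma AE_config_inj: "AE x in config ell n. inj_on x {..<n}"
proof -
  have "AE x in config ell n. \<forall>i\<in>{..<n}. \<forall>j\<in>{..<n}. i \<noteq> j \<longrightarrow> x i \<noteq> x j"
    by (simp add: AE_ball_countable AE_config_neq)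
  then show ?thesis by eventually_elim (auto simp: inj_on_def)
qed

text \<open>Sorting the indices by their values, rather than the values, yields the permutation
  directly as a list. Uniqueness: a sorted list without repetitions is determined by its set, and
  \<open>x\<close> is injective.\<close>

lemma ex1_sorting_permutation:
  fixes x :: "nat \<Rightarrow> real"
  assumes inj: "inj_on x {..<n}"
  shows "\<exists>!p. p permutes {..<n} \<and> strict_mono_on {..<n} (x \<circ> p)"
proof -
  define q where "q = sort_key x [0..<n]"
  have q: "distinct q" "set q = {..<n}" "sorted (map x q)" "length q = n"
    by (auto simp: q_def)
  define p where "p i = (if i < n then q ! i else i)" for i
  have "bij_betw ((!) q) {..<n} {..<n}"
    by (rule bij_betw_nth[OF q(1)]) (simp_all only: q)
  then have "bij_betw p {..<n} {..<n}"
    by (rule bij_betw_cong[THEN iffD1, rotated]) (simp add: p_def)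
  then have pp: "p permutes {..<n}" by (rule bij_imp_permutes) (simp add: p_def)
  have "x (q ! i) < x (q ! j)" if "i < j" "j < n" for i j
  proof -
    have "x (q ! i) \<le> x (q ! j)" using sorted_nth_mono[OF q(3), of i j] q(4) that by simp
    moreover have "q ! i \<noteq> q ! j" using q that by (simp add: nth_eq_iff_index_eq)
    then have "x (q ! i) \<noteq> x (q ! j)"
      using inj_onD[OF inj, of "q ! i" "q ! j"] q that nth_mem[of i q] nth_mem[of j q] by auto
    ultimately show ?thesis by simp
  qed
  then have sm: "strict_mono_on {..<n} (x \<circ> p)" by (auto simp: strict_mono_on_def p_def)
  have unique: "p' = p''" if p': "p' permutes {..<n}" "strict_mono_on {..<n} (x \<circ> p')"
    and p'': "p'' permutes {..<n}" "strict_mono_on {..<n} (x \<circ> p'')" for p' p''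
  proof -
    have *: "sorted (map (x \<circ> p) [0..<n]) \<and> distinct (map (x \<circ> p) [0..<n]) \<and> set (map (x \<circ> p) [0..<n]) = x ` {..<n}"
      if "p permutes {..<n}" "strict_mono_on {..<n} (x \<circ> p)" for p
    proof -
      have "sorted (map (x \<circ> p) [0..<n])"
        using that(2) by (auto simp: sorted_iff_nth_mono strict_mono_on_def le_less)
      moreover have "inj_on (x \<circ> p) {..<n}"
        using that(2) by (rule strict_mono_on_imp_inj_on)
      moreover have "(x \<circ> p) ` {..<n} = x ` {..<n}"
        by (simp only: image_comp[symmetric] permutes_image[OF that(1)])
      ultimately show ?thesis by (simp add: distinct_map atLeast0LessThan)
    qed
    have "map (x \<circ> p') [0..<n] = map (x \<circ> p'') [0..<n]"
      using *[OF p'] *[OF p''] by (intro sorted_distinct_set_unique) simp_all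
    then have eq: "x (p' i) = x (p'' i)" if "i < n" for i using that by (simp add: list_eq_iff_nth_eq)
    show "p' = p''"
    proof
      fix i show "p' i = p'' i"
      proof (cases "i < n")
        case True
        then show ?thesis
          using inj_onD[OF inj eq[OF True]] permutes_in_image[OF p'(1), of i] permutes_in_image[OF p''(1), of i] by simp
      next
        case False
        then show ?thesis using p'(1) p''(1) by (simp add: permutes_not_in)
      qed
    qed
  qed
  show ?thesis using pp sm unique by blast
qed

text \<open>A fundamental domain, up to null sets, for the permutations of the coordinates.\<close>

abbreviation chamber :: "nat \<Rightarrow> (nat \<Rightarrow> real) set" where
  "chamber n \<equiv> {x. strict_mono_on {..<n} x}"

abbreviation simplex_integrable :: "real \<Rightarrow> nat \<Rightarrow> ((nat \<Rightarrow> real) \<Rightarrow> complex) \<Rightarrow> bool" where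
  "simplex_integrable ell n f \<equiv> set_integrable (config ell n) (chamber n) f"

lemma set_integrable_simplex:
  fixes h :: "(nat \<Rightarrow> real) \<Rightarrow> complex"
  assumes "integrable (config ell n) h"
  shows "simplex_integrable ell n h"
  unfolding set_integrable_def
proof (rule Bochner_Integration.integrable_bound[OF assms])
  show "(\<lambda>x. indicat_real (chamber n) x *\<^sub>R h x) \<in> borel_measurable (config ell n)"
    using borel_measurable_integrable[OF assms] by measurable
qed (auto simp: indicator_def)

text \<open>Almost every configuration has distinct coordinates and hence exactly one sorting
  permutation, so the indicators of the permuted chambers sum to 1 almost everywhere.\<close>

lemma integral_config_simplex:
  fixes h :: "(nat \<Rightarrow> real) \<Rightarrow> complex"
  assumes h: "integrable (config ell n) h"
  shows "(LINT x|config ell n. h x) = (\<Sum>p | p permutes {..<n}. LINT x:chamber n|config ell n. h (x \<circ> p))"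
proof -
  let ?chi = "\<lambda>x. indicat_real (chamber n) x"
  let ?P = "{p. p permutes {..<n}}"
  have [measurable]: "h \<in> borel_measurable (config ell n)" using h by simp
  have fin: "finite ?P" by (simp add: finite_permutations)
  have int: "integrable (config ell n) (\<lambda>x. ?chi (x \<circ> p) *\<^sub>R h x)" if "p \<in> ?P" for p
  proof (rule Bochner_Integration.integrable_bound[OF h])
    have [measurable]: "(\<lambda>x. ?chi (x \<circ> p)) \<in> borel_measurable (config ell n)"
    proof -
      have [measurable]: "Measurable.pred (config ell n) (\<lambda>x. strict_mono_on {..<n} (x \<circ> p))"
        using that by (intro measurable_strict_mono) simp
      have "(\<lambda>x. ?chi (x \<circ> p)) = indicat_real {x. strict_mono_on {..<n} (x \<circ> p)}"
        by (simp add: indicator_def fun_eq_iff)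
      then show ?thesis by simp
    qed
    show "(\<lambda>x. ?chi (x \<circ> p) *\<^sub>R h x) \<in> borel_measurable (config ell n)"
      by measurable
  qed (auto simp: indicator_def)
  have "(LINT x|config ell n. h x) = (LINT x|config ell n. (\<Sum>p\<in>?P. ?chi (x \<circ> p) *\<^sub>R h x))"
  proof (rule integral_cong_AE)
    show "AE x in config ell n. h x = (\<Sum>p\<in>?P. ?chi (x \<circ> p) *\<^sub>R h x)"
      using AE_config_inj
    proof eventually_elim
      fix x :: "nat \<Rightarrow> real" assume "inj_on x {..<n}"
      then obtain p where p: "p permutes {..<n}" "strict_mono_on {..<n} (x \<circ> p)"
        and u: "\<And>q. q permutes {..<n} \<Longrightarrow> strict_mono_on {..<n} (x \<circ> q) \<Longrightarrow> q = p"
        using ex1_sorting_permutation by blast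
      have "(\<Sum>q\<in>?P. ?chi (x \<circ> q) *\<^sub>R h x) = (\<Sum>q\<in>?P. if q = p then h x else 0)"
      proof (rule sum.cong[OF refl])
        fix q assume "q \<in> ?P"
        then show "?chi (x \<circ> q) *\<^sub>R h x = (if q = p then h x else 0)"
          using u[of q] p by (cases "strict_mono_on {..<n} (x \<circ> q)") auto
      qed
      then show "h x = (\<Sum>q\<in>?P. ?chi (x \<circ> q) *\<^sub>R h x)"
        using p fin by simp
    qed
    show "(\<lambda>x. \<Sum>p\<in>?P. ?chi (x \<circ> p) *\<^sub>R h x) \<in> borel_measurable (config ell n)"
      by (intro borel_measurable_sum borel_measurable_integrable int)
  qed simp
  also have "\<dots> = (\<Sum>p\<in>?P. LINT x|config ell n. ?chi (x \<circ> p) *\<^sub>R h x)"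
    by (intro Bochner_Integration.integral_sum int)
  \<comment> \<open>Invariance of the measure moves the permutation from the indicator to
    \<open>h\<close> as an inverse, which disappears in the sum over the whole group.\<close>
  also have "\<dots> = (\<Sum>p\<in>?P. LINT x|config ell n. ?chi x *\<^sub>R h (x \<circ> (inv_into UNIV p)))"
  proof (rule sum.cong[OF refl])
    fix p assume "p \<in> ?P"
    then have p: "p permutes {..<n}" by simp
    have [measurable]: "(\<lambda>x. x \<circ> (inv_into UNIV p)) \<in> measurable (config ell n) (config ell n)"
      by (rule config_perm(1)[OF permutes_inv[OF p]])
    have "(\<lambda>x. ?chi x *\<^sub>R h (x \<circ> (inv_into UNIV p))) \<in> borel_measurable (config ell n)"
      by measurable
    from integral_config_perm(1)[OF p this]
    show "(LINT x|config ell n. ?chi (x \<circ> p) *\<^sub>R h x)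
        = (LINT x|config ell n. ?chi x *\<^sub>R h (x \<circ> (inv_into UNIV p)))"
      by (simp add: comp_assoc permutes_inv_o[OF p])
  qed
  also have "\<dots> = (\<Sum>p\<in>?P. LINT x|config ell n. ?chi x *\<^sub>R h (x \<circ> p))"
    by (rule sum_permutations_inverse[symmetric])
  finally show ?thesis by (simp add: set_lebesgue_integral_def)
qed

text \<open>The source of the factorials: all \<open>fact n\<close> chambers contribute equally.
  Symmetry is asked for almost everywhere only, as this is all that \<open>fock\<close>
  provides.\<close>

lemma integral_config_symmetric:
  fixes h :: "(nat \<Rightarrow> real) \<Rightarrow> complex"
  assumes h: "integrable (config ell n) h"
    and sym: "\<And>p. p permutes {..<n} \<Longrightarrow> AE x in config ell n. h (x \<circ> p) = h x"
  shows "(LINT x|config ell n. h x) = fact n * (LINT x:chamber n|config ell n. h x)"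
proof -
  have [measurable]: "h \<in> borel_measurable (config ell n)" using h by simp
  have "(LINT x:chamber n|config ell n. h (x \<circ> p)) = (LINT x:chamber n|config ell n. h x)"
    if "p permutes {..<n}" for p
    unfolding set_lebesgue_integral_def
  proof (rule integral_cong_AE)
    have [measurable]: "(\<lambda>x. x \<circ> p) \<in> measurable (config ell n) (config ell n)"
      by (rule config_perm(1)[OF that])
    show "(\<lambda>x. indicat_real (chamber n) x *\<^sub>R h (x \<circ> p)) \<in> borel_measurable (config ell n)"
      by measurable
    show "(\<lambda>x. indicat_real (chamber n) x *\<^sub>R h x) \<in> borel_measurable (config ell n)"
      by measurable
    show "AE x in config ell n. indicat_real (chamber n) x *\<^sub>R h (x \<circ> p) = indicat_real (chamber n) x *\<^sub>R h x"
      using sym[OF that] by eventually_elim simp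
  qed
  then show ?thesis
    by (simp add: integral_config_simplex[OF h] card_permutations)
qed

section \<open>Interleavings of ket and bra positions\<close>

definition positions :: "leg \<Rightarrow> leg list \<Rightarrow> nat list" where
  "positions s \<alpha> = filter (\<lambda>i. \<alpha> ! i = s) [0..<length \<alpha>]"

text \<open>The (N, M)-shuffles, encoded as words in the two legs.\<close>

definition shuffles_of :: "nat \<Rightarrow> nat \<Rightarrow> leg list set" where
  "shuffles_of N M = {\<alpha>. length \<alpha> = N + M \<and> Adj \<notin> set \<alpha> \<and> length (positions Left \<alpha>) = N}"

text \<open>The shuffle as a permutation: it sends the first block of indices to the left positions
  and the second block to the right positions, both in increasing order. Beyond the length it is the
  identity, as \<open>permutes\<close> demands.\<close>

definition shuffle_perm :: "leg list \<Rightarrow> nat \<Rightarrow> nat" where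
  "shuffle_perm \<alpha> i = (if i < length \<alpha> then (positions Left \<alpha> @ positions Right \<alpha>) ! i else i)"

lemma set_positions: "set (positions s \<alpha>) = {i. i < length \<alpha> \<and> \<alpha> ! i = s}"
  by (auto simp: positions_def)

lemma sorted_positions: "sorted_wrt (<) (positions s \<alpha>)"
  unfolding positions_def by (intro sorted_wrt_filter) simp

lemma distinct_positions: "distinct (positions s \<alpha>)"
  by (simp add: positions_def)

lemma leg_exhaust: "s = Left \<or> s = Right \<or> s = Adj"
  by (cases s) auto

lemma positions_append:
  assumes "Adj \<notin> set \<alpha>"
  shows "set (positions Left \<alpha> @ positions Right \<alpha>) = {..<length \<alpha>}"
    and "distinct (positions Left \<alpha> @ positions Right \<alpha>)"
    and "length (positions Left \<alpha> @ positions Right \<alpha>) = length \<alpha>"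
proof -
  have "\<alpha> ! i = Left \<or> \<alpha> ! i = Right" if "i < length \<alpha>" for i
    using leg_exhaust[of "\<alpha> ! i"] nth_mem[OF that] assms by metis
  then show s: "set (positions Left \<alpha> @ positions Right \<alpha>) = {..<length \<alpha>}"
    by (auto simp: set_positions)
  show d: "distinct (positions Left \<alpha> @ positions Right \<alpha>)"
    by (auto simp: set_positions distinct_positions)
  show "length (positions Left \<alpha> @ positions Right \<alpha>) = length \<alpha>"
    using distinct_card[OF d] s by simp
qed

lemma shuffles_of_right:
  "\<alpha> \<in> shuffles_of N M \<Longrightarrow> length (positions Right \<alpha>) = M"
  using positions_append(3)[of \<alpha>] by (simp add: shuffles_of_def)

lemma shuffle_perm_nth:
  assumes "\<alpha> \<in> shuffles_of N M"
  shows "i < N \<Longrightarrow> shuffle_perm \<alpha> i = positions Left \<alpha> ! i"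
    and "i < M \<Longrightarrow> shuffle_perm \<alpha> (N + i) = positions Right \<alpha> ! i"
  using assms by (auto simp: shuffle_perm_def shuffles_of_def nth_append)

lemma shuffle_perm_permutes:
  assumes "\<alpha> \<in> shuffles_of N M"
  shows "shuffle_perm \<alpha> permutes {..<N + M}"
proof -
  have a: "Adj \<notin> set \<alpha>" "length \<alpha> = N + M" using assms by (auto simp: shuffles_of_def)
  note p = positions_append[OF a(1)]
  have "bij_betw ((!) (positions Left \<alpha> @ positions Right \<alpha>)) {..<N + M} {..<N + M}"
    by (rule bij_betw_nth[OF p(2)]) (simp_all only: p a)
  then have "bij_betw (shuffle_perm \<alpha>) {..<N + M} {..<N + M}"
    by (rule bij_betw_cong[THEN iffD1, rotated]) (simp add: shuffle_perm_def a)
  then show ?thesis by (rule bij_imp_permutes) (simp add: shuffle_perm_def a)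
qed

lemma shuffle_perm_mono:
  assumes "\<alpha> \<in> shuffles_of N M"
  shows "strict_mono_on {..<N} (shuffle_perm \<alpha>)"
    and "strict_mono_on {..<M} (\<lambda>i. shuffle_perm \<alpha> (N + i))"
proof -
  have "length (positions Left \<alpha>) = N" "length (positions Right \<alpha>) = M"
    using assms shuffles_of_right by (auto simp: shuffles_of_def)
  then show "strict_mono_on {..<N} (shuffle_perm \<alpha>)" "strict_mono_on {..<M} (\<lambda>i. shuffle_perm \<alpha> (N + i))"
    using sorted_wrt_nth_less[OF sorted_positions]
    by (auto simp: strict_mono_on_def shuffle_perm_nth[OF assms])
qed

text \<open>A permutation that increases on both blocks is determined by the image of the first
  block, and this image is the set of left positions of the word, an arbitrary set of
  \<open>N\<close> indices.\<close>

lemma bij_betw_shuffle_perm: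
  "bij_betw shuffle_perm (shuffles_of N M)
     {p. p permutes {..<N + M} \<and> strict_mono_on {..<N} p \<and> strict_mono_on {..<M} (\<lambda>i. p (N + i))}"
  (is "bij_betw _ ?A ?S")
proof (rule bij_betwI')
  fix \<alpha> \<beta> assume A: "\<alpha> \<in> ?A" "\<beta> \<in> ?A"
  show "(shuffle_perm \<alpha> = shuffle_perm \<beta>) = (\<alpha> = \<beta>)"
  proof
    assume eq: "shuffle_perm \<alpha> = shuffle_perm \<beta>"
    have im: "set (positions Left \<gamma>) = shuffle_perm \<gamma> ` {..<N}" if "\<gamma> \<in> ?A" for \<gamma>
      using shuffle_perm_nth(1)[OF that] that by (force simp: set_conv_nth shuffles_of_def image_iff)
    have len: "length \<alpha> = N + M" "length \<beta> = N + M" "Adj \<notin> set \<alpha>" "Adj \<notin> set \<beta>"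
      using A by (auto simp: shuffles_of_def)
    have "set (positions Left \<alpha>) = set (positions Left \<beta>)" using im A eq by simp
    then have L: "\<alpha> ! i = Left \<longleftrightarrow> \<beta> ! i = Left" if "i < N + M" for i
      using that len by (auto simp: set_positions set_eq_iff)
    show "\<alpha> = \<beta>"
    proof (rule nth_equalityI)
      fix i assume i: "i < length \<alpha>"
      then have "\<alpha> ! i \<noteq> Adj" "\<beta> ! i \<noteq> Adj" using len by (auto simp: in_set_conv_nth)
      with L[of i] i len show "\<alpha> ! i = \<beta> ! i"
        using leg_exhaust[of "\<alpha> ! i"] leg_exhaust[of "\<beta> ! i"] by auto
    qed (simp add: len)
  qed simp
next
  fix \<alpha> assume "\<alpha> \<in> ?A"
  then show "shuffle_perm \<alpha> \<in> ?S" using shuffle_perm_permutes shuffle_perm_mono by blast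
next
  fix p assume "p \<in> ?S"
  then have p: "p permutes {..<N + M}" "strict_mono_on {..<N} p" "strict_mono_on {..<M} (\<lambda>i. p (N + i))"
    by auto
  have lt: "p i < N + M \<longleftrightarrow> i < N + M" for i using permutes_in_image[OF p(1), of i] by simp
  define q where "q = inv_into UNIV p"
  have pq: "p (q i) = i" "q (p i) = i" for i using permutes_inverses[OF p(1)] by (auto simp: q_def)
  have ltq: "q i < N + M \<longleftrightarrow> i < N + M" for i using lt[of "q i"] by (simp add: pq)
  \<comment> \<open>The letter at \<open>i\<close> records which block the inverse permutation sends
    \<open>i\<close> to.\<close>
  define \<alpha> where "\<alpha> = map (\<lambda>i. if q i < N then Left else Right) [0..<N + M]"
  have len: "length \<alpha> = N + M" and nth: "\<And>i. i < N + M \<Longrightarrow> \<alpha> ! i = (if q i < N then Left else Right)"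
    by (auto simp: \<alpha>_def)
  have L: "positions Left \<alpha> = map p [0..<N]"
  \<comment> \<open>Both lists are strictly increasing, so comparing their sets is enough.\<close>
  proof (rule strict_sorted_equal[OF sorted_positions, symmetric])
    show "sorted_wrt (<) (map p [0..<N])"
      using p(2) by (auto simp: sorted_wrt_iff_nth_less strict_mono_on_def)
    show "set (map p [0..<N]) = set (positions Left \<alpha>)"
    proof (intro Set.set_eqI iffI)
      fix i assume "i \<in> set (positions Left \<alpha>)"
      then have "i < N + M" "q i < N" by (auto simp: set_positions len nth split: if_splits)
      then show "i \<in> set (map p [0..<N])" using pq(1)[of i] by (auto intro!: image_eqI[of _ _ "q i"])
    next
      fix i assume "i \<in> set (map p [0..<N])"
      then obtain k where k: "k < N" "i = p k" by auto
      moreover have "i < N + M" using k lt by simp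
      ultimately show "i \<in> set (positions Left \<alpha>)"
        by (simp add: set_positions len nth pq)
    qed
  qed
  have R: "positions Right \<alpha> = map (\<lambda>i. p (N + i)) [0..<M]"
  proof (rule strict_sorted_equal[OF sorted_positions, symmetric])
    show "sorted_wrt (<) (map (\<lambda>i. p (N + i)) [0..<M])"
      using p(3) by (auto simp: sorted_wrt_iff_nth_less strict_mono_on_def)
    show "set (map (\<lambda>i. p (N + i)) [0..<M]) = set (positions Right \<alpha>)"
    proof (intro Set.set_eqI iffI)
      fix i assume "i \<in> set (positions Right \<alpha>)"
      then have i: "i < N + M" "\<not> q i < N" by (auto simp: set_positions len nth split: if_splits)
      then have "p (N + (q i - N)) = i" "q i - N < M" using ltq[of i] by (auto simp: pq)
      then show "i \<in> set (map (\<lambda>i. p (N + i)) [0..<M])"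
        by (auto intro!: image_eqI[of _ _ "q i - N"])
    next
      fix i assume "i \<in> set (map (\<lambda>i. p (N + i)) [0..<M])"
      then obtain k where k: "k < M" "i = p (N + k)" by auto
      moreover have "i < N + M" using k lt by simp
      ultimately show "i \<in> set (positions Right \<alpha>)"
        by (simp add: set_positions len nth pq)
    qed
  qed
  have A: "\<alpha> \<in> ?A" by (auto simp: shuffles_of_def len L) (auto simp: \<alpha>_def split: if_splits)
  have "p i = shuffle_perm \<alpha> i" for i
  proof (cases "i < N + M")
    case True
    then show ?thesis by (auto simp: shuffle_perm_def len L R nth_append)
  next
    case False
    then show ?thesis using p(1) by (simp add: shuffle_perm_def len permutes_not_in)
  qed
  with A show "\<exists>\<alpha>\<in>?A. p = shuffle_perm \<alpha>" by blast
qed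

lemma set_integral_if:
  fixes f :: "'a \<Rightarrow> 'b :: {banach, second_countable_topology}"
  shows "(LINT x:S|M. (if c then f x else 0)) = (if c then LINT x:S|M. f x else 0)"
  by (simp add: set_lebesgue_integral_def)

text \<open>The product of the two small simplices is written as one integral over the cube of
  \<open>N + M\<close> coordinates and decomposed into chambers. A point of the large chamber,
  permuted by \<open>p\<close>, lies in the product of the small simplices exactly if
  \<open>p\<close> is a shuffle, so the other permutations drop out.\<close>

lemma integral_shuffles:
  fixes u v :: "(nat \<Rightarrow> real) \<Rightarrow> complex"
  assumes u: "integrable (config ell N) u" and v: "integrable (config ell M) v"
  defines "g \<equiv> \<lambda>\<alpha> x. u (\<lambda>i\<in>{..<N}. x (positions Left \<alpha> ! i)) * v (\<lambda>i\<in>{..<M}. x (positions Right \<alpha> ! i))"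
  shows "\<alpha> \<in> shuffles_of N M \<Longrightarrow> simplex_integrable ell (N + M) (g \<alpha>)"
    and "(\<Sum>\<alpha>\<in>shuffles_of N M. LINT x:chamber (N + M)|config ell (N + M). g \<alpha> x)
      = (LINT x:chamber N|config ell N. u x) * (LINT x:chamber M|config ell M. v x)"
proof -
  have g: "g \<alpha> x = u (\<lambda>i\<in>{..<N}. (x \<circ> shuffle_perm \<alpha>) i) * v (\<lambda>i\<in>{..<M}. (x \<circ> shuffle_perm \<alpha>) (N + i))"
    if "\<alpha> \<in> shuffles_of N M" for \<alpha> x
    by (simp add: g_def shuffle_perm_nth[OF that] cong: restrict_cong)
  show "simplex_integrable ell (N + M) (g \<alpha>)" if "\<alpha> \<in> shuffles_of N M"
  proof (rule set_integrable_simplex)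
    note i = integrable_config_append(1)[OF u v]
    have "g \<alpha> = (\<lambda>x. u (\<lambda>i\<in>{..<N}. (x \<circ> shuffle_perm \<alpha>) i) * v (\<lambda>i\<in>{..<M}. (x \<circ> shuffle_perm \<alpha>) (N + i)))"
      using g[OF that] by (rule ext)
    then show "integrable (config ell (N + M)) (g \<alpha>)"
      using integral_config_perm(2)[OF shuffle_perm_permutes[OF that] borel_measurable_integrable[OF i]] i
      by (simp only:)
  qed
  let ?I = "\<lambda>f. LINT x:chamber (N + M)|config ell (N + M). f x :: complex"
  let ?u = "\<lambda>x. indicat_real (chamber N) x *\<^sub>R u x"
  let ?v = "\<lambda>x. indicat_real (chamber M) x *\<^sub>R v x"
  \<comment> \<open>The two small simplices enter as cut-offs on the first \<open>N\<close> and the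
    last \<open>M\<close> coordinates.\<close>
  let ?h = "\<lambda>x. ?u (\<lambda>i\<in>{..<N}. x i) * ?v (\<lambda>i\<in>{..<M}. x (N + i))"
  let ?g = "\<lambda>p x. u (\<lambda>i\<in>{..<N}. (x \<circ> p) i) * v (\<lambda>i\<in>{..<M}. (x \<circ> p) (N + i))"
  let ?P = "{p. p permutes {..<N + M}}"
  let ?Q = "\<lambda>p. strict_mono_on {..<N} p \<and> strict_mono_on {..<M} (\<lambda>i. p (N + i))"
  have iu: "integrable (config ell N) ?u" and iv: "integrable (config ell M) ?v"
    using set_integrable_simplex[OF u] set_integrable_simplex[OF v] by (simp_all add: set_integrable_def)
  have "?I (\<lambda>x. ?h (x \<circ> p))
     = (if ?Q p then ?I (?g p) else 0)" if "p \<in> ?P" for p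
  proof -
    have lt: "p i < N + M \<longleftrightarrow> i < N + M" for i using permutes_in_image[of p "{..<N + M}" i] that by simp
    have eq: "?h (x \<circ> p) = (if ?Q p then ?g p x else 0)" if x: "x \<in> chamber (N + M)" for x
    proof -
      \<comment> \<open>On the large chamber values are ordered like indices, so the cut-offs become
        conditions on \<open>p\<close> alone and leave the integral.\<close>
      have x_less: "x (p i) < x (p j) \<longleftrightarrow> p i < p j" if "i < N + M" "j < N + M" for i j
        using strict_mono_on_less[of "{..<N + M}" x "p i" "p j"] x that lt by simp
      have 1: "strict_mono_on {..<N} (\<lambda>i\<in>{..<N}. (x \<circ> p) i) \<longleftrightarrow> strict_mono_on {..<N} p"
        using x_less by (auto simp: strict_mono_on_def)
      have 2: "strict_mono_on {..<M} (\<lambda>i\<in>{..<M}. (x \<circ> p) (N + i)) \<longleftrightarrow> strict_mono_on {..<M} (\<lambda>i. p (N + i))"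
        using x_less by (auto simp: strict_mono_on_def)
      show ?thesis using 1 2 by (auto simp: indicator_def)
    qed
    have "indicat_real (chamber (N + M)) x *\<^sub>R ?h (x \<circ> p)
        = indicat_real (chamber (N + M)) x *\<^sub>R (if ?Q p then ?g p x else 0)" for x
      by (cases "x \<in> chamber (N + M)") (simp_all only: eq indicator_simps scaleR_zero_left not_False_eq_True)
    then have *: "?I (\<lambda>x. ?h (x \<circ> p))
       = ?I (\<lambda>x. if ?Q p then ?g p x else 0)"
      unfolding set_lebesgue_integral_def by (simp only:)
    show ?thesis unfolding * by (rule set_integral_if)
  qed
  then have "(LINT x|config ell (N + M). ?h x)
      = (\<Sum>p\<in>?P. if ?Q p then ?I (?g p) else 0)"
    unfolding integral_config_simplex[OF integrable_config_append(1)[OF iu iv]] by (intro sum.cong refl)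
  also have "\<dots> = (\<Sum>p\<in>{p \<in> ?P. ?Q p}. ?I (?g p))"
    by (rule sum.inter_filter[symmetric]) (simp add: finite_permutations)
  also have "\<dots> = (\<Sum>\<alpha>\<in>shuffles_of N M. ?I (?g (shuffle_perm \<alpha>)))"
    using sum.reindex_bij_betw[OF bij_betw_shuffle_perm[of N M], of "\<lambda>p. ?I (?g p)"]
    by (simp add: conj_ac)
  also have "\<dots> = (\<Sum>\<alpha>\<in>shuffles_of N M. ?I (g \<alpha>))"
    by (intro sum.cong refl) (simp only: g)
  finally show "(\<Sum>\<alpha>\<in>shuffles_of N M. ?I (g \<alpha>))
      = (LINT x:chamber N|config ell N. u x) * (LINT x:chamber M|config ell M. v x)"
    using integrable_config_append(2)[OF iu iv] by (simp add: set_lebesgue_integral_def)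
qed

section \<open>Matrix entries and Kronecker products\<close>

lemma mat_mult_entry:
  fixes A B :: "'a :: semiring_0 mat"
  assumes "A \<in> carrier_mat n m" "B \<in> carrier_mat m p" "i < n" "j < p"
  shows "(A * B) $$ (i, j) = (\<Sum>k<m. A $$ (i, k) * B $$ (k, j))"
  using assms by (auto simp: scalar_prod_def atLeast0LessThan intro!: sum.cong)

text \<open>The flat index of a Kronecker product encodes a pair of indices; the range is cut into
  blocks of length \<open>m\<close>.\<close>

lemma sum_div_mod:
  fixes f :: "nat \<Rightarrow> nat \<Rightarrow> 'a :: comm_monoid_add"
  shows "(\<Sum>k<n * m. f (k div m) (k mod m)) = (\<Sum>p<n. \<Sum>q<m. f p q)"
proof -
  have "(\<Sum>k<n * m. f (k div m) (k mod m)) = (\<Sum>p<n. \<Sum>k=p*m..<p*m+m. f (k div m) (k mod m))"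
    by (rule sum.nat_group[symmetric])
  also have "\<dots> = (\<Sum>p<n. \<Sum>q<m. f p q)"
  proof (rule sum.cong[OF refl])
    fix p
    have "(\<Sum>k=p*m..<p*m+m. f (k div m) (k mod m)) = (\<Sum>q=0..<m. f ((q + p*m) div m) ((q + p*m) mod m))"
      using sum.shift_bounds_nat_ivl[of "\<lambda>k. f (k div m) (k mod m)" 0 "p * m" m] by (simp add: add.commute)
    also have "\<dots> = (\<Sum>q<m. f p q)"
      by (intro sum.cong) auto
    finally show "(\<Sum>k=p*m..<p*m+m. f (k div m) (k mod m)) = (\<Sum>q<m. f p q)" .
  qed
  finally show ?thesis .
qed

lemma div_mod_less:
  assumes "i < n * (m :: nat)" shows "i div m < n" "i mod m < m"
proof -
  show "i div m < n" using assms by (simp add: less_mult_imp_div_less)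
  show "i mod m < m" using assms by (cases "m = 0") auto
qed

lemma kron_carrier [simp]:
  "A \<in> carrier_mat n m \<Longrightarrow> B \<in> carrier_mat p q \<Longrightarrow> kron A B \<in> carrier_mat (n * p) (m * q)"
  by (auto simp: kron_def)

lemma kron_entry:
  assumes "A \<in> carrier_mat n m" "B \<in> carrier_mat p q" "i < n * p" "j < m * q"
  shows "kron A B $$ (i, j) = A $$ (i div p, j div q) * B $$ (i mod p, j mod q)"
  using assms by (auto simp: kron_def)

text \<open>The mixed-product rule. It keeps ket and bra tensors in separate factors, so that a word
  in both kinds splits.\<close>

lemma kron_mult:
  assumes "A \<in> carrier_mat n m" "C \<in> carrier_mat m k" "B \<in> carrier_mat p q" "E \<in> carrier_mat q r"
  shows "kron A B * kron C E = kron (A * C) (B * E)"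
proof (rule eq_matI)
  have AC: "A * C \<in> carrier_mat n k" "B * E \<in> carrier_mat p r" using assms by auto
  fix i j assume "i < dim_row (kron (A * C) (B * E))" "j < dim_col (kron (A * C) (B * E))"
  then have ij: "i < n * p" "j < k * r" using assms by (auto simp: kron_def)
  note dm = div_mod_less[OF ij(1)] div_mod_less[OF ij(2)]
  have "(kron A B * kron C E) $$ (i, j) = (\<Sum>l<m * q. kron A B $$ (i, l) * kron C E $$ (l, j))"
    using assms ij by (intro mat_mult_entry) auto
  also have "\<dots> = (\<Sum>l<m * q. (A $$ (i div p, l div q) * C $$ (l div q, j div r)) * (B $$ (i mod p, l mod q) * E $$ (l mod q, j mod r)))"
    using assms ij by (intro sum.cong refl) (simp add: kron_entry[where n = n and m = m and p = p and q = q] kron_entry[where n = m and m = k and p = q and q = r])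
  also have "\<dots> = (\<Sum>s<m. \<Sum>t<q. (A $$ (i div p, s) * C $$ (s, j div r)) * (B $$ (i mod p, t) * E $$ (t, j mod r)))"
    by (rule sum_div_mod)
  also have "\<dots> = (A * C) $$ (i div p, j div r) * (B * E) $$ (i mod p, j mod r)"
    using mat_mult_entry[OF assms(1,2) dm(1,3)] mat_mult_entry[OF assms(3,4) dm(2,4)] by (simp add: sum_product)
  also have "\<dots> = kron (A * C) (B * E) $$ (i, j)"
    using kron_entry[OF AC ij] by simp
  finally show "(kron A B * kron C E) $$ (i, j) = kron (A * C) (B * E) $$ (i, j)" .
qed (use assms in \<open>auto simp: kron_def\<close>)

lemma mat_trace_kron:
  assumes "A \<in> carrier_mat n n" "B \<in> carrier_mat m m"
  shows "mat_trace (kron A B) = mat_trace A * mat_trace B"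
proof -
  have "mat_trace (kron A B) = (\<Sum>i<n * m. A $$ (i div m, i div m) * B $$ (i mod m, i mod m))"
    using assms by (auto simp: mat_trace_def kron_def intro!: sum.cong)
  also have "\<dots> = (\<Sum>s<n. \<Sum>t<m. A $$ (s, s) * B $$ (t, t))" by (rule sum_div_mod)
  finally show ?thesis using assms by (simp add: mat_trace_def sum_product)
qed

lemma kron_one: "kron (1\<^sub>m n) (1\<^sub>m m) = 1\<^sub>m (n * m)"
proof (rule eq_matI)
  fix i j assume ij: "i < dim_row (1\<^sub>m (n * m) :: complex mat)" "j < dim_col (1\<^sub>m (n * m) :: complex mat)"
  then have *: "i < n * m" "j < n * m" by auto
  have "i = j \<longleftrightarrow> i div m = j div m \<and> i mod m = j mod m" by (metis div_mult_mod_eq)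
  with * show "kron (1\<^sub>m n) (1\<^sub>m m) $$ (i, j) = 1\<^sub>m (n * m) $$ (i, j)"
    using div_mod_less[OF *(1)] div_mod_less[OF *(2)] by (auto simp: kron_def)
qed (auto simp: kron_def)

section \<open>The product rule for indefinite integrals\<close>

lemma set_integral_sum_of:
  fixes f :: "'i \<Rightarrow> 'a \<Rightarrow> 'b :: {banach, second_countable_topology}"
  assumes "\<And>k. k \<in> K \<Longrightarrow> set_integrable M S (f k)"
  shows "(LINT t:S|M. (\<Sum>k\<in>K. f k t)) = (\<Sum>k\<in>K. LINT t:S|M. f k t)"
  using assms by (simp add: set_lebesgue_integral_def set_integrable_def scaleR_sum_right)

text \<open>Integration by parts for functions that are only integrable, hence without derivatives:
  the integral of \<open>f s * g t\<close> over the square is \<open>F b * G b\<close>, and Fubini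
  on the two triangles at the diagonal gives the two summands.\<close>

lemma integral_product_rule:
  fixes f g :: "real \<Rightarrow> 'a :: {real_normed_field, banach, second_countable_topology}"
  assumes f: "set_integrable lborel {a..b} f" and g: "set_integrable lborel {a..b} g"
  defines "F \<equiv> \<lambda>t. LINT s:{a..t}|lborel. f s" and "G \<equiv> \<lambda>t. LINT s:{a..t}|lborel. g s"
  shows "set_integrable lborel {a..b} (\<lambda>t. f t * G t)"
    and "set_integrable lborel {a..b} (\<lambda>t. F t * g t)"
    and "(LINT t:{a..b}|lborel. f t * G t) + (LINT t:{a..b}|lborel. F t * g t) = F b * G b"
proof -
  \<comment> \<open>Extension by zero lets Fubini run over the whole plane, all limits of
    integration being carried by indicators.\<close>
  define f0 where "f0 t = indicator {a..b} t *\<^sub>R f t" for t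
  define g0 where "g0 t = indicator {a..b} t *\<^sub>R g t" for t
  have fi: "integrable lborel f0" and gi: "integrable lborel g0"
    using f g by (simp_all add: set_integrable_def f0_def[abs_def] g0_def[abs_def])
  have [measurable]: "f0 \<in> borel_measurable borel" "g0 \<in> borel_measurable borel"
    using borel_measurable_integrable[OF fi] borel_measurable_integrable[OF gi] by simp_all
  let ?h = "\<lambda>s t. f0 s * g0 t"
  have h: "integrable (lborel \<Otimes>\<^sub>M lborel) (\<lambda>(s, t). ?h s t)"
    by (rule lborel_pair.Fubini_integrable) (use fi gi in \<open>auto simp: norm_mult\<close>)
  \<comment> \<open>The two triangles, with the diagonal assigned to the first.\<close>
  let ?h1 = "\<lambda>s t. indicator {..t} s *\<^sub>R ?h s t" and ?h2 = "\<lambda>s t. indicator {..<s} t *\<^sub>R ?h s t"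
  have h1: "integrable (lborel \<Otimes>\<^sub>M lborel) (\<lambda>(s, t). ?h1 s t)"
    by (rule Bochner_Integration.integrable_bound[OF h]) (auto simp: indicator_def)
  have h2: "integrable (lborel \<Otimes>\<^sub>M lborel) (\<lambda>(s, t). ?h2 s t)"
    by (rule Bochner_Integration.integrable_bound[OF h]) (auto simp: indicator_def)
  have e1: "(\<integral>s. ?h1 s t \<partial>lborel) = indicator {a..b} t *\<^sub>R (F t * g t)" for t
  proof (cases "t \<in> {a..b}")
    case True
    then have "?h1 s t = (indicator {a..t} s *\<^sub>R f s) * g t" for s
      by (auto simp: indicator_def f0_def g0_def)
    then have "(\<integral>s. ?h1 s t \<partial>lborel) = F t * g t"
      by (simp only: integral_mult_left_zero F_def set_lebesgue_integral_def)
    then show ?thesis using True by simp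
  qed (simp add: g0_def)
  have e2: "(\<integral>t. ?h2 s t \<partial>lborel) = indicator {a..b} s *\<^sub>R (f s * G s)" for s
  proof (cases "s \<in> {a..b}")
    case True
    have g0: "indicator {a..s} t *\<^sub>R g t = indicator {a..s} t *\<^sub>R g0 t" for t
      using True by (auto simp: indicator_def g0_def)
    have "(\<integral>t. ?h2 s t \<partial>lborel) = (\<integral>t. f s * (indicator {a..s} t *\<^sub>R g t) \<partial>lborel)"
    proof (rule integral_cong_AE)
      \<comment> \<open>The triangle is open at \<open>t = s\<close> whereas \<open>G\<close>
        integrates up to and including \<open>s\<close>; the difference is one point.\<close>
      show "AE t in lborel. ?h2 s t = f s * (indicator {a..s} t *\<^sub>R g t)"
        using AE_lborel_singleton[of s]
        by eventually_elim (use True in \<open>auto simp: indicator_def f0_def g0_def\<close>)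
      show "(\<lambda>t. f s * (indicator {a..s} t *\<^sub>R g t)) \<in> borel_measurable lborel"
        unfolding g0 by measurable
    qed simp
    then have "(\<integral>t. ?h2 s t \<partial>lborel) = f s * G s"
      by (simp only: integral_mult_right_zero G_def set_lebesgue_integral_def)
    then show ?thesis using True by simp
  qed (simp add: f0_def)
  have "integrable lborel (\<lambda>t. \<integral>s. ?h1 s t \<partial>lborel)"
    using lborel_pair.integrable_snd[OF h1] .
  then show "set_integrable lborel {a..b} (\<lambda>t. F t * g t)"
    unfolding e1 set_integrable_def .
  have "integrable lborel (\<lambda>s. \<integral>t. ?h2 s t \<partial>lborel)"
    using lborel_pair.integrable_fst[OF h2] .
  then show "set_integrable lborel {a..b} (\<lambda>t. f t * G t)"
    unfolding e2 set_integrable_def .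
  have "F b = integral\<^sup>L lborel f0" "G b = integral\<^sup>L lborel g0"
    by (simp_all add: F_def G_def set_lebesgue_integral_def f0_def[abs_def] g0_def[abs_def])
  then have "F b * G b = (\<integral>s. \<integral>t. ?h s t \<partial>lborel \<partial>lborel)"
    by simp
  also have "\<dots> = (\<integral>z. (case z of (s, t) \<Rightarrow> ?h s t) \<partial>(lborel \<Otimes>\<^sub>M lborel))"
    by (rule lborel_pair.integral_fst[OF h])
  also have "\<dots> = (\<integral>z. (case z of (s, t) \<Rightarrow> ?h1 s t) + (case z of (s, t) \<Rightarrow> ?h2 s t) \<partial>(lborel \<Otimes>\<^sub>M lborel))"
    by (intro Bochner_Integration.integral_cong refl) (auto simp: indicator_def)
  also have "\<dots> = (\<integral>z. (case z of (s, t) \<Rightarrow> ?h1 s t) \<partial>(lborel \<Otimes>\<^sub>M lborel)) + (\<integral>z. (case z of (s, t) \<Rightarrow> ?h2 s t) \<partial>(lborel \<Otimes>\<^sub>M lborel))"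
    by (rule Bochner_Integration.integral_add[OF h1 h2])
  also have "\<dots> = (LINT t:{a..b}|lborel. F t * g t) + (LINT t:{a..b}|lborel. f t * G t)"
    unfolding lborel_pair.integral_snd[OF h1, symmetric] lborel_pair.integral_fst[OF h2, symmetric] e1 e2
    by (simp add: set_lebesgue_integral_def)
  finally show "(LINT t:{a..b}|lborel. f t * G t) + (LINT t:{a..b}|lborel. F t * g t) = F b * G b"
    by simp
qed

text \<open>The source of \<open>1 / fact n\<close> in the Dyson bound. The product rule is applied
  to \<open>q * G ^ n\<close> and \<open>q\<close>; the primitive of the first is needed at every
  intermediate point, which is why the induction varies the upper limit.\<close>

lemma integral_power_rule:
  fixes q :: "real \<Rightarrow> real" and a b :: real
  assumes q: "integrable lborel q"
  defines "G \<equiv> \<lambda>t. LINT s:{a..t}|lborel. q s"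
  shows "set_integrable lborel {a..b} (\<lambda>t. q t * G t ^ n)
    \<and> (LINT t:{a..b}|lborel. q t * G t ^ n) = G b ^ Suc n / real (Suc n)"
proof (induction n arbitrary: b)
  case 0
  have "set_integrable lborel {a..b} q"
    unfolding set_integrable_def by (rule integrable_mult_indicator[OF _ q]) simp
  then show ?case by (simp add: G_def)
next
  case (Suc n)
  have IH: "set_integrable lborel {a..b} (\<lambda>t. q t * G t ^ n)" for b using Suc by blast
  have IH': "(LINT t:{a..b}|lborel. q t * G t ^ n) = G b ^ Suc n / real (Suc n)" for b using Suc by blast
  have qi: "set_integrable lborel {a..b} q"
    unfolding set_integrable_def by (rule integrable_mult_indicator[OF _ q]) simp
  have G: "(LINT s:{a..t}|lborel. q s) = G t" for t by (simp add: G_def)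
  note P = integral_product_rule[OF IH qi, unfolded IH' G]
  have i: "set_integrable lborel {a..b} (\<lambda>t. q t * G t ^ Suc n)"
    using P(1) by (simp add: mult_ac)
  have "(LINT t:{a..b}|lborel. q t * G t ^ n * G t) = (LINT t:{a..b}|lborel. q t * G t ^ Suc n)"
    by (simp add: mult_ac)
  moreover have "(LINT t:{a..b}|lborel. G t ^ Suc n / real (Suc n) * q t)
     = (LINT t:{a..b}|lborel. q t * G t ^ Suc n) / real (Suc n)"
    by (simp add: mult_ac flip: set_integral_divide_zero)
  \<comment> \<open>Both terms of the product rule are multiples of the wanted integral, and
    \<open>1 + 1 / (n + 1) = (n + 2) / (n + 1)\<close>.\<close>
  ultimately have "(LINT t:{a..b}|lborel. q t * G t ^ Suc n) * (1 + 1 / real (Suc n)) = G b ^ Suc (Suc n) / real (Suc n)"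
    using P(3) by (simp add: algebra_simps)
  then have "(LINT t:{a..b}|lborel. q t * G t ^ Suc n) = G b ^ Suc (Suc n) / real (Suc (Suc n))"
    by (simp add: field_simps)
  with i show ?case by blast
qed

text \<open>The induction step for the Dyson terms of a sum of two commuting tensors: with \<open>A\<close> and \<open>B\<close> the
  Dyson terms of the summands, their convolution is again an iterated integral.\<close>

lemma integral_convolution_rule:
  fixes a b A B :: "nat \<Rightarrow> real \<Rightarrow> complex"
  assumes a: "\<And>k. set_integrable lborel {x..y} (a k)" and b: "\<And>k. set_integrable lborel {x..y} (b k)"
    and A: "\<And>k t. A (Suc k) t = (LINT s:{x..t}|lborel. a k s)" "\<And>t. A 0 t = A0"
    and B: "\<And>k t. B (Suc k) t = (LINT s:{x..t}|lborel. b k s)" "\<And>t. B 0 t = B0"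
  shows "(LINT t:{x..y}|lborel. (\<Sum>k\<le>n. a k t * B (n - k) t + A k t * b (n - k) t))
    = (\<Sum>k\<le>Suc n. A k y * B (Suc n - k) y)"
proof -
  have ia: "set_integrable lborel {x..y} (\<lambda>t. a k t * B l t)" for k l
  proof (cases l)
    case 0
    then show ?thesis using a[of k] by (simp add: B)
  next
    case (Suc m)
    then show ?thesis using integral_product_rule(1)[OF a[of k] b[of m]] by (simp add: B)
  qed
  have ib: "set_integrable lborel {x..y} (\<lambda>t. A k t * b l t)" for k l
  proof (cases k)
    case 0
    then show ?thesis using b[of l] by (simp add: A)
  next
    case (Suc m)
    then show ?thesis using integral_product_rule(2)[OF a[of m] b[of l]] by (simp add: A)
  qed
  define X where "X k = (LINT t:{x..y}|lborel. a k t * B (n - k) t)" for k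
  define Y where "Y k = (LINT t:{x..y}|lborel. A k t * b (n - k) t)" for k
  \<comment> \<open>The product rule for \<open>A (Suc k) * B (n - k)\<close> pairs the first half
    of summand \<open>k\<close> with the second half of summand \<open>k + 1\<close>. What remains
    unpaired are the two ends, \<open>Y 0\<close> and \<open>X n\<close>, where one factor is
    constant.\<close>
  have XY: "X k + Y (Suc k) = A (Suc k) y * B (n - k) y" if "k < n" for k
  proof -
    have nk: "n - k = Suc (n - Suc k)" using that by simp
    show ?thesis
      unfolding X_def Y_def nk A(1) B(1) by (rule integral_product_rule(3)[OF a b])
  qed
  have Y0: "Y 0 = A 0 y * B (Suc n) y" by (simp add: Y_def A B)
  have Xn: "X n = A (Suc n) y * B 0 y" by (simp add: X_def A B)
  have "(LINT t:{x..y}|lborel. (\<Sum>k\<le>n. a k t * B (n - k) t + A k t * b (n - k) t)) = (\<Sum>k\<le>n. X k + Y k)"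
    using ia ib by (simp add: set_integral_sum_of X_def Y_def set_integral_add)
  also have "\<dots> = (\<Sum>k<n. X k) + X n + (Y 0 + (\<Sum>k<n. Y (Suc k)))"
    by (simp add: sum.distrib flip: lessThan_Suc_atMost sum.lessThan_Suc_shift)
  also have "\<dots> = A 0 y * B (Suc n) y + (\<Sum>k<n. A (Suc k) y * B (n - k) y) + A (Suc n) y * B 0 y"
    by (simp add: Xn Y0 XY sum.distrib[symmetric])
  also have "\<dots> = (\<Sum>k\<le>Suc n. A k y * B (Suc n - k) y)"
    by (simp add: sum.atMost_Suc_shift del: sum.atMost_Suc) (simp flip: lessThan_Suc_atMost)
  finally show ?thesis .
qed

section \<open>Path-ordered exponentials\<close>

lemma dyson_carrier [simp]: "dyson_term D Q n x y \<in> carrier_mat D D"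
  by (cases n) auto

lemma path_exp_carrier [simp]: "path_exp D Q x y \<in> carrier_mat D D"
  by (simp add: path_exp_def)

text \<open>Integrability on the whole line, to be supplied by cutting tensors off outside the
  interval, gives bounds that are uniform in the end points.\<close>

locale path_ordered =
  fixes D :: nat and Q :: "real \<Rightarrow> complex mat"
  assumes carrier [simp]: "\<And>x. Q x \<in> carrier_mat D D"
    and integrable: "\<And>i j. i < D \<Longrightarrow> j < D \<Longrightarrow> integrable lborel (\<lambda>x. Q x $$ (i, j))"
begin

abbreviation dyson_entry :: "nat \<Rightarrow> real \<Rightarrow> real \<Rightarrow> nat \<Rightarrow> nat \<Rightarrow> complex" where
  "dyson_entry n x y i j \<equiv> dyson_term D Q n x y $$ (i, j)"

abbreviation integrand :: "nat \<Rightarrow> real \<Rightarrow> nat \<Rightarrow> nat \<Rightarrow> real \<Rightarrow> complex" where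
  "integrand n x i j z \<equiv> \<Sum>k<D. dyson_entry n x z i k * Q z $$ (k, j)"

lemma dyson_entry_0: "i < D \<Longrightarrow> j < D \<Longrightarrow> dyson_entry 0 x y i j = (if i = j then 1 else 0)"
  by simp

lemma dyson_entry_Suc:
  assumes "i < D" "j < D"
  shows "dyson_entry (Suc n) x y i j = (LINT z:{x..y}|lborel. integrand n x i j z)"
  using assms by (simp add: mat_mult_entry[OF dyson_carrier carrier] del: index_mult_mat)

lemma measurable_indicator_Icc:
  "(\<lambda>q :: (real \<times> real) \<times> real. indicat_real {fst (fst q)..snd (fst q)} (snd q))
     \<in> borel_measurable ((borel \<Otimes>\<^sub>M borel) \<Otimes>\<^sub>M lborel)"
  unfolding indicator_def atLeastAtMost_iff by measurable

text \<open>Measurability is needed jointly in both end points: inside a path word both are particle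
  positions that are integrated over.\<close>

lemma dyson_entry_measurable:
  assumes "i < D" "j < D"
  shows "(\<lambda>(x, y). dyson_entry n x y i j) \<in> borel_measurable (borel \<Otimes>\<^sub>M borel)"
  using assms
proof (induction n arbitrary: i j)
  case 0
  then show ?case by (simp add: dyson_entry_0)
next
  case (Suc n)
  let ?P = "(borel \<Otimes>\<^sub>M borel) \<Otimes>\<^sub>M lborel :: ((real \<times> real) \<times> real) measure"
  have Qm [measurable]: "(\<lambda>z. Q z $$ (k, j)) \<in> borel_measurable borel" if "k < D" for k
    using borel_measurable_integrable[OF integrable[OF that Suc.prems(2)]] by simp
  have dm [measurable]: "(\<lambda>p. dyson_entry n (fst p) (snd p) i k) \<in> borel_measurable (borel \<Otimes>\<^sub>M borel)" if "k < D" for k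
    using Suc.IH[OF Suc.prems(1) that] by (simp add: case_prod_beta)
  have 1: "(\<lambda>q. dyson_entry n (fst (fst q)) (snd q) i k * Q (snd q) $$ (k, j))
      \<in> borel_measurable ?P" if "k < D" for k
  proof -
    have "(\<lambda>q. dyson_entry n (fst (fst q)) (snd q) i k) \<in> borel_measurable ?P"
      using measurable_compose[OF _ dm[OF that], of "\<lambda>q. (fst (fst q), snd q)" ?P] by simp
    moreover have "(\<lambda>q. Q (snd q) $$ (k, j)) \<in> borel_measurable ?P"
      using measurable_compose[OF _ Qm[OF that], of snd ?P] by simp
    ultimately show ?thesis by (rule borel_measurable_times)
  qed
  have "(\<lambda>q. indicat_real {fst (fst q)..snd (fst q)} (snd q) *\<^sub>R (\<Sum>k<D. dyson_entry n (fst (fst q)) (snd q) i k * Q (snd q) $$ (k, j)))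
      \<in> borel_measurable ?P"
    by (intro borel_measurable_scaleR borel_measurable_sum 1 measurable_indicator_Icc) simp
  then have "(\<lambda>p. LINT z|lborel. indicat_real {fst p..snd p} z *\<^sub>R integrand n (fst p) i j z) \<in> borel_measurable (borel \<Otimes>\<^sub>M borel)"
    by (intro lborel.borel_measurable_lebesgue_integral) (simp add: case_prod_beta)
  then show ?case
    using Suc.prems by (simp only: dyson_entry_Suc set_lebesgue_integral_def case_prod_beta)
qed

lemma dyson_entry_measurable' [measurable]:
  assumes "i < D" "j < D"
  shows "(\<lambda>y. dyson_entry n x y i j) \<in> borel_measurable borel"
  using measurable_compose[OF _ dyson_entry_measurable[OF assms, of n], of "\<lambda>y. (x, y)" borel] by simp

text \<open>The entrywise 1-norm of \<open>Q z\<close>. It dominates the row and the column sums, so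
  no power of the dimension enters the estimates.\<close>

definition growth :: "real \<Rightarrow> real" where
  "growth z = (\<Sum>i<D. \<Sum>j<D. cmod (Q z $$ (i, j)))"

definition total :: "real \<Rightarrow> real \<Rightarrow> real" where
  "total x y = (LINT z:{x..y}|lborel. growth z)"

lemma growth_nonneg: "growth z \<ge> 0"
  by (simp add: growth_def sum_nonneg)

lemma growth_integrable: "integrable lborel growth"
  unfolding growth_def[abs_def] by (intro Bochner_Integration.integrable_sum integrable_norm integrable) auto

lemma total_nonneg: "total x y \<ge> 0"
  unfolding total_def set_lebesgue_integral_def
  by (intro Bochner_Integration.integral_nonneg) (simp add: growth_nonneg)

lemma total_mono: "y \<le> y' \<Longrightarrow> total x y \<le> total x y'"
  unfolding total_def set_lebesgue_integral_def
  by (intro integral_mono integrable_mult_indicator growth_integrable)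
    (auto simp: growth_nonneg indicator_def)

lemma total_le: "total x y \<le> (LINT z|lborel. growth z)"
  unfolding total_def set_lebesgue_integral_def
  by (intro integral_mono integrable_mult_indicator growth_integrable)
    (auto simp: growth_nonneg indicator_def)

text \<open>Bound and integrability have to be proved together: estimating the next Dyson term under
  the integral needs its integrand to be integrable, and integrability of the integrand after that
  follows from the new bound by domination. Row sums are estimated because one more factor
  \<open>Q z\<close> then costs only \<open>growth z\<close>.\<close>

lemma dyson_row_bound:
  assumes "i < D"
  shows "(\<Sum>j<D. cmod (dyson_entry n x y i j)) \<le> total x y ^ n / fact n
    \<and> (\<forall>j<D. set_integrable lborel {x..y} (integrand n x i j))"
  using assms
proof (induction n arbitrary: y)
  case 0
  have "(\<Sum>j<D. cmod (dyson_entry 0 x y i j)) = (\<Sum>j<D. if j = i then 1 else 0)"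
    using 0 by (intro sum.cong refl) (simp add: dyson_entry_0)
  then have "(\<Sum>j<D. cmod (dyson_entry 0 x y i j)) = 1" using 0 by simp
  moreover have "set_integrable lborel {x..y} (integrand 0 x i j)" if "j < D" for j
  proof -
    have "integrand 0 x i j z = Q z $$ (i, j)" for z
    proof -
      have "integrand 0 x i j z = (\<Sum>k<D. if k = i then Q z $$ (k, j) else 0)"
        using 0 by (intro sum.cong refl) (simp add: dyson_entry_0)
      then show ?thesis using 0 by simp
    qed
    then show ?thesis
      unfolding set_integrable_def using integrable_mult_indicator[OF _ integrable[OF 0 that], of "{x..y}"] by simp
  qed
  ultimately show ?case by simp
next
  case (Suc n)
  have int: "set_integrable lborel {x..y} (integrand n x i j)" if "j < D" for j y using Suc that by blast
  have bnd: "(\<Sum>j<D. cmod (dyson_entry n x y i j)) \<le> total x y ^ n / fact n" for y using Suc by blast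
  note pow = integral_power_rule[OF growth_integrable, of x, folded total_def]
  have integrand_le: "(\<Sum>j<D. cmod (integrand n x i j z)) \<le> growth z * total x z ^ n / fact n" for z
  proof -
    have "(\<Sum>j<D. cmod (integrand n x i j z)) \<le> (\<Sum>j<D. \<Sum>k<D. cmod (dyson_entry n x z i k) * cmod (Q z $$ (k, j)))"
      by (intro sum_mono order_trans[OF norm_sum]) (simp add: norm_mult)
    \<comment> \<open>Replacing an entry by its column sum makes the second factor independent of
      \<open>k\<close>, so that the double sum factorizes.\<close>
    also have "\<dots> \<le> (\<Sum>j<D. \<Sum>k<D. cmod (dyson_entry n x z i k) * (\<Sum>l<D. cmod (Q z $$ (l, j))))"
      by (intro sum_mono mult_left_mono member_le_sum) auto
    also have "\<dots> = (\<Sum>k<D. cmod (dyson_entry n x z i k)) * growth z"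
    proof -
      have "growth z = (\<Sum>j<D. \<Sum>l<D. cmod (Q z $$ (l, j)))"
        unfolding growth_def by (rule sum.swap)
      then show ?thesis
        by (subst sum.swap) (simp add: sum_distrib_left[symmetric] sum_distrib_right[symmetric])
    qed
    also have "\<dots> \<le> total x z ^ n / fact n * growth z"
      using bnd growth_nonneg by (rule mult_right_mono)
    finally show ?thesis by (simp add: mult_ac)
  qed
  have pint: "set_integrable lborel {x..y} (\<lambda>z. growth z * total x z ^ n / fact n)" for y
    using pow[of y n] by simp
  have "(\<Sum>j<D. cmod (dyson_entry (Suc n) x y i j)) \<le> (\<Sum>j<D. LINT z:{x..y}|lborel. cmod (integrand n x i j z))" for y
    using Suc.prems int by (intro sum_mono) (simp add: dyson_entry_Suc set_integral_norm_bound del: dyson_term.simps)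
  also have "\<dots> y = (LINT z:{x..y}|lborel. (\<Sum>j<D. cmod (integrand n x i j z)))" for y
    using int by (intro set_integral_sum_of[symmetric] set_integrable_norm) auto
  also have "\<dots> y \<le> (LINT z:{x..y}|lborel. growth z * total x z ^ n / fact n)" for y
  proof (rule set_integral_mono)
    have "set_integrable lborel {x..y} (\<lambda>z. cmod (integrand n x i j z))" if "j < D" for j
      using int[OF that] by (rule set_integrable_norm)
    then show "set_integrable lborel {x..y} (\<lambda>z. \<Sum>j<D. cmod (integrand n x i j z))"
      unfolding set_integrable_def scaleR_sum_right by (intro Bochner_Integration.integrable_sum) auto
  qed (use pint integrand_le in auto)
  also have "\<dots> y = total x y ^ Suc n / fact (Suc n)" for y
    unfolding set_integral_divide_zero conjunct2[OF pow] by (simp add: mult.commute fact_Suc del: of_nat_Suc power_Suc)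
  finally have bnd': "(\<Sum>j<D. cmod (dyson_entry (Suc n) x y i j)) \<le> total x y ^ Suc n / fact (Suc n)" for y .
  have "set_integrable lborel {x..y} (integrand (Suc n) x i j)" if j: "j < D" for j
  proof -
    \<comment> \<open>The bound at the upper end point serves for all \<open>z\<close> in the
      interval, since \<open>total\<close> is monotone.\<close>
    define C where "C = total x y ^ Suc n / fact (Suc n)"
    have "set_integrable lborel {x..y} (\<lambda>z. dyson_entry (Suc n) x z i k * Q z $$ (k, j))" if k: "k < D" for k
      unfolding set_integrable_def
    proof (rule Bochner_Integration.integrable_bound)
      show "integrable lborel (\<lambda>z. C * cmod (Q z $$ (k, j)))"
        using integrable[OF k j] by simp
      have "(\<lambda>z. dyson_entry (Suc n) x z i k) \<in> borel_measurable lborel"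
        using dyson_entry_measurable'[OF Suc.prems k, of "Suc n" x] by (simp del: dyson_term.simps)
      then show "(\<lambda>z. indicat_real {x..y} z *\<^sub>R (dyson_entry (Suc n) x z i k * Q z $$ (k, j))) \<in> borel_measurable lborel"
        using borel_measurable_integrable[OF integrable[OF k j]]
        by (intro borel_measurable_scaleR borel_measurable_times borel_measurable_indicator) auto
      have "cmod (indicat_real {x..y} z *\<^sub>R (dyson_entry (Suc n) x z i k * Q z $$ (k, j))) \<le> C * cmod (Q z $$ (k, j))" for z
      proof (cases "z \<in> {x..y}")
        case True
        have "cmod (dyson_entry (Suc n) x z i k) \<le> (\<Sum>j<D. cmod (dyson_entry (Suc n) x z i j))"
          using k by (intro member_le_sum) auto
        also have "\<dots> \<le> total x z ^ Suc n / fact (Suc n)" by (rule bnd')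
        also have "\<dots> \<le> C"
          unfolding C_def using True by (intro divide_right_mono power_mono total_mono total_nonneg) auto
        finally have "cmod (dyson_entry (Suc n) x z i k) * cmod (Q z $$ (k, j)) \<le> C * cmod (Q z $$ (k, j))"
          by (rule mult_right_mono) simp
        then show ?thesis using True by (simp only: indicator_simps scaleR_one norm_mult)
      next
        case False
        have "0 \<le> C" using total_nonneg[of x y] unfolding C_def by (intro divide_nonneg_nonneg zero_le_power) auto
        then show ?thesis using False by (simp del: dyson_term.simps)
      qed
      then show "AE z in lborel. cmod (indicat_real {x..y} z *\<^sub>R (dyson_entry (Suc n) x z i k * Q z $$ (k, j)))
          \<le> norm (C * cmod (Q z $$ (k, j)))"
        unfolding real_norm_def by (intro AE_I2 order_trans[OF _ abs_ge_self])
    qed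
    then show ?thesis
      unfolding set_integrable_def scaleR_sum_right by (intro Bochner_Integration.integrable_sum) auto
  qed
  with bnd' show ?case by blast
qed

lemma integrand_integrable:
  "i < D \<Longrightarrow> j < D \<Longrightarrow> set_integrable lborel {x..y} (integrand n x i j)"
  using dyson_row_bound by blast

lemma dyson_entry_bound:
  assumes "i < D" "j < D"
  shows "cmod (dyson_entry n x y i j) \<le> total x y ^ n / fact n"
proof -
  have "cmod (dyson_entry n x y i j) \<le> (\<Sum>j<D. cmod (dyson_entry n x y i j))"
    using assms by (intro member_le_sum) auto
  also have "\<dots> \<le> total x y ^ n / fact n" using dyson_row_bound[OF assms(1)] by blast
  finally show ?thesis .
qed

lemma sums_total: "(\<lambda>n. total x y ^ n / fact n) sums exp (total x y)"
  using exp_converges[of "total x y"] by (simp add: scaleR_conv_of_real field_simps)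

lemma dyson_entry_summable_norm:
  assumes "i < D" "j < D"
  shows "summable (\<lambda>n. cmod (dyson_entry n x y i j))"
  by (rule summable_comparison_test[OF _ sums_summable[OF sums_total[of x y]]])
    (use dyson_entry_bound[OF assms] in auto)

lemma path_exp_entry: "i < D \<Longrightarrow> j < D \<Longrightarrow> path_exp D Q x y $$ (i, j) = (\<Sum>n. dyson_entry n x y i j)"
  by (simp add: path_exp_def)

lemma dyson_entry_sums:
  assumes "i < D" "j < D"
  shows "(\<lambda>n. dyson_entry n x y i j) sums (path_exp D Q x y $$ (i, j))"
  unfolding path_exp_entry[OF assms]
  by (rule summable_sums[OF summable_norm_cancel[OF dyson_entry_summable_norm[OF assms]]])

lemma path_exp_bound:
  assumes "i < D" "j < D"
  shows "cmod (path_exp D Q x y $$ (i, j)) \<le> exp (LINT z|lborel. growth z)"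
proof -
  have "cmod (path_exp D Q x y $$ (i, j)) \<le> (\<Sum>n. cmod (dyson_entry n x y i j))"
    unfolding path_exp_entry[OF assms] by (rule summable_norm[OF dyson_entry_summable_norm[OF assms]])
  also have "\<dots> \<le> (\<Sum>n. total x y ^ n / fact n)"
    by (intro suminf_le dyson_entry_bound assms dyson_entry_summable_norm sums_summable[OF sums_total])
  also have "\<dots> = exp (total x y)" using sums_unique[OF sums_total] by simp
  also have "\<dots> \<le> exp (LINT z|lborel. growth z)" using total_le by simp
  finally show ?thesis .
qed

lemma path_exp_measurable:
  assumes "i < D" "j < D"
  shows "(\<lambda>(x, y). path_exp D Q x y $$ (i, j)) \<in> borel_measurable (borel \<Otimes>\<^sub>M borel)"
  using dyson_entry_measurable[OF assms]
  by (simp add: path_exp_entry[OF assms] case_prod_beta borel_measurable_suminf)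

text \<open>Of the \<open>n\<close> ordered integration points, some number \<open>k\<close> lies
  before \<open>y\<close> and the others after it. The induction splits only the last, outermost
  integration at \<open>y\<close>.\<close>

lemma dyson_term_compose:
  assumes "i < D" "j < D" "x \<le> y" "y \<le> z"
  shows "dyson_entry n x z i j = (\<Sum>k\<le>n. \<Sum>l<D. dyson_entry k x y i l * dyson_entry (n - k) y z l j)"
  using assms(2,4)
proof (induction n arbitrary: z j)
  case 0
  have "(\<Sum>l<D. dyson_entry 0 x y i l * dyson_entry 0 y z l j) = (\<Sum>l<D. if l = i then dyson_entry 0 y z l j else 0)"
    using assms by (intro sum.cong refl) (simp add: dyson_entry_0)
  then show ?case using assms 0 by (simp add: dyson_entry_0)
next
  case (Suc n)
  note j = \<open>j < D\<close>
  have split: "(LINT w:{x..z}|lborel. integrand n x i j w) = (LINT w:{x..y}|lborel. integrand n x i j w) + (LINT w:{y..z}|lborel. integrand n x i j w)"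
  proof -
    have "AE w in lborel. \<not> (w \<in> {x..y} \<and> w \<in> {y..z})"
      using AE_lborel_singleton[of y] by eventually_elim auto
    moreover have "{x..z} = {x..y} \<union> {y..z}" using Suc.prems assms by auto
    moreover have "set_integrable lborel {y..z} (integrand n x i j)"
      by (rule set_integrable_subset[OF integrand_integrable[OF assms(1) j]]) (use assms in auto)
    ultimately show ?thesis
      using set_integral_Un_AE[of "{x..y}" "{y..z}" lborel "integrand n x i j"]
        integrand_integrable[OF assms(1) j, of x y n] by simp
  qed
  \<comment> \<open>If the last point lies beyond \<open>y\<close>, the induction hypothesis applies
    to the inner term with upper end point \<open>w\<close>.\<close>
  have tail: "integrand n x i j w = (\<Sum>k\<le>n. \<Sum>l<D. dyson_entry k x y i l * integrand (n - k) y l j w)" if "w \<in> {y..z}" for w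
  proof -
    have "integrand n x i j w = (\<Sum>m<D. (\<Sum>k\<le>n. \<Sum>l<D. dyson_entry k x y i l * dyson_entry (n - k) y w l m) * Q w $$ (m, j))"
      using that Suc.IH[of _ w] by (intro sum.cong refl) simp
    also have "\<dots> = (\<Sum>m<D. \<Sum>k\<le>n. \<Sum>l<D. dyson_entry k x y i l * (dyson_entry (n - k) y w l m * Q w $$ (m, j)))"
      by (simp add: sum_distrib_right mult.assoc)
    also have "\<dots> = (\<Sum>k\<le>n. \<Sum>m<D. \<Sum>l<D. dyson_entry k x y i l * (dyson_entry (n - k) y w l m * Q w $$ (m, j)))"
      by (rule sum.swap)
    also have "\<dots> = (\<Sum>k\<le>n. \<Sum>l<D. \<Sum>m<D. dyson_entry k x y i l * (dyson_entry (n - k) y w l m * Q w $$ (m, j)))"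
      by (intro sum.cong refl sum.swap)
    finally show ?thesis by (simp add: sum_distrib_left)
  qed
  have "(LINT w:{y..z}|lborel. integrand n x i j w)
      = (LINT w:{y..z}|lborel. (\<Sum>k\<le>n. \<Sum>l<D. dyson_entry k x y i l * integrand (n - k) y l j w))"
    by (rule set_lebesgue_integral_cong) (use tail in auto)
  also have "\<dots> = (\<Sum>k\<le>n. \<Sum>l<D. LINT w:{y..z}|lborel. dyson_entry k x y i l * integrand (n - k) y l j w)"
  proof -
    have 1: "set_integrable lborel {y..z} (\<lambda>w. dyson_entry k x y i l * integrand (n - k) y l j w)" if "l < D" for k l
      using integrand_integrable[OF that j] by simp
    have 2: "set_integrable lborel {y..z} (\<lambda>w. \<Sum>l<D. dyson_entry k x y i l * integrand (n - k) y l j w)" for k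
      using 1 unfolding set_integrable_def scaleR_sum_right by (intro Bochner_Integration.integrable_sum) auto
    show ?thesis
      by (subst set_integral_sum_of[OF 2], intro sum.cong refl, rule set_integral_sum_of) (use 1 in auto)
  qed
  also have "\<dots> = (\<Sum>k\<le>n. \<Sum>l<D. dyson_entry k x y i l * dyson_entry (Suc n - k) y z l j)"
  proof (intro sum.cong refl)
    fix k l assume "k \<in> {..n}" "l \<in> {..<D}"
    then have "Suc n - k = Suc (n - k)" "l < D" by auto
    then show "(LINT w:{y..z}|lborel. dyson_entry k x y i l * integrand (n - k) y l j w) = dyson_entry k x y i l * dyson_entry (Suc n - k) y z l j"
      using j by (simp only: dyson_entry_Suc set_integral_mult_right)
  qed
  \<comment> \<open>If the last point lies before \<open>y\<close>, so do all: this part is the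
    summand \<open>k = Suc n\<close>, whose second factor is the identity matrix.\<close>
  also have "dyson_entry (Suc n) x y i j = (\<Sum>l<D. dyson_entry (Suc n) x y i l * dyson_entry 0 y z l j)"
  proof -
    have "(\<Sum>l<D. dyson_entry (Suc n) x y i l * dyson_entry 0 y z l j) = (\<Sum>l<D. if l = j then dyson_entry (Suc n) x y i l else 0)"
      using j by (intro sum.cong refl) (simp add: dyson_entry_0 del: dyson_term.simps)
    then show ?thesis using j by (simp del: dyson_term.simps)
  qed
  ultimately show ?case
    using split dyson_entry_Suc[OF assms(1) j, of n x z] dyson_entry_Suc[OF assms(1) j, of n x y]
    by (simp del: dyson_term.simps)
qed

text \<open>The convolution of \<open>dyson_term_compose\<close> is the Cauchy product of the two
  absolutely convergent series.\<close>

lemma path_exp_compose: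
  assumes "x \<le> y" "y \<le> z"
  shows "path_exp D Q x y * path_exp D Q y z = path_exp D Q x z"
proof (rule eq_matI)
  fix i j assume "i < dim_row (path_exp D Q x z)" "j < dim_col (path_exp D Q x z)"
  then have ij: "i < D" "j < D" by (auto simp: path_exp_def)
  have "(\<lambda>n. \<Sum>l<D. \<Sum>k\<le>n. dyson_entry k x y i l * dyson_entry (n - k) y z l j)
      sums (\<Sum>l<D. path_exp D Q x y $$ (i, l) * path_exp D Q y z $$ (l, j))"
  proof (rule sums_sum)
    fix l assume "l \<in> {..<D}"
    then have l: "l < D" by simp
    show "(\<lambda>n. \<Sum>k\<le>n. dyson_entry k x y i l * dyson_entry (n - k) y z l j)
      sums (path_exp D Q x y $$ (i, l) * path_exp D Q y z $$ (l, j))"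
      unfolding path_exp_entry[OF ij(1) l] path_exp_entry[OF l ij(2)]
      by (rule Cauchy_product_sums[OF dyson_entry_summable_norm[OF ij(1) l] dyson_entry_summable_norm[OF l ij(2)]])
  qed
  moreover have "(\<Sum>l<D. \<Sum>k\<le>n. dyson_entry k x y i l * dyson_entry (n - k) y z l j) = dyson_entry n x z i j" for n
    unfolding dyson_term_compose[OF ij assms] by (rule sum.swap)
  ultimately have "(\<Sum>l<D. path_exp D Q x y $$ (i, l) * path_exp D Q y z $$ (l, j)) = path_exp D Q x z $$ (i, j)"
    using sums_unique2[OF _ dyson_entry_sums[OF ij, of x z]] by simp
  then show "(path_exp D Q x y * path_exp D Q y z) $$ (i, j) = path_exp D Q x z $$ (i, j)"
    using ij by (simp add: mat_mult_entry[OF path_exp_carrier path_exp_carrier] del: index_mult_mat)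
qed (auto simp: path_exp_def)

end

section \<open>Complex conjugation and locality of words\<close>

lemma mat_cnj_mult:
  assumes "A \<in> carrier_mat n m" "B \<in> carrier_mat m p"
  shows "mat_cnj (A * B) = mat_cnj A * mat_cnj B"
proof (rule eq_matI)
  fix i j assume "i < dim_row (mat_cnj A * mat_cnj B)" "j < dim_col (mat_cnj A * mat_cnj B)"
  then have ij: "i < n" "j < p" using assms by auto
  have c: "mat_cnj A \<in> carrier_mat n m" "mat_cnj B \<in> carrier_mat m p" using assms by auto
  have "mat_cnj (A * B) $$ (i, j) = cnj ((A * B) $$ (i, j))" using assms ij by auto
  also have "\<dots> = (\<Sum>k<m. mat_cnj A $$ (i, k) * mat_cnj B $$ (k, j))"
    unfolding mat_mult_entry[OF assms ij] using assms ij by (auto intro!: sum.cong)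
  also have "\<dots> = (mat_cnj A * mat_cnj B) $$ (i, j)" by (rule mat_mult_entry[OF c ij, symmetric])
  finally show "mat_cnj (A * B) $$ (i, j) = (mat_cnj A * mat_cnj B) $$ (i, j)" .
qed (use assms in auto)

lemma mat_trace_cnj: "A \<in> carrier_mat n n \<Longrightarrow> mat_trace (mat_cnj A) = cnj (mat_trace A)"
  by (auto simp: mat_trace_def)

lemma set_integral_cnj: "(LINT x:S|M. cnj (f x)) = cnj (LINT x:S|M. f x)"
proof -
  have "indicat_real S x *\<^sub>R cnj (f x) = cnj (indicat_real S x *\<^sub>R f x)" for x by simp
  then show ?thesis unfolding set_lebesgue_integral_def by (simp only: Bochner_Integration.integral_cnj)
qed

lemma dyson_term_cong:
  assumes "\<And>z. x \<le> z \<Longrightarrow> z \<le> y \<Longrightarrow> Q z = Q' z"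
  shows "dyson_term D Q n x y = dyson_term D Q' n x y"
  using assms
proof (induction n arbitrary: y)
  case (Suc n)
  have "dyson_term D Q n x z * Q z = dyson_term D Q' n x z * Q' z" if "z \<in> {x..y}" for z
    using Suc.IH[of z] Suc.prems that by simp
  then show ?case
    by (auto intro!: arg_cong[where f = "mat D D"] ext set_lebesgue_integral_cong)
qed simp

lemma path_exp_cong:
  "(\<And>z. x \<le> z \<Longrightarrow> z \<le> y \<Longrightarrow> Q z = Q' z) \<Longrightarrow> path_exp D Q x y = path_exp D Q' x y"
  unfolding path_exp_def using dyson_term_cong[of x y Q Q' D] by simp

lemma path_word_cong:
  assumes "\<And>z. a \<le> z \<Longrightarrow> z \<le> b \<Longrightarrow> Q z = Q' z" "a \<le> x" "y \<le> b"
    and "\<And>w. w \<in> set ws \<Longrightarrow> fst w \<in> {a..b}"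
  shows "path_word D Q x y ws = path_word D Q' x y ws"
  using assms(2,4)
proof (induction ws arbitrary: x)
  case Nil
  then show ?case using assms by (auto intro!: path_exp_cong)
next
  case (Cons w ws)
  obtain t K where w: "w = (t, K)" by (cases w)
  have t: "a \<le> t" "t \<le> b" using Cons.prems(2)[of w] w by auto
  have "path_exp D Q x t = path_exp D Q' x t"
    using assms(1) Cons.prems(1) t by (intro path_exp_cong) auto
  then show ?case using Cons.IH[of t] Cons.prems t by (simp add: w)
qed

lemma path_word_carrier:
  "(\<And>w. w \<in> set ws \<Longrightarrow> snd w \<in> carrier_mat D D) \<Longrightarrow> path_word D Q x y ws \<in> carrier_mat D D"
proof (induction ws arbitrary: x)
  case (Cons w ws)
  obtain t K where w: "w = (t, K)" by (cases w)
  have K: "K \<in> carrier_mat D D" using Cons.prems[of w] w by simp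
  have W: "path_word D Q t y ws \<in> carrier_mat D D" using Cons.IH[of t] Cons.prems by simp
  show ?case
    unfolding w path_word.simps by (rule mult_carrier_mat[OF mult_carrier_mat[OF path_exp_carrier K] W])
qed simp

context path_ordered begin

lemma path_ordered_cnj: "path_ordered D (\<lambda>x. mat_cnj (Q x))"
proof
  show "mat_cnj (Q x) \<in> carrier_mat D D" for x using carrier[of x] by simp
  show "integrable lborel (\<lambda>x. mat_cnj (Q x) $$ (i, j))" if "i < D" "j < D" for i j
  proof -
    have "mat_cnj (Q x) $$ (i, j) = cnj (Q x $$ (i, j))" for x using carrier_matD[OF carrier[of x]] that by simp
    then show ?thesis using integrable[OF that] by (simp add: integrable_cnj)
  qed
qed

lemma dyson_term_cnj: "dyson_term D (\<lambda>x. mat_cnj (Q x)) n x y = mat_cnj (dyson_term D Q n x y)"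
proof (induction n arbitrary: y)
  case 0
  then show ?case by (intro eq_matI) auto
next
  case (Suc n)
  show ?case
  proof (rule eq_matI)
    fix i j assume "i < dim_row (mat_cnj (dyson_term D Q (Suc n) x y))" "j < dim_col (mat_cnj (dyson_term D Q (Suc n) x y))"
    then have ij: "i < D" "j < D" by auto
    have "(dyson_term D (\<lambda>x. mat_cnj (Q x)) n x z * mat_cnj (Q z)) $$ (i, j) = cnj ((dyson_term D Q n x z * Q z) $$ (i, j))" for z
      unfolding Suc mat_cnj_mult[OF dyson_carrier carrier, symmetric]
      using ij carrier_matD[OF carrier[of z]] carrier_matD[OF dyson_carrier[of D Q n x z]] by simp
    then show "dyson_term D (\<lambda>x. mat_cnj (Q x)) (Suc n) x y $$ (i, j) = mat_cnj (dyson_term D Q (Suc n) x y) $$ (i, j)"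
      using ij by (simp add: set_integral_cnj)
  qed auto
qed

lemma path_exp_cnj: "path_exp D (\<lambda>x. mat_cnj (Q x)) x y = mat_cnj (path_exp D Q x y)"
proof (rule eq_matI)
  fix i j assume "i < dim_row (mat_cnj (path_exp D Q x y))" "j < dim_col (mat_cnj (path_exp D Q x y))"
  then have ij: "i < D" "j < D" by (auto simp: path_exp_def)
  interpret cnj: path_ordered D "\<lambda>x. mat_cnj (Q x)" by (rule path_ordered_cnj)
  have "dyson_term D (\<lambda>x. mat_cnj (Q x)) n x y $$ (i, j) = cnj (dyson_entry n x y i j)" for n
    using ij carrier_matD[OF dyson_carrier[of D Q n x y]] by (simp add: dyson_term_cnj)
  then have 1: "(\<lambda>n. cnj (dyson_entry n x y i j)) sums (path_exp D (\<lambda>x. mat_cnj (Q x)) x y $$ (i, j))"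
    using cnj.dyson_entry_sums[OF ij, of x y] by simp
  have 2: "(\<lambda>n. cnj (dyson_entry n x y i j)) sums cnj (path_exp D Q x y $$ (i, j))"
    unfolding sums_cnj by (rule dyson_entry_sums[OF ij])
  have "path_exp D (\<lambda>x. mat_cnj (Q x)) x y $$ (i, j) = cnj (path_exp D Q x y $$ (i, j))"
    by (rule sums_unique2[OF 1 2])
  then show "path_exp D (\<lambda>x. mat_cnj (Q x)) x y $$ (i, j) = mat_cnj (path_exp D Q x y) $$ (i, j)"
    using ij by (simp add: path_exp_def)
qed (auto simp: path_exp_def)

lemma path_word_cnj:
  assumes "\<And>w. w \<in> set ws \<Longrightarrow> snd w \<in> carrier_mat D D"
  shows "path_word D (\<lambda>x. mat_cnj (Q x)) x y (map (\<lambda>(t, K). (t, mat_cnj K)) ws) = mat_cnj (path_word D Q x y ws)"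
  using assms
proof (induction ws arbitrary: x)
  case Nil
  then show ?case by (simp add: path_exp_cnj)
next
  case (Cons w ws)
  obtain t K where w: "w = (t, K)" by (cases w)
  have K: "K \<in> carrier_mat D D" using Cons.prems[of w] w by simp
  have W: "path_word D Q t y ws \<in> carrier_mat D D" using Cons.prems by (intro path_word_carrier) auto
  show ?case
    using Cons.IH[of t] Cons.prems
    by (simp add: w path_exp_cnj mat_cnj_mult[OF mult_carrier_mat[OF path_exp_carrier K] W] mat_cnj_mult[OF path_exp_carrier K])
qed

text \<open>In a tensor product, a letter of one factor is invisible to the other, which there sees
  two adjacent exponentials; this merges them. The positions must be sorted because the composition
  law needs ordered end points.\<close>

lemma path_exp_path_word:
  assumes "x \<le> t" "sorted (t # map fst ws @ [y])" "\<And>w. w \<in> set ws \<Longrightarrow> snd w \<in> carrier_mat D D"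
  shows "path_exp D Q x t * path_word D Q t y ws = path_word D Q x y ws"
proof (cases ws)
  case Nil
  then show ?thesis using assms by (simp add: path_exp_compose)
next
  case (Cons w ws')
  obtain s K where w: "w = (s, K)" by (cases w)
  have K: "K \<in> carrier_mat D D" using assms(3)[of w] w Cons by simp
  have W: "path_word D Q s y ws' \<in> carrier_mat D D" using assms(3) Cons by (intro path_word_carrier) auto
  have "t \<le> s" using assms(2) Cons w by simp
  then have "path_exp D Q x t * path_exp D Q t s = path_exp D Q x s" using assms(1) by (rule path_exp_compose[rotated])
  then show ?thesis
    by (simp add: Cons w K W assoc_mult_mat[OF path_exp_carrier path_exp_carrier K, symmetric]
        assoc_mult_mat[OF path_exp_carrier mult_carrier_mat[OF path_exp_carrier K] W, symmetric])
qed

end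

section \<open>Kronecker sums\<close>

abbreviation kron_sum ::
  "nat \<Rightarrow> nat \<Rightarrow> (real \<Rightarrow> complex mat) \<Rightarrow> (real \<Rightarrow> complex mat) \<Rightarrow> real \<Rightarrow> complex mat" where
  "kron_sum D E Q R \<equiv> \<lambda>x. kron (Q x) (1\<^sub>m E) + kron (1\<^sub>m D) (R x)"

lemma path_ordered_kron:
  assumes "path_ordered D Q" "path_ordered E R"
  shows "path_ordered (D * E) (kron_sum D E Q R)"
proof -
  interpret Q: path_ordered D Q by fact
  interpret R: path_ordered E R by fact
  show ?thesis
  proof
    show "kron (Q x) (1\<^sub>m E) + kron (1\<^sub>m D) (R x) \<in> carrier_mat (D * E) (D * E)" for x
      by (intro add_carrier_mat kron_carrier Q.carrier R.carrier one_carrier_mat)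
    fix i j assume ij: "i < D * E" "j < D * E"
    note dm = div_mod_less[OF ij(1)] div_mod_less[OF ij(2)]
    have kr: "kron (1\<^sub>m D) (R x) \<in> carrier_mat (D * E) (D * E)" for x by simp
    have "(kron (Q x) (1\<^sub>m E) + kron (1\<^sub>m D) (R x)) $$ (i, j)
        = Q x $$ (i div E, j div E) * 1\<^sub>m E $$ (i mod E, j mod E) + 1\<^sub>m D $$ (i div E, j div E) * R x $$ (i mod E, j mod E)" for x
      using ij carrier_matD[OF kr[of x]]
      by (simp add: kron_entry[OF Q.carrier one_carrier_mat] kron_entry[OF one_carrier_mat R.carrier] del: index_one_mat)
    then show "integrable lborel (\<lambda>x. (kron (Q x) (1\<^sub>m E) + kron (1\<^sub>m D) (R x)) $$ (i, j))"
      using Q.integrable[OF dm(1,3)] R.integrable[OF dm(2,4)] by simp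
  qed
qed

text \<open>An integrated Leibniz rule: multiplying a Kronecker product of Dyson terms by the
  Kronecker sum extends either the first or the second factor, and
  \<open>integral_convolution_rule\<close> integrates the sum of both. There are no binomial
  coefficients, as ordered integrals already contain the inverse factorials.\<close>

lemma dyson_term_kron:
  assumes "path_ordered D Q" "path_ordered E R" and ij: "i < D * E" "j < D * E"
  shows "dyson_term (D * E) (kron_sum D E Q R) n x y $$ (i, j)
    = (\<Sum>k\<le>n. dyson_term D Q k x y $$ (i div E, j div E) * dyson_term E R (n - k) x y $$ (i mod E, j mod E))"
  using ij(2)
proof (induction n arbitrary: y j)
  case 0
  have "kron (1\<^sub>m D) (1\<^sub>m E) $$ (i, j) = 1\<^sub>m (D * E) $$ (i, j)" by (simp only: kron_one)
  then show ?case using ij 0 kron_entry[OF one_carrier_mat one_carrier_mat ij(1) 0]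
    by (simp del: index_one_mat)
next
  case (Suc n)
  interpret Q: path_ordered D Q by fact
  interpret R: path_ordered E R by fact
  let ?S = "\<lambda>x. kron (Q x) (1\<^sub>m E) + kron (1\<^sub>m D) (R x)"
  interpret S: path_ordered "D * E" ?S by (intro path_ordered_kron assms)
  note j = Suc.prems
  note dm = div_mod_less[OF ij(1)] div_mod_less[OF j]
  define i1 i2 j1 j2 where "i1 = i div E" and "i2 = i mod E" and "j1 = j div E" and "j2 = j mod E"
  have b: "i1 < D" "i2 < E" "j1 < D" "j2 < E" using dm by (simp_all add: i1_def i2_def j1_def j2_def)
  have S: "S.integrand n x i j z = (\<Sum>k\<le>n. Q.integrand k x i1 j1 z * R.dyson_entry (n - k) x z i2 j2
      + Q.dyson_entry k x z i1 j1 * R.integrand (n - k) x i2 j2 z)" for z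
  proof -
    have "S.integrand n x i j z = (\<Sum>m<D * E. (\<Sum>k\<le>n. kron (dyson_term D Q k x z) (dyson_term E R (n - k) x z) $$ (i, m)) * ?S z $$ (m, j))"
      by (intro sum.cong refl) (simp add: Suc.IH ij kron_entry[OF dyson_carrier dyson_carrier])
    also have "\<dots> = (\<Sum>k\<le>n. \<Sum>m<D * E. kron (dyson_term D Q k x z) (dyson_term E R (n - k) x z) $$ (i, m) * ?S z $$ (m, j))"
      unfolding sum_distrib_right by (rule sum.swap)
    also have "\<dots> = (\<Sum>k\<le>n. (kron (dyson_term D Q k x z) (dyson_term E R (n - k) x z) * ?S z) $$ (i, j))"
      by (intro sum.cong refl mat_mult_entry[OF kron_carrier[OF dyson_carrier dyson_carrier] S.carrier ij(1) j, symmetric])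
    also have "\<dots> = (\<Sum>k\<le>n. Q.integrand k x i1 j1 z * R.dyson_entry (n - k) x z i2 j2
      + Q.dyson_entry k x z i1 j1 * R.integrand (n - k) x i2 j2 z)"
    proof (intro sum.cong refl)
      fix k
      let ?A = "dyson_term D Q k x z" and ?B = "dyson_term E R (n - k) x z"
      have "kron ?A ?B * ?S z = kron ?A ?B * kron (Q z) (1\<^sub>m E) + kron ?A ?B * kron (1\<^sub>m D) (R z)"
        by (rule mult_add_distrib_mat[OF kron_carrier[OF dyson_carrier dyson_carrier]
              kron_carrier[OF Q.carrier one_carrier_mat] kron_carrier[OF one_carrier_mat R.carrier]])
      also have "\<dots> = kron (?A * Q z) ?B + kron ?A (?B * R z)"
        by (simp add: kron_mult[OF dyson_carrier Q.carrier dyson_carrier one_carrier_mat]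
            kron_mult[OF dyson_carrier one_carrier_mat dyson_carrier R.carrier]
            right_mult_one_mat[OF dyson_carrier])
      finally have *: "kron ?A ?B * ?S z = kron (?A * Q z) ?B + kron ?A (?B * R z)" .
      have AQ: "?A * Q z \<in> carrier_mat D D" and BR: "?B * R z \<in> carrier_mat E E"
        by (rule mult_carrier_mat[OF dyson_carrier Q.carrier] mult_carrier_mat[OF dyson_carrier R.carrier])+
      have K: "kron ?A (?B * R z) \<in> carrier_mat (D * E) (D * E)" by (rule kron_carrier[OF dyson_carrier BR])
      have "(kron ?A ?B * ?S z) $$ (i, j) = (?A * Q z) $$ (i1, j1) * ?B $$ (i2, j2) + ?A $$ (i1, j1) * (?B * R z) $$ (i2, j2)"
        unfolding * i1_def i2_def j1_def j2_def
        using ij j carrier_matD[OF K]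
        by (simp add: kron_entry[OF AQ dyson_carrier ij(1) j] kron_entry[OF dyson_carrier BR ij(1) j] del: index_mult_mat(1))
      then show "(kron ?A ?B * ?S z) $$ (i, j) = Q.integrand k x i1 j1 z * R.dyson_entry (n - k) x z i2 j2
          + Q.dyson_entry k x z i1 j1 * R.integrand (n - k) x i2 j2 z"
        by (simp only: mat_mult_entry[OF dyson_carrier Q.carrier b(1,3)] mat_mult_entry[OF dyson_carrier R.carrier b(2,4)])
    qed
    finally show ?thesis .
  qed
  have "S.dyson_entry (Suc n) x y i j = (LINT z:{x..y}|lborel. S.integrand n x i j z)"
    by (rule S.dyson_entry_Suc[OF ij(1) j])
  also have "\<dots> = (\<Sum>k\<le>Suc n. Q.dyson_entry k x y i1 j1 * R.dyson_entry (Suc n - k) x y i2 j2)"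
    unfolding S
    by (rule integral_convolution_rule[where A = "\<lambda>k t. Q.dyson_entry k x t i1 j1" and B = "\<lambda>k t. R.dyson_entry k x t i2 j2"])
      (rule Q.integrand_integrable[OF b(1,3)] R.integrand_integrable[OF b(2,4)]
        Q.dyson_entry_Suc[OF b(1,3)] R.dyson_entry_Suc[OF b(2,4)] Q.dyson_entry_0[OF b(1,3)] R.dyson_entry_0[OF b(2,4)])+
  finally show ?case unfolding i1_def i2_def j1_def j2_def .
qed

lemma path_exp_kron:
  assumes "path_ordered D Q" "path_ordered E R"
  shows "path_exp (D * E) (kron_sum D E Q R) x y = kron (path_exp D Q x y) (path_exp E R x y)"
proof (rule eq_matI)
  interpret Q: path_ordered D Q by fact
  interpret R: path_ordered E R by fact
  let ?S = "\<lambda>x. kron (Q x) (1\<^sub>m E) + kron (1\<^sub>m D) (R x)"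
  interpret S: path_ordered "D * E" ?S by (intro path_ordered_kron assms)
  fix i j assume "i < dim_row (kron (path_exp D Q x y) (path_exp E R x y))" "j < dim_col (kron (path_exp D Q x y) (path_exp E R x y))"
  then have ij: "i < D * E" "j < D * E" by (auto simp: path_exp_def kron_def)
  note dm = div_mod_less[OF ij(1)] div_mod_less[OF ij(2)]
  have "(\<lambda>n. \<Sum>k\<le>n. Q.dyson_entry k x y (i div E) (j div E) * R.dyson_entry (n - k) x y (i mod E) (j mod E))
      sums (path_exp D Q x y $$ (i div E, j div E) * path_exp E R x y $$ (i mod E, j mod E))"
    unfolding Q.path_exp_entry[OF dm(1,3)] R.path_exp_entry[OF dm(2,4)]
    by (rule Cauchy_product_sums[OF Q.dyson_entry_summable_norm[OF dm(1,3)] R.dyson_entry_summable_norm[OF dm(2,4)]])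
  then have "path_exp (D * E) ?S x y $$ (i, j) = path_exp D Q x y $$ (i div E, j div E) * path_exp E R x y $$ (i mod E, j mod E)"
    by (rule sums_unique2[OF S.dyson_entry_sums[OF ij, of x y, unfolded dyson_term_kron[OF assms ij]]])
  then show "path_exp (D * E) ?S x y $$ (i, j) = kron (path_exp D Q x y) (path_exp E R x y) $$ (i, j)"
    by (simp add: kron_entry[OF path_exp_carrier path_exp_carrier ij])
qed (auto simp: path_exp_def kron_def)

text \<open>Each letter acts in one factor only. The mixed-product rule appends it there, while the
  other factor continues across the position by \<open>path_exp_path_word\<close>.\<close>

lemma path_word_kron:
  assumes "path_ordered D Q" "path_ordered E R"
    and L: "\<And>t. L t \<in> carrier_mat D D" and K: "\<And>t. K t \<in> carrier_mat E E"
    and "sorted (a # map x ks @ [b])"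
  shows "path_word (D * E) (kron_sum D E Q R) a b
      (map (\<lambda>i. (x i, if P i then kron (L (x i)) (1\<^sub>m E) else kron (1\<^sub>m D) (K (x i)))) ks)
    = kron (path_word D Q a b (map (\<lambda>i. (x i, L (x i))) (filter P ks)))
        (path_word E R a b (map (\<lambda>i. (x i, K (x i))) (filter (\<lambda>i. \<not> P i) ks)))"
  using assms(5)
proof (induction ks arbitrary: a)
  case Nil
  then show ?case by (simp add: path_exp_kron[OF assms(1,2)])
next
  case (Cons i ks)
  interpret Q: path_ordered D Q by fact
  interpret R: path_ordered E R by fact
  let ?wl = "map (\<lambda>i. (x i, L (x i))) (filter P ks)"
  let ?wr = "map (\<lambda>i. (x i, K (x i))) (filter (\<lambda>i. \<not> P i) ks)"
  have ai: "a \<le> x i" and s: "sorted (x i # map x ks @ [b])" using Cons.prems by auto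
  have WL: "path_word D Q (x i) b ?wl \<in> carrier_mat D D" and WR: "path_word E R (x i) b ?wr \<in> carrier_mat E E"
    by (auto intro!: path_word_carrier L K)
  have sl: "sorted (x i # map fst ?wl @ [b])" and sr: "sorted (x i # map fst ?wr @ [b])"
    using s by (auto simp: sorted_append o_def sorted_map sorted_wrt_filter)
  note IH = Cons.IH[OF s]
  show ?case
  proof (cases "P i")
    case True
    have "kron (path_exp D Q a (x i)) (path_exp E R a (x i)) * kron (L (x i)) (1\<^sub>m E)
        * kron (path_word D Q (x i) b ?wl) (path_word E R (x i) b ?wr)
      = kron (path_exp D Q a (x i) * L (x i) * path_word D Q (x i) b ?wl) (path_exp E R a (x i) * path_word E R (x i) b ?wr)"
      by (simp add: kron_mult[OF path_exp_carrier L path_exp_carrier one_carrier_mat] right_mult_one_mat[OF path_exp_carrier]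
          kron_mult[OF mult_carrier_mat[OF path_exp_carrier L] WL path_exp_carrier WR])
    also have "path_exp E R a (x i) * path_word E R (x i) b ?wr = path_word E R a b ?wr"
      by (rule R.path_exp_path_word[OF ai sr]) (auto simp: K)
    finally show ?thesis using True by (simp add: IH path_exp_kron[OF assms(1,2)])
  next
    case False
    have "kron (path_exp D Q a (x i)) (path_exp E R a (x i)) * kron (1\<^sub>m D) (K (x i))
        * kron (path_word D Q (x i) b ?wl) (path_word E R (x i) b ?wr)
      = kron (path_exp D Q a (x i) * path_word D Q (x i) b ?wl) (path_exp E R a (x i) * K (x i) * path_word E R (x i) b ?wr)"
      by (simp add: kron_mult[OF path_exp_carrier one_carrier_mat path_exp_carrier K] right_mult_one_mat[OF path_exp_carrier]
          kron_mult[OF path_exp_carrier WL mult_carrier_mat[OF path_exp_carrier K] WR])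
    also have "path_exp D Q a (x i) * path_word D Q (x i) b ?wl = path_word D Q a b ?wl"
      by (rule Q.path_exp_path_word[OF ai sl]) (auto simp: L)
    finally show ?thesis using False by (simp add: IH path_exp_kron[OF assms(1,2)])
  qed
qed

section \<open>Restriction of the tensors to the interval\<close>

text \<open>The tensors are unconstrained outside the interval; cutting them off there makes the
  Dyson terms measurable functions of arbitrary real endpoints.\<close>

definition cut_off :: "real \<Rightarrow> nat \<Rightarrow> (real \<Rightarrow> complex mat) \<Rightarrow> real \<Rightarrow> complex mat" where
  "cut_off ell D Q z = (if z \<in> {- ell / 2..ell / 2} then Q z else 0\<^sub>m D D)"

lemma integrable_interval_measure:
  fixes f :: "real \<Rightarrow> 'a :: {banach, second_countable_topology}"
  shows "integrable (interval_measure ell) f \<longleftrightarrow> integrable lborel (\<lambda>x. indicat_real {- ell / 2..ell / 2} x *\<^sub>R f x)"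
  unfolding interval_measure_def by (rule integrable_restrict_space) simp

lemma path_ordered_cut:
  assumes "mat_integrable ell D Q"
  shows "path_ordered D (cut_off ell D Q)"
proof
  show "cut_off ell D Q x \<in> carrier_mat D D" for x using assms by (simp add: cut_off_def mat_integrable_def)
  show "integrable lborel (\<lambda>x. cut_off ell D Q x $$ (i, j))" if "i < D" "j < D" for i j
  proof -
    have "cut_off ell D Q x $$ (i, j) = indicat_real {- ell / 2..ell / 2} x *\<^sub>R Q x $$ (i, j)" for x
      using that by (auto simp: cut_off_def)
    then show ?thesis
      using assms that integrable_interval_measure[of ell "\<lambda>x. Q x $$ (i, j)"]
      by (simp add: mat_integrable_def)
  qed
qed

lemma path_word_cut:
  assumes "a \<in> {- ell / 2..ell / 2}" "b \<in> {- ell / 2..ell / 2}"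
    and "\<And>w. w \<in> set ws \<Longrightarrow> fst w \<in> {- ell / 2..ell / 2}"
  shows "path_word D Q a b ws = path_word D (cut_off ell D Q) a b ws"
  by (rule path_word_cong[of "- ell / 2" "ell / 2"]) (use assms in \<open>auto simp: cut_off_def\<close>)

section \<open>Block diagonal tensors\<close>

text \<open>One recursion step of \<open>diag_block_mat\<close>, so that direct sums of lists are
  handled by induction with two blocks at a time.\<close>

definition block_diag :: "complex mat \<Rightarrow> complex mat \<Rightarrow> complex mat" where
  "block_diag A B = four_block_mat A (0\<^sub>m (dim_row A) (dim_col B)) (0\<^sub>m (dim_row B) (dim_col A)) B"

lemma block_diag_carrier [simp]:
  "A \<in> carrier_mat n n \<Longrightarrow> B \<in> carrier_mat m m \<Longrightarrow> block_diag A B \<in> carrier_mat (n + m) (n + m)"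
  by (simp add: block_diag_def)

lemma block_diag_entry:
  assumes "A \<in> carrier_mat n n" "B \<in> carrier_mat m m" "i < n + m" "j < n + m"
  shows "block_diag A B $$ (i, j) = (if i < n then if j < n then A $$ (i, j) else 0
      else if j < n then 0 else B $$ (i - n, j - n))"
  using assms by (auto simp: block_diag_def)

lemma block_diag_mult:
  assumes "A \<in> carrier_mat n n" "B \<in> carrier_mat m m" "A' \<in> carrier_mat n n" "B' \<in> carrier_mat m m"
  shows "block_diag A B * block_diag A' B' = block_diag (A * A') (B * B')"
proof -
  have d: "dim_row A = n" "dim_col A = n" "dim_row B = m" "dim_col B = m"
    "dim_row A' = n" "dim_col A' = n" "dim_row B' = m" "dim_col B' = m"
    using assms by auto
  show ?thesis
    unfolding block_diag_def d index_mult_mat(2,3)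
    using mult_four_block_mat[OF assms(1) zero_carrier_mat zero_carrier_mat assms(2) assms(3) zero_carrier_mat zero_carrier_mat assms(4)] assms
    by simp
qed

lemma mat_trace_block_diag:
  assumes "A \<in> carrier_mat n n" "B \<in> carrier_mat m m"
  shows "mat_trace (block_diag A B) = mat_trace A + mat_trace B"
proof -
  have "mat_trace (block_diag A B) = (\<Sum>i<n + m. block_diag A B $$ (i, i))"
    using block_diag_carrier[OF assms] by (simp add: mat_trace_def)
  also have "\<dots> = (\<Sum>i<n. block_diag A B $$ (i, i)) + (\<Sum>i<m. block_diag A B $$ (n + i, n + i))"
    by (induction m) (simp_all add: add.assoc)
  also have "\<dots> = mat_trace A + mat_trace B"
    using assms by (simp add: block_diag_entry[OF assms] mat_trace_def)
  finally show ?thesis .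
qed

lemma dyson_term_block_diag:
  assumes Q: "\<And>x. Q x \<in> carrier_mat n n" and R: "\<And>x. R x \<in> carrier_mat m m"
  shows "dyson_term (n + m) (\<lambda>x. block_diag (Q x) (R x)) k x y = block_diag (dyson_term n Q k x y) (dyson_term m R k x y)"
proof (induction k arbitrary: y)
  case 0
  show ?case
    by (rule eq_matI) (auto simp: block_diag_entry[OF one_carrier_mat one_carrier_mat] carrier_matD[OF block_diag_carrier[OF one_carrier_mat one_carrier_mat]])
next
  case (Suc k)
  show ?case
  proof (rule eq_matI)
    fix i j
    assume "i < dim_row (block_diag (dyson_term n Q (Suc k) x y) (dyson_term m R (Suc k) x y))"
      "j < dim_col (block_diag (dyson_term n Q (Suc k) x y) (dyson_term m R (Suc k) x y))"
    then have ij: "i < n + m" "j < n + m" by (auto simp: block_diag_def)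
    have c: "dyson_term n Q k x z * Q z \<in> carrier_mat n n" "dyson_term m R k x z * R z \<in> carrier_mat m m" for z
      using mult_carrier_mat[OF dyson_carrier Q] mult_carrier_mat[OF dyson_carrier R] by auto
    show "dyson_term (n + m) (\<lambda>x. block_diag (Q x) (R x)) (Suc k) x y $$ (i, j)
        = block_diag (dyson_term n Q (Suc k) x y) (dyson_term m R (Suc k) x y) $$ (i, j)"
      unfolding block_diag_entry[OF dyson_carrier dyson_carrier ij]
      using ij by (simp add: Suc block_diag_mult[OF dyson_carrier dyson_carrier Q R] block_diag_entry[OF c ij] del: index_mult_mat(1))
  qed (auto simp: block_diag_def)
qed

lemma path_exp_block_diag:
  assumes Q: "\<And>x. Q x \<in> carrier_mat n n" and R: "\<And>x. R x \<in> carrier_mat m m"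
  shows "path_exp (n + m) (\<lambda>x. block_diag (Q x) (R x)) x y = block_diag (path_exp n Q x y) (path_exp m R x y)"
proof (rule eq_matI)
  fix i j
  assume "i < dim_row (block_diag (path_exp n Q x y) (path_exp m R x y))"
    "j < dim_col (block_diag (path_exp n Q x y) (path_exp m R x y))"
  then have ij: "i < n + m" "j < n + m" by (auto simp: block_diag_def path_exp_def)
  show "path_exp (n + m) (\<lambda>x. block_diag (Q x) (R x)) x y $$ (i, j) = block_diag (path_exp n Q x y) (path_exp m R x y) $$ (i, j)"
    unfolding block_diag_entry[OF path_exp_carrier path_exp_carrier ij]
    using ij by (simp add: path_exp_def dyson_term_block_diag[OF Q R] block_diag_entry[OF dyson_carrier dyson_carrier ij])
qed (auto simp: block_diag_def path_exp_def)

lemma path_word_block_diag: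
  assumes Q: "\<And>x. Q x \<in> carrier_mat n n" and R: "\<And>x. R x \<in> carrier_mat m m"
    and K: "\<And>i. K i \<in> carrier_mat n n" and L: "\<And>i. L i \<in> carrier_mat m m"
  shows "path_word (n + m) (\<lambda>x. block_diag (Q x) (R x)) a b (map (\<lambda>i. (x i, block_diag (K i) (L i))) ks)
    = block_diag (path_word n Q a b (map (\<lambda>i. (x i, K i)) ks)) (path_word m R a b (map (\<lambda>i. (x i, L i)) ks))"
proof (induction ks arbitrary: a)
  case Nil
  then show ?case by (simp add: path_exp_block_diag[OF Q R])
next
  case (Cons i ks)
  have c: "path_word n Q (x i) b (map (\<lambda>i. (x i, K i)) ks) \<in> carrier_mat n n"
    "path_word m R (x i) b (map (\<lambda>i. (x i, L i)) ks) \<in> carrier_mat m m"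
    by (auto intro!: path_word_carrier K L)
  show ?case
    by (simp add: Cons path_exp_block_diag[OF Q R] block_diag_mult[OF path_exp_carrier path_exp_carrier K L]
        block_diag_mult[OF mult_carrier_mat[OF path_exp_carrier K] mult_carrier_mat[OF path_exp_carrier L] c])
qed

text \<open>The scalar weight of a word of legs. All dependence of the Dyson expansion on the
  tensors sits here, so a direct sum has to be analysed for this factor only.\<close>

definition cmpo_amplitude :: "real \<Rightarrow> nat \<Rightarrow> cmpo \<Rightarrow> leg list \<Rightarrow> (nat \<Rightarrow> real) \<Rightarrow> complex" where
  "cmpo_amplitude ell D W \<alpha> x = mat_trace (cmpo_B W * path_word D (cmpo_Q W) (- ell / 2) (ell / 2)
         (map (\<lambda>i. (x i, leg_mat W (\<alpha> ! i) (x i))) [0..<length \<alpha>]))"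

lemma cmpo_tensorsD:
  assumes "cmpo_tensors ell D W"
  shows "cmpo_B W \<in> carrier_mat D D" "cmpo_Q W x \<in> carrier_mat D D" "leg_mat W s x \<in> carrier_mat D D"
  using assms by (cases s; auto simp: cmpo_tensors_def mat_integrable_def mat_sq_integrable_def mat_bounded_def)+

lemma diag_block_mat_Cons:
  "diag_block_mat (A # As) = block_diag A (diag_block_mat As)"
  by (simp add: block_diag_def Let_def)

lemma leg_mat_direct_sum:
  "leg_mat (direct_sum_cmpo (W # Ws)) s x = block_diag (leg_mat W s x) (leg_mat (direct_sum_cmpo Ws) s x)"
  by (cases s) (simp_all add: direct_sum_cmpo_def diag_block_mat_Cons del: diag_block_mat.simps)

text \<open>Block diagonal matrices multiply blockwise, hence a whole word is block diagonal and its
  trace is the sum of the traces of the blocks.\<close>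

lemma cmpo_tensors_block_diag:
  assumes W: "cmpo_tensors ell n W" and V: "cmpo_tensors ell m V"
    and U: "cmpo_B U = block_diag (cmpo_B W) (cmpo_B V)" "\<And>x. cmpo_Q U x = block_diag (cmpo_Q W x) (cmpo_Q V x)"
      "\<And>x s. leg_mat U s x = block_diag (leg_mat W s x) (leg_mat V s x)"
  shows "cmpo_tensors ell (n + m) U"
    and "cmpo_amplitude ell (n + m) U \<alpha> x = cmpo_amplitude ell n W \<alpha> x + cmpo_amplitude ell m V \<alpha> x"
proof -
  note dW = cmpo_tensorsD[OF W] and dV = cmpo_tensorsD[OF V]
  \<comment> \<open>Every regularity condition is entrywise, so it passes to the block matrix once
    it holds for both blocks and for the zero function.\<close>
  have P: "(\<forall>i<n + m. \<forall>j<n + m. P (\<lambda>x. block_diag (X x) (Y x) $$ (i, j)))"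
    if "\<forall>i<n. \<forall>j<n. P (\<lambda>x. X x $$ (i, j))" "\<forall>i<m. \<forall>j<m. P (\<lambda>x. Y x $$ (i, j))" "P (\<lambda>x. 0)"
      "\<And>x. X x \<in> carrier_mat n n" "\<And>x. Y x \<in> carrier_mat m m" for P and X Y :: "real \<Rightarrow> complex mat"
  proof (intro allI impI)
    fix i j assume ij: "i < n + m" "j < n + m"
    show "P (\<lambda>x. block_diag (X x) (Y x) $$ (i, j))"
      unfolding block_diag_entry[OF that(4,5) ij] using that(1-3) ij
      by (cases "i < n"; cases "j < n") auto
  qed
  have L: "cmpo_L X x = leg_mat X Left x" "cmpo_R X x = leg_mat X Right x" "cmpo_T X x = leg_mat X Adj x" for X x
    by simp_all
  have sq: "\<forall>i<n + m. \<forall>j<n + m. (\<lambda>x. block_diag (leg_mat W s x) (leg_mat V s x) $$ (i, j)) \<in> borel_measurable (interval_measure ell) \<and>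
      integrable (interval_measure ell) (\<lambda>x. (cmod (block_diag (leg_mat W s x) (leg_mat V s x) $$ (i, j)))\<^sup>2)"
    if "s \<noteq> Adj" for s
    by (rule P[where P = "\<lambda>f. f \<in> borel_measurable (interval_measure ell) \<and> integrable (interval_measure ell) (\<lambda>x. (cmod (f x))\<^sup>2)"])
      (use W V dW(3) dV(3) that in \<open>cases s; auto simp: cmpo_tensors_def mat_sq_integrable_def\<close>)+
  show "cmpo_tensors ell (n + m) U"
    unfolding cmpo_tensors_def mat_integrable_def mat_sq_integrable_def mat_bounded_def L U
  proof (intro conjI)
    show "\<forall>i<n + m. \<forall>j<n + m. integrable (interval_measure ell) (\<lambda>x. block_diag (cmpo_Q W x) (cmpo_Q V x) $$ (i, j))"
      by (rule P) (use W V dW dV in \<open>auto simp: cmpo_tensors_def mat_integrable_def\<close>)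
    show "\<forall>i<n + m. \<forall>j<n + m. (\<lambda>x. block_diag (leg_mat W Adj x) (leg_mat V Adj x) $$ (i, j)) \<in> borel_measurable (interval_measure ell) \<and>
        (\<exists>C. \<forall>x\<in>{- ell / 2..ell / 2}. cmod (block_diag (leg_mat W Adj x) (leg_mat V Adj x) $$ (i, j)) \<le> C)"
      by (rule P[where P = "\<lambda>f. f \<in> borel_measurable (interval_measure ell) \<and> (\<exists>C. \<forall>x\<in>{- ell / 2..ell / 2}. cmod (f x) \<le> C)"])
        (use W V dW(3)[where s = Adj] dV(3)[where s = Adj] in \<open>auto simp: cmpo_tensors_def mat_bounded_def\<close>)
  qed (use dW dV sq[of Left] sq[of Right] in \<open>simp_all del: leg_mat.simps\<close>)
  have c: "path_word n (cmpo_Q W) a b (map (\<lambda>i. (x i, leg_mat W (\<alpha> ! i) (x i))) ks) \<in> carrier_mat n n"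
    "path_word m (cmpo_Q V) a b (map (\<lambda>i. (x i, leg_mat V (\<alpha> ! i) (x i))) ks) \<in> carrier_mat m m" for a b ks
    using dW(3) dV(3) by (auto intro!: path_word_carrier)
  have Q: "cmpo_Q U = (\<lambda>x. block_diag (cmpo_Q W x) (cmpo_Q V x))" using U(2) by (rule ext)
  show "cmpo_amplitude ell (n + m) U \<alpha> x = cmpo_amplitude ell n W \<alpha> x + cmpo_amplitude ell m V \<alpha> x"
    unfolding cmpo_amplitude_def U Q path_word_block_diag[OF dW(2) dV(2) dW(3) dV(3)]
      block_diag_mult[OF dW(1) dV(1) c]
    by (rule mat_trace_block_diag[OF mult_carrier_mat[OF dW(1) c(1)] mult_carrier_mat[OF dV(1) c(2)]])
qed

lemma cmpo_tensors_direct_sum: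
  assumes "\<And>p. p \<in> set ps \<Longrightarrow> cmpo_tensors ell (fst p) (snd p)"
  shows "cmpo_tensors ell (sum_list (map fst ps)) (direct_sum_cmpo (map snd ps)) \<and>
    cmpo_amplitude ell (sum_list (map fst ps)) (direct_sum_cmpo (map snd ps)) \<alpha> x
      = (\<Sum>p\<leftarrow>ps. cmpo_amplitude ell (fst p) (snd p) \<alpha> x)"
  using assms
proof (induction ps)
  case Nil
  show ?case
    by (auto simp: direct_sum_cmpo_def cmpo_tensors_def mat_integrable_def mat_sq_integrable_def mat_bounded_def
        cmpo_amplitude_def mat_trace_def)
next
  case (Cons p ps)
  have IH: "cmpo_tensors ell (sum_list (map fst ps)) (direct_sum_cmpo (map snd ps))"
    using Cons by simp
  have p: "cmpo_tensors ell (fst p) (snd p)" using Cons.prems by simp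
  have "cmpo_B (direct_sum_cmpo (map snd (p # ps))) = block_diag (cmpo_B (snd p)) (cmpo_B (direct_sum_cmpo (map snd ps)))"
    "\<And>x. cmpo_Q (direct_sum_cmpo (map snd (p # ps))) x = block_diag (cmpo_Q (snd p) x) (cmpo_Q (direct_sum_cmpo (map snd ps)) x)"
    "\<And>x s. leg_mat (direct_sum_cmpo (map snd (p # ps))) s x = block_diag (leg_mat (snd p) s x) (leg_mat (direct_sum_cmpo (map snd ps)) s x)"
    by (simp_all add: leg_mat_direct_sum) (simp_all add: direct_sum_cmpo_def diag_block_mat_Cons del: diag_block_mat.simps)
  note bd = cmpo_tensors_block_diag[OF p IH this]
  show ?case using bd(1) bd(2)[of \<alpha> x] Cons by simp
qed

section \<open>Continuous matrix product states are Fock vectors\<close>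

lemma space_configD:
  assumes "x \<in> space (config ell N)" "k < N"
  shows "x k \<in> {- ell / 2..ell / 2}"
  using PiE_mem[of x "{..<N}" "\<lambda>_. {- ell / 2..ell / 2}" k] assms by (simp only: space_config lessThan_iff)

lemma smeared_creation_perm:
  assumes p: "p permutes {..<N}"
  shows "smeared_creation N f (y \<circ> p) = smeared_creation N f y"
  unfolding smeared_creation_def comp_assoc
  by (subst (2) setum_permutations_compose_left[OF p]) (rule refl)

text \<open>An increasing configuration is sorted by the identity alone, so one summand
  survives.\<close>

lemma smeared_creation_simplex:
  assumes y: "strict_mono_on {..<N} y"
  shows "smeared_creation N f y = f y / complex_of_real (sqrt (fact N))"
proof -
  have u: "p = id" if "p permutes {..<N}" "strict_mono_on {..<N} (y \<circ> p)" for p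
  proof -
    have "id permutes {..<N} \<and> strict_mono_on {..<N} (y \<circ> id)" using y permutes_id by simp
    then show ?thesis
      using ex1_sorting_permutation[OF strict_mono_on_imp_inj_on[OF y]] that by blast
  qed
  have "(\<Sum>p | p permutes {..<N}. if strict_mono_on {..<N} (y \<circ> p) then f (y \<circ> p) else 0)
      = (\<Sum>p | p permutes {..<N}. if p = id then f y else 0)"
  proof (rule sum.cong[OF refl])
    fix p assume "p \<in> {p. p permutes {..<N}}"
    then show "(if strict_mono_on {..<N} (y \<circ> p) then f (y \<circ> p) else 0) = (if p = id then f y else 0)"
      using u[of p] y by (cases "strict_mono_on {..<N} (y \<circ> p)") auto
  qed
  also have "\<dots> = f y" by (simp add: finite_permutations permutes_id)
  finally show ?thesis by (simp only: smeared_creation_def)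
qed

text \<open>At most one permutation sorts \<open>y\<close>, so at most one summand is nonzero. The
  triangle inequality would cost a factor \<open>fact N\<close> and with it the convergence of the
  norm.\<close>

lemma smeared_creation_bound:
  assumes f: "\<And>p. p permutes {..<N} \<Longrightarrow> cmod (f (y \<circ> p)) \<le> g" and "0 \<le> g"
  shows "cmod (smeared_creation N f y) \<le> g / sqrt (fact N)"
proof (cases "\<exists>p. p permutes {..<N} \<and> strict_mono_on {..<N} (y \<circ> p)")
  case True
  then obtain p where p: "p permutes {..<N}" "strict_mono_on {..<N} (y \<circ> p)" by blast
  have "smeared_creation N f y = f (y \<circ> p) / complex_of_real (sqrt (fact N))"
    using smeared_creation_perm[OF p(1), of f y] smeared_creation_simplex[OF p(2), of f] by simp
  then have "cmod (smeared_creation N f y) = cmod (f (y \<circ> p)) / sqrt (fact N)"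
    by (simp add: norm_divide)
  then show ?thesis using f[OF p(1)] by (simp add: divide_right_mono)
next
  case False
  then have "smeared_creation N f y = 0"
    by (auto simp: smeared_creation_def intro!: sum.neutral)
  then show ?thesis using assms(2) by simp
qed

section \<open>Measurability and square integrability of the amplitudes\<close>

definition cmps_amplitude ::
  "real \<Rightarrow> nat \<Rightarrow> complex mat \<Rightarrow> (real \<Rightarrow> complex mat) \<Rightarrow> (real \<Rightarrow> complex mat) \<Rightarrow> nat \<Rightarrow> (nat \<Rightarrow> real) \<Rightarrow> complex" where
  "cmps_amplitude ell D B Q L N x = mat_trace (B * path_word D Q (- ell / 2) (ell / 2) (map (\<lambda>i. (x i, L (x i))) [0..<N]))"

lemma cmps_eq: "cmps ell D B Q L N = smeared_creation N (cmps_amplitude ell D B Q L N)"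
  by (simp add: cmps_def cmps_amplitude_def[abs_def])

context path_ordered begin

text \<open>The starting point is allowed to depend on the configuration, because the tail of a word
  starts at the position of the letter just removed.\<close>

lemma path_word_measurable:
  assumes L: "\<And>x. L x \<in> carrier_mat D D"
    and Lm: "\<And>i j. i < D \<Longrightarrow> j < D \<Longrightarrow> (\<lambda>x. L x $$ (i, j)) \<in> borel_measurable (interval_measure ell)"
    and "s \<in> borel_measurable (config ell N)" "\<And>k. k \<in> set ks \<Longrightarrow> k < N" "i < D" "j < D"
  shows "(\<lambda>x. path_word D Q (s x) b (map (\<lambda>k. (x k, L (x k))) ks) $$ (i, j)) \<in> borel_measurable (config ell N)"
  using assms(3-)
proof (induction ks arbitrary: s i)
  case Nil
  have "(\<lambda>x. (s x, b)) \<in> measurable (config ell N) (borel \<Otimes>\<^sub>M borel)"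
    using Nil.prems(1) by simp
  from measurable_compose[OF this path_exp_measurable[OF Nil.prems(3,4)]]
  show ?case by simp
next
  case (Cons k ks)
  have k: "k < N" using Cons.prems by simp
  have xk: "(\<lambda>x. x k) \<in> borel_measurable (config ell N)" by (rule measurable_config_component[OF k])
  have pair: "(\<lambda>x. (s x, x k)) \<in> measurable (config ell N) (borel \<Otimes>\<^sub>M borel)"
    using Cons.prems(1) xk by simp
  have 1: "(\<lambda>x. path_exp D Q (s x) (x k) $$ (i, p)) \<in> borel_measurable (config ell N)" if "p < D" for p
    using measurable_compose[OF pair path_exp_measurable[OF Cons.prems(3) that]] by simp
  have 2: "(\<lambda>x. L (x k) $$ (p, q)) \<in> borel_measurable (config ell N)" if "p < D" "q < D" for p q
  proof (rule measurable_compose[OF _ Lm[OF that]])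
    show "(\<lambda>x. x k) \<in> measurable (config ell N) (interval_measure ell)"
      using k unfolding config_def by simp
  qed
  have 3: "(\<lambda>x. path_word D Q (x k) b (map (\<lambda>k. (x k, L (x k))) ks) $$ (q, j)) \<in> borel_measurable (config ell N)" if "q < D" for q
    using Cons.IH[OF xk _ that Cons.prems(4)] Cons.prems(2) by simp
  have W: "path_word D Q a b (map (\<lambda>k. (x k, L (x k))) ks) \<in> carrier_mat D D" for x :: "nat \<Rightarrow> real" and a
    by (auto intro!: path_word_carrier L)
  have "path_word D Q (s x) b (map (\<lambda>k. (x k, L (x k))) (k # ks)) $$ (i, j)
      = (\<Sum>q<D. (\<Sum>p<D. path_exp D Q (s x) (x k) $$ (i, p) * L (x k) $$ (p, q)) * path_word D Q (x k) b (map (\<lambda>k. (x k, L (x k))) ks) $$ (q, j))" for x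
    using Cons.prems(3,4)
    by (simp add: mat_mult_entry[OF mult_carrier_mat[OF path_exp_carrier L] W] mat_mult_entry[OF path_exp_carrier L] del: index_mult_mat(1))
  then show ?case
    by (simp only:) (intro borel_measurable_sum borel_measurable_times 1 2 3; simp)
qed

text \<open>One factor \<open>C\<close> for each exponential, of which there is one more than
  letters, and one factor \<open>l\<close> for each letter. Summing \<open>l\<close> over all
  entries absorbs both matrix index sums.\<close>

lemma path_word_bound:
  fixes l :: "real \<Rightarrow> real"
  assumes L: "\<And>x. L x \<in> carrier_mat D D"
    and "i < D" "j < D"
  defines "C \<equiv> exp (LINT z|lborel. growth z)"
    and "l \<equiv> \<lambda>t. \<Sum>p<D. \<Sum>q<D. cmod (L t $$ (p, q))"
  shows "cmod (path_word D Q a b (map (\<lambda>k. (x k, L (x k))) ks) $$ (i, j)) \<le> C ^ Suc (length ks) * (\<Prod>k\<leftarrow>ks. l (x k))"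
  using assms(2)
proof (induction ks arbitrary: a i)
  case Nil
  then show ?case using path_exp_bound[OF Nil assms(3)] by (simp add: C_def)
next
  case (Cons k ks)
  have C: "C \<ge> 0" by (simp add: C_def)
  have l: "l t \<ge> 0" for t by (simp add: l_def sum_nonneg)
  have pl: "(\<Prod>k\<leftarrow>ks. l (x k)) \<ge> 0" by (induction ks) (simp_all add: l)
  let ?W = "path_word D Q (x k) b (map (\<lambda>k. (x k, L (x k))) ks)"
  have W: "?W \<in> carrier_mat D D" by (auto intro!: path_word_carrier L)
  let ?M = "C ^ Suc (length ks) * (\<Prod>k\<leftarrow>ks. l (x k))"
  have "path_word D Q a b (map (\<lambda>k. (x k, L (x k))) (k # ks)) $$ (i, j)
      = (\<Sum>q<D. (\<Sum>p<D. path_exp D Q a (x k) $$ (i, p) * L (x k) $$ (p, q)) * ?W $$ (q, j))"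
    using Cons.prems assms(3)
    by (simp add: mat_mult_entry[OF mult_carrier_mat[OF path_exp_carrier L] W] mat_mult_entry[OF path_exp_carrier L] del: index_mult_mat(1))
  also have "cmod \<dots> \<le> (\<Sum>q<D. (\<Sum>p<D. C * cmod (L (x k) $$ (p, q))) * ?M)"
  proof (intro order_trans[OF norm_sum] sum_mono)
    fix q assume "q \<in> {..<D}"
    then have q: "q < D" by simp
    have "cmod (\<Sum>p<D. path_exp D Q a (x k) $$ (i, p) * L (x k) $$ (p, q)) \<le> (\<Sum>p<D. C * cmod (L (x k) $$ (p, q)))"
      by (intro order_trans[OF norm_sum] sum_mono)
        (auto simp: norm_mult C_def intro!: mult_right_mono path_exp_bound Cons.prems)
    then show "cmod ((\<Sum>p<D. path_exp D Q a (x k) $$ (i, p) * L (x k) $$ (p, q)) * ?W $$ (q, j))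
        \<le> (\<Sum>p<D. C * cmod (L (x k) $$ (p, q))) * ?M"
      unfolding norm_mult by (intro mult_mono Cons.IH q sum_nonneg) (auto simp: C)
  qed
  also have "\<dots> = C * l (x k) * ?M"
  proof -
    have "l (x k) = (\<Sum>q<D. \<Sum>p<D. cmod (L (x k) $$ (p, q)))"
      unfolding l_def by (rule sum.swap)
    then show ?thesis by (simp only: sum_distrib_left[symmetric] sum_distrib_right[symmetric])
  qed
  finally show ?case by (simp add: mult_ac)
qed

end

context
  fixes ell :: real and D :: nat and B :: "complex mat" and Q L :: "real \<Rightarrow> complex mat"
  assumes tensors: "cmps_tensors ell D B Q L"
begin

abbreviation full_word :: "nat \<Rightarrow> (nat \<Rightarrow> real) \<Rightarrow> complex mat" where
  "full_word N x \<equiv> path_word D (cut_off ell D Q) (- ell / 2) (ell / 2) (map (\<lambda>i. (x i, L (x i))) [0..<N])"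

lemma cmps_tensors_carrier: "B \<in> carrier_mat D D" "Q x \<in> carrier_mat D D" "L x \<in> carrier_mat D D"
  using tensors by (auto simp: cmps_tensors_def mat_integrable_def mat_sq_integrable_def)

lemma path_ordered_cmps: "path_ordered D (cut_off ell D Q)"
  using tensors by (intro path_ordered_cut) (simp add: cmps_tensors_def)

lemma cmps_amplitude_entries:
  assumes "0 < ell" "\<And>k. k < N \<Longrightarrow> x k \<in> {- ell / 2..ell / 2}"
  shows "cmps_amplitude ell D B Q L N x
    = (\<Sum>i<D. \<Sum>k<D. B $$ (i, k) * (full_word N x) $$ (k, i))"
proof -
  let ?W = "(full_word N x)"
  have W: "?W \<in> carrier_mat D D" by (auto intro!: path_word_carrier cmps_tensors_carrier)
  have "cmps_amplitude ell D B Q L N x = mat_trace (B * ?W)"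
    unfolding cmps_amplitude_def using assms by (subst path_word_cut) auto
  then show ?thesis
    using cmps_tensors_carrier(1) mat_mult_entry[OF cmps_tensors_carrier(1) W]
    by (simp add: mat_trace_def del: index_mult_mat(1))
qed

lemma cmps_amplitude_measurable:
  assumes "0 < ell"
  shows "cmps_amplitude ell D B Q L N \<in> borel_measurable (config ell N)"
proof -
  interpret path_ordered D "cut_off ell D Q" by (rule path_ordered_cmps)
  have "(\<lambda>x. \<Sum>i<D. \<Sum>k<D. B $$ (i, k) * (full_word N x) $$ (k, i))
      \<in> borel_measurable (config ell N)"
    using tensors
    by (intro borel_measurable_sum borel_measurable_times borel_measurable_const path_word_measurable cmps_tensors_carrier)
      (auto simp: cmps_tensors_def mat_sq_integrable_def)
  moreover have "cmps_amplitude ell D B Q L N x = (\<Sum>i<D. \<Sum>k<D. B $$ (i, k) *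
      (full_word N x) $$ (k, i))"
    if "x \<in> space (config ell N)" for x
    by (intro cmps_amplitude_entries[OF assms] space_configD[OF that])
  ultimately show ?thesis by (subst measurable_cong)
qed

lemma cmps_measurable:
  assumes "0 < ell"
  shows "cmps ell D B Q L N \<in> borel_measurable (config ell N)"
proof -
  have "(\<lambda>y. if strict_mono_on {..<N} (y \<circ> p) then cmps_amplitude ell D B Q L N (y \<circ> p) else 0)
      \<in> borel_measurable (config ell N)" if "p permutes {..<N}" for p
    using measurable_strict_mono[OF that, of ell] measurable_compose[OF config_perm(1)[OF that] cmps_amplitude_measurable[OF assms]]
    by (intro measurable_If) auto
  then show ?thesis unfolding cmps_eq smeared_creation_def[abs_def]
    by (intro borel_measurable_divide borel_measurable_sum borel_measurable_const) auto
qed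

lemma cmps_bound:
  assumes "0 < ell"
  obtains c l where "0 \<le> c" "\<And>t. 0 \<le> l t" "integrable (interval_measure ell) (\<lambda>t. (l t)\<^sup>2)"
    "\<And>N y. y \<in> space (config ell N) \<Longrightarrow> cmod (cmps ell D B Q L N y) \<le> c ^ Suc N * (\<Prod>i<N. l (y i)) / sqrt (fact N)"
proof -
  interpret path_ordered D "cut_off ell D Q" by (rule path_ordered_cmps)
  define C where "C = exp (LINT z|lborel. growth z)"
  define l where "l t = (\<Sum>p<D. \<Sum>q<D. cmod (L t $$ (p, q)))" for t
  \<comment> \<open>The summand 1 ensures \<open>b \<le> b ^ Suc N\<close>, so that the boundary
    matrix is absorbed into a single geometric constant \<open>b * C\<close>.\<close>
  define b where "b = 1 + (\<Sum>i<D. \<Sum>k<D. cmod (B $$ (i, k)))"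
  have C: "C \<ge> 0" by (simp add: C_def)
  have l: "l t \<ge> 0" for t by (simp add: l_def sum_nonneg)
  have b: "b \<ge> 1" by (simp add: b_def sum_nonneg)
  have amp: "cmod (cmps_amplitude ell D B Q L N x) \<le> (b * C) ^ Suc N * (\<Prod>i<N. l (x i))"
    if x: "\<And>k. k < N \<Longrightarrow> x k \<in> {- ell / 2..ell / 2}" for N x
  proof -
    let ?W = "(full_word N x)"
    let ?M = "C ^ Suc N * (\<Prod>i<N. l (x i))"
    have pr: "(\<Prod>k\<leftarrow>[0..<N]. l (x k)) = (\<Prod>i<N. l (x i))"
      by (subst prod.distinct_set_conv_list[symmetric]) (auto simp: atLeast0LessThan)
    have M: "?M \<ge> 0" by (intro mult_nonneg_nonneg zero_le_power prod_nonneg) (auto simp: C l)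
    have "cmod (cmps_amplitude ell D B Q L N x) \<le> (\<Sum>i<D. \<Sum>k<D. cmod (B $$ (i, k)) * ?M)"
    proof (subst cmps_amplitude_entries[OF assms x], assumption, intro order_trans[OF norm_sum] sum_mono)
      fix i k assume "i \<in> {..<D}" "k \<in> {..<D}"
      then show "cmod (B $$ (i, k) * ?W $$ (k, i)) \<le> cmod (B $$ (i, k)) * ?M"
        using path_word_bound[where L = L and i = k and j = i and a = "- ell / 2" and b = "ell / 2" and x = x and ks = "[0..<N]", OF cmps_tensors_carrier(3)]
        unfolding norm_mult C_def[symmetric] l_def[symmetric] pr by (intro mult_left_mono) auto
    qed
    also have "\<dots> = (b - 1) * ?M" by (simp add: b_def sum_distrib_right)
    also have "\<dots> \<le> b ^ Suc N * ?M"
    proof (rule mult_right_mono[OF _ M])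
      have "b \<le> b ^ Suc N" using b by (intro self_le_power) auto
      then show "b - 1 \<le> b ^ Suc N" by linarith
    qed
    finally show ?thesis by (simp add: power_mult_distrib mult_ac)
  qed
  have "cmod (cmps ell D B Q L N y) \<le> (b * C) ^ Suc N * (\<Prod>i<N. l (y i)) / sqrt (fact N)"
    if y: "y \<in> space (config ell N)" for N y
    unfolding cmps_eq
  proof (rule smeared_creation_bound)
    fix p assume p: "p permutes {..<N}"
    have "cmod (cmps_amplitude ell D B Q L N (y \<circ> p)) \<le> (b * C) ^ Suc N * (\<Prod>i<N. l ((y \<circ> p) i))"
      unfolding o_def using permutes_in_image[OF p] by (intro amp space_configD[OF y]) simp
    also have "(\<Prod>i<N. l ((y \<circ> p) i)) = (\<Prod>i<N. l (y i))"
      using prod.permute[OF p, of "\<lambda>i. l (y i)"] by (simp add: o_def)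
    finally show "cmod (cmps_amplitude ell D B Q L N (y \<circ> p)) \<le> (b * C) ^ Suc N * (\<Prod>i<N. l (y i))" .
  qed (use b C l in \<open>auto intro!: mult_nonneg_nonneg zero_le_power prod_nonneg\<close>)
  moreover have "integrable (interval_measure ell) (\<lambda>t. (l t)\<^sup>2)"
  proof (rule Bochner_Integration.integrable_bound)
    show "integrable (interval_measure ell) (\<lambda>t. real D * (\<Sum>p<D. real D * (\<Sum>q<D. (cmod (L t $$ (p, q)))\<^sup>2)))"
      using tensors by (intro integrable_mult_right Bochner_Integration.integrable_sum) (auto simp: cmps_tensors_def mat_sq_integrable_def)
    have "(\<lambda>t. L t $$ (p, q)) \<in> borel_measurable (interval_measure ell)" if "p < D" "q < D" for p q
      using tensors that by (auto simp: cmps_tensors_def mat_sq_integrable_def)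
    then show "(\<lambda>t. (l t)\<^sup>2) \<in> borel_measurable (interval_measure ell)"
      unfolding l_def by (intro borel_measurable_power borel_measurable_sum borel_measurable_norm) auto
    \<comment> \<open>Cauchy-Schwarz over \<open>D\<close> terms, used once for the rows and once
      for the columns; this accounts for the two factors \<open>real D\<close> in the dominating
      function.\<close>
    have cs: "(\<Sum>p<D. f p)\<^sup>2 \<le> real D * (\<Sum>p<D. (f p)\<^sup>2)" for f :: "nat \<Rightarrow> real"
      using sum_squared_le_sum_of_squares[of f "{..<D}"] by (simp add: mult.commute)
    have "(l t)\<^sup>2 \<le> real D * (\<Sum>p<D. real D * (\<Sum>q<D. (cmod (L t $$ (p, q)))\<^sup>2))" for t
      unfolding l_def by (intro order_trans[OF cs] mult_left_mono sum_mono cs) auto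
    then show "AE t in interval_measure ell. norm ((l t)\<^sup>2) \<le> norm (real D * (\<Sum>p<D. real D * (\<Sum>q<D. (cmod (L t $$ (p, q)))\<^sup>2)))"
      unfolding real_norm_def abs_power2 power2_abs by (intro AE_I2 order_trans[OF _ abs_ge_self])
  qed
  ultimately show ?thesis using that[of "b * C" l] b C l by simp
qed

text \<open>The squared bound is a product of one-particle functions, so its integral over the cube
  is a power of \<Lambda>. The factor \<open>1 / fact N\<close> left over from the normalization
  makes the norm series exponential.\<close>

lemma cmps_in_fock:
  assumes "0 < ell"
  shows "cmps ell D B Q L \<in> fock ell"
proof -
  interpret product_sigma_finite "\<lambda>_. interval_measure ell" by (rule product_sigma_finite_interval)
  obtain c l where c: "0 \<le> c" and l: "\<And>t. 0 \<le> l t" and li: "integrable (interval_measure ell) (\<lambda>t. (l t)\<^sup>2)"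
    and bound: "\<And>N y. y \<in> space (config ell N) \<Longrightarrow> cmod (cmps ell D B Q L N y) \<le> c ^ Suc N * (\<Prod>i<N. l (y i)) / sqrt (fact N)"
    using cmps_bound[OF assms] by blast
  let ?g = "\<lambda>N y. c\<^sup>2 * (c\<^sup>2) ^ N * (\<Prod>i<N. (l (y i))\<^sup>2) / fact N"
  define \<Lambda> where "\<Lambda> = (LINT t|interval_measure ell. (l t)\<^sup>2)"
  have sq: "(cmod (cmps ell D B Q L N y))\<^sup>2 \<le> ?g N y" if "y \<in> space (config ell N)" for N y
  proof -
    have "(cmod (cmps ell D B Q L N y))\<^sup>2 \<le> (c ^ Suc N * (\<Prod>i<N. l (y i)) / sqrt (fact N))\<^sup>2"
      by (intro power_mono bound that) simp
    also have "\<dots> = ?g N y"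
      by (simp add: power_mult_distrib power_divide prod_power_distrib[symmetric] power_mult[symmetric] mult.commute[of 2])
    finally show ?thesis .
  qed
  have gi: "integrable (config ell N) (?g N)" for N
    using product_integrable_prod[of "{..<N}" "\<lambda>_ t. (l t)\<^sup>2"] li by (simp add: config_def)
  have g: "(LINT y|config ell N. ?g N y) = c\<^sup>2 * ((c\<^sup>2 * \<Lambda>) ^ N / fact N)" for N
    using product_integral_prod[of "{..<N}" "\<lambda>_ t. (l t)\<^sup>2"] li
    by (simp add: config_def \<Lambda>_def power_mult_distrib)
  have i: "integrable (config ell N) (\<lambda>y. (cmod (cmps ell D B Q L N y))\<^sup>2)" for N
  proof (rule Bochner_Integration.integrable_bound[OF gi])
    show "(\<lambda>y. (cmod (cmps ell D B Q L N y))\<^sup>2) \<in> borel_measurable (config ell N)"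
      using cmps_measurable[OF assms] by simp
    show "AE y in config ell N. norm ((cmod (cmps ell D B Q L N y))\<^sup>2) \<le> norm (?g N y)"
      using sq unfolding real_norm_def abs_power2 power2_abs by (intro AE_I2 order_trans[OF _ abs_ge_self])
  qed
  have "summable (\<lambda>N. LINT y|config ell N. (cmod (cmps ell D B Q L N y))\<^sup>2)"
  proof (rule summable_comparison_test)
    show "summable (\<lambda>N. c\<^sup>2 * ((c\<^sup>2 * \<Lambda>) ^ N / fact N))"
      using summable_exp[of "c\<^sup>2 * \<Lambda>"] by (intro summable_mult) (simp add: field_simps)
    have "(LINT y|config ell N. (cmod (cmps ell D B Q L N y))\<^sup>2) \<le> c\<^sup>2 * ((c\<^sup>2 * \<Lambda>) ^ N / fact N)" for N
      unfolding g[symmetric] by (intro integral_mono i gi sq)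
    then show "\<exists>n0. \<forall>N\<ge>n0. norm (LINT y|config ell N. (cmod (cmps ell D B Q L N y))\<^sup>2) \<le> c\<^sup>2 * ((c\<^sup>2 * \<Lambda>) ^ N / fact N)"
      by (simp add: integral_nonneg_AE)
  qed
  with i cmps_measurable[OF assms] show ?thesis
    by (simp add: fock_def cmps_eq smeared_creation_perm)
qed

end

section \<open>Matrix elements of the Dyson expansion\<close>

text \<open>The square roots of successive particle numbers multiply to a quotient of factorials,
  and the position annihilated first becomes the first coordinate.\<close>

lemma fold_annih:
  "fold annih xs \<phi> N y = complex_of_real (sqrt (fact (N + length xs) / fact N)) *
     \<phi> (N + length xs) (\<lambda>i. if i < length xs then xs ! i else y (i - length xs))"
proof (induction xs arbitrary: \<phi>)
  case (Cons x xs)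
  let ?y = "\<lambda>i. if i < length xs then xs ! i else y (i - length xs)"
  have "(case_nat x ?y) = (\<lambda>i. if i < length (x # xs) then (x # xs) ! i else y (i - length (x # xs)))"
    by (auto split: nat.split simp: fun_eq_iff)
  then have "fold annih (x # xs) \<phi> N y = complex_of_real (sqrt (fact (N + length xs) / fact N) * sqrt (real (Suc (N + length xs)))) *
      \<phi> (N + length (x # xs)) (\<lambda>i. if i < length (x # xs) then (x # xs) ! i else y (i - length (x # xs)))"
    by (simp add: Cons annih_def)
  also have "sqrt (fact (N + length xs) / fact N) * sqrt (real (Suc (N + length xs))) = sqrt (fact (N + length (x # xs)) / fact N)"
    by (simp add: real_sqrt_mult[symmetric] mult.commute)
  finally show ?case .
qed simp

lemma fold_annih_vacuum:
  "fold annih xs \<phi> 0 (\<lambda>_. undefined) = complex_of_real (sqrt (fact (length xs))) * \<phi> (length xs) (\<lambda>i\<in>{..<length xs}. xs ! i)"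
  by (simp add: fold_annih restrict_def)

text \<open>An \<open>Adj\<close> leg acts on both sides, so its position belongs to
  \<open>kets\<close> and to \<open>bras\<close>.\<close>

definition kets :: "leg list \<Rightarrow> nat list" where
  "kets \<alpha> = filter (\<lambda>i. \<alpha> ! i \<noteq> Right) [0..<length \<alpha>]"

definition bras :: "leg list \<Rightarrow> nat list" where
  "bras \<alpha> = filter (\<lambda>i. \<alpha> ! i \<noteq> Left) [0..<length \<alpha>]"

definition supermap_form :: "leg list \<Rightarrow> (nat \<Rightarrow> real) \<Rightarrow> fockvec \<Rightarrow> fockvec \<Rightarrow> complex" where
  "supermap_form \<alpha> x = foldr (\<lambda>i. supermap (\<alpha> ! i) (x i)) [0..<length \<alpha>] vacuum_proj_form"

text \<open>On forms a supermap acts through the arguments: the outermost one reaches the vectors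
  first, so \<open>foldr\<close> over supermaps becomes \<open>fold\<close> over
  annihilators.\<close>

lemma foldr_supermap:
  "foldr (\<lambda>i. supermap (\<alpha> ! i) (x i)) ks X \<eta> \<phi>
    = X (fold annih (map x (filter (\<lambda>i. \<alpha> ! i \<noteq> Right) ks)) \<eta>) (fold annih (map x (filter (\<lambda>i. \<alpha> ! i \<noteq> Left) ks)) \<phi>)"
proof (induction ks arbitrary: \<eta> \<phi>)
  case (Cons i ks)
  then show ?case by (cases "\<alpha> ! i") auto
qed simp

lemma supermap_form_eq:
  defines "r \<equiv> \<lambda>ks x. \<lambda>i\<in>{..<length ks}. x (ks ! i :: nat) :: real"
  shows "supermap_form \<alpha> x \<eta> \<phi> = complex_of_real (sqrt (fact (length (kets \<alpha>))) * sqrt (fact (length (bras \<alpha>))))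
    * (cnj (\<eta> (length (kets \<alpha>)) (r (kets \<alpha>) x)) * \<phi> (length (bras \<alpha>)) (r (bras \<alpha>) x))"
proof -
  have r: "(\<lambda>i\<in>{..<length (map x ks)}. map x ks ! i) = r ks x" for ks
    by (auto simp: r_def)
  show ?thesis
    unfolding supermap_form_def foldr_supermap vacuum_proj_form_def fold_annih_vacuum
      kets_def[symmetric] bras_def[symmetric] r by simp
qed

text \<open>After all annihilations only the vacuum component counts, so each side must lose exactly
  its particles. Each leg removes at least one particle from some side, which bounds the length and
  makes the Dyson series finite.\<close>

lemma supermap_form_nonzero:
  assumes "\<eta> \<in> fock_sector ell N" "\<phi> \<in> fock_sector ell M" "supermap_form \<alpha> x \<eta> \<phi> \<noteq> 0"
  shows "length (kets \<alpha>) = N" "length (bras \<alpha>) = M" "length \<alpha> \<le> N + M"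
proof -
  show "length (kets \<alpha>) = N" "length (bras \<alpha>) = M"
    using assms by (auto simp: supermap_form_eq fock_sector_def)
  moreover have "length [0..<length \<alpha>] \<le> length (kets \<alpha>) + length (bras \<alpha>)"
  proof -
    have "length ks \<le> length (filter (\<lambda>i. \<alpha> ! i \<noteq> Right) ks) + length (filter (\<lambda>i. \<alpha> ! i \<noteq> Left) ks)" for ks
      by (induction ks) auto
    then show ?thesis by (simp only: kets_def bras_def)
  qed
  ultimately show "length \<alpha> \<le> N + M" by simp
qed

definition cmpo_integrand :: "real \<Rightarrow> nat \<Rightarrow> cmpo \<Rightarrow> fockvec \<Rightarrow> fockvec \<Rightarrow> leg list \<Rightarrow> (nat \<Rightarrow> real) \<Rightarrow> complex" where
  "cmpo_integrand ell D W \<eta> \<phi> \<alpha> x = cmpo_amplitude ell D W \<alpha> x * supermap_form \<alpha> x \<eta> \<phi>"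

definition cmpo_term :: "real \<Rightarrow> nat \<Rightarrow> cmpo \<Rightarrow> fockvec \<Rightarrow> fockvec \<Rightarrow> leg list \<Rightarrow> complex" where
  "cmpo_term ell D W \<eta> \<phi> \<alpha> = (LINT x:chamber (length \<alpha>)|config ell (length \<alpha>). cmpo_integrand ell D W \<eta> \<phi> \<alpha> x)"

text \<open>Needed to add Dyson terms of different tensors: the integral of a function that is not
  integrable is 0 by convention, so equality of forms alone would not give additivity.\<close>

definition cmpo_terms_integrable :: "real \<Rightarrow> nat \<Rightarrow> cmpo \<Rightarrow> fockvec \<Rightarrow> fockvec \<Rightarrow> bool" where
  "cmpo_terms_integrable ell D W \<eta> \<phi> \<longleftrightarrow>
     (\<forall>\<alpha>. simplex_integrable ell (length \<alpha>) (cmpo_integrand ell D W \<eta> \<phi> \<alpha>))"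

section \<open>The Dyson expansion as a finite sum over words\<close>

lemma finite_legs_of_length: "finite {\<alpha> :: leg list. length \<alpha> = n}"
proof -
  have "UNIV = {Left, Right, Adj}" using leg_exhaust by auto
  then have "finite (UNIV :: leg set)" by (metis finite.emptyI finite_insert)
  then show ?thesis using finite_lists_length_eq[of "UNIV :: leg set" n] by simp
qed

lemma cmpo_form_eq:
  assumes F: "finite F" and zero: "\<And>\<alpha>. \<alpha> \<notin> F \<Longrightarrow> cmpo_term ell D W \<eta> \<phi> \<alpha> = 0"
  shows "cmpo_form ell D W \<eta> \<phi> = (\<Sum>\<alpha>\<in>F. cmpo_term ell D W \<eta> \<phi> \<alpha>)"
proof -
  let ?t = "cmpo_term ell D W \<eta> \<phi>"
  have inner: "(\<Sum>\<alpha> | length \<alpha> = n. ?t \<alpha>) = (\<Sum>\<alpha> | \<alpha> \<in> F \<and> length \<alpha> = n. ?t \<alpha>)" for n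
    by (rule sum.mono_neutral_right) (use zero in \<open>auto simp: finite_legs_of_length\<close>)
  have "cmpo_form ell D W \<eta> \<phi> = (\<Sum>n. \<Sum>\<alpha> | length \<alpha> = n. ?t \<alpha>)"
    unfolding cmpo_form_def
    by (intro arg_cong[where f = suminf] ext sum.cong refl)
      (auto simp: cmpo_term_def cmpo_integrand_def cmpo_amplitude_def supermap_form_def)
  also have "\<dots> = (\<Sum>n\<in>length ` F. \<Sum>\<alpha> | length \<alpha> = n. ?t \<alpha>)"
    by (rule suminf_finite) (use F in \<open>auto simp: inner intro!: sum.neutral\<close>)
  also have "\<dots> = (\<Sum>\<alpha>\<in>F. ?t \<alpha>)"
    unfolding inner by (rule sum.image_gen[OF F, symmetric])
  finally show ?thesis .
qed

lemma cmpo_form_direct_sum: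
  assumes tens: "\<And>p. p \<in> set ps \<Longrightarrow> cmpo_tensors ell (fst p) (snd p)"
    and int: "\<And>p. p \<in> set ps \<Longrightarrow> cmpo_terms_integrable ell (fst p) (snd p) \<eta> \<phi>"
    and \<eta>: "\<eta> \<in> fock_sector ell N" and \<phi>: "\<phi> \<in> fock_sector ell M"
  shows "cmpo_form ell (sum_list (map fst ps)) (direct_sum_cmpo (map snd ps)) \<eta> \<phi>
    = (\<Sum>p\<leftarrow>ps. cmpo_form ell (fst p) (snd p) \<eta> \<phi>)"
proof -
  let ?D = "sum_list (map fst ps)" and ?W = "direct_sum_cmpo (map snd ps)"
  \<comment> \<open>This set depends on the two sectors only, so it serves the direct sum and all
    its summands at once.\<close>
  define F :: "leg list set" where "F = (\<Union>n\<in>{..N + M}. {\<alpha>. length \<alpha> = n})"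
  have F: "finite F" unfolding F_def by (auto simp: finite_legs_of_length)
  have zero: "cmpo_term ell D W \<eta> \<phi> \<alpha> = 0" if "\<alpha> \<notin> F" for D W \<alpha>
  proof -
    have "supermap_form \<alpha> x \<eta> \<phi> = 0" for x
      using supermap_form_nonzero(3)[OF \<eta> \<phi>, of \<alpha> x] that by (auto simp: F_def)
    then show ?thesis by (simp add: cmpo_term_def cmpo_integrand_def set_lebesgue_integral_def)
  qed
  have form: "cmpo_form ell D W \<eta> \<phi> = (\<Sum>\<alpha>\<in>F. cmpo_term ell D W \<eta> \<phi> \<alpha>)" for D W
    by (rule cmpo_form_eq[OF F]) (rule zero)
  have term_eq: "cmpo_term ell ?D ?W \<eta> \<phi> \<alpha>
      = (\<Sum>p\<leftarrow>ps. cmpo_term ell (fst p) (snd p) \<eta> \<phi> \<alpha>)" for \<alpha>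
  proof -
    have i: "cmpo_integrand ell ?D ?W \<eta> \<phi> \<alpha> x
        = (\<Sum>p\<leftarrow>ps. cmpo_integrand ell (fst p) (snd p) \<eta> \<phi> \<alpha> x)" for x
      using cmpo_tensors_direct_sum[OF tens, of ps \<alpha> x]
      by (simp add: cmpo_integrand_def sum_list_mult_const)
    show ?thesis
      unfolding cmpo_term_def i using int
    proof (induction ps)
      case Nil
      then show ?case by (simp add: set_lebesgue_integral_def)
    next
      case (Cons p ps)
      have "simplex_integrable ell (length \<alpha>) (\<lambda>x. \<Sum>p\<leftarrow>ps. cmpo_integrand ell (fst p) (snd p) \<eta> \<phi> \<alpha> x)"
        using Cons.prems
      proof (induction ps)
        case Nil
        then show ?case by (simp add: set_integrable_def)
      next
        case (Cons q qs)
        have "simplex_integrable ell (length \<alpha>) (cmpo_integrand ell (fst q) (snd q) \<eta> \<phi> \<alpha>)"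
          using Cons.prems[of q] by (simp add: cmpo_terms_integrable_def)
        moreover have "simplex_integrable ell (length \<alpha>) (\<lambda>x. \<Sum>p\<leftarrow>qs. cmpo_integrand ell (fst p) (snd p) \<eta> \<phi> \<alpha> x)"
          by (rule Cons.IH) (use Cons.prems in auto)
        ultimately show ?case by simp
      qed
      with Cons show ?case by (simp add: cmpo_terms_integrable_def)
    qed
  qed
  have "cmpo_form ell ?D ?W \<eta> \<phi>
      = (\<Sum>\<alpha>\<in>F. \<Sum>p\<leftarrow>ps. cmpo_term ell (fst p) (snd p) \<eta> \<phi> \<alpha>)"
    unfolding form term_eq by (rule refl)
  also have "\<dots> = (\<Sum>p\<leftarrow>ps. \<Sum>\<alpha>\<in>F. cmpo_term ell (fst p) (snd p) \<eta> \<phi> \<alpha>)"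
    by (induction ps) (simp_all add: sum.distrib)
  finally show ?thesis unfolding form .
qed

lemma fock_inner_sector:
  assumes "\<eta> \<in> fock_sector ell N \<or> \<phi> \<in> fock_sector ell N"
  shows "fock_inner ell \<eta> \<phi> = (LINT x|config ell N. cnj (\<eta> N x) * \<phi> N x)"
proof -
  have "fock_inner ell \<eta> \<phi> = (\<Sum>k\<in>{N}. LINT x|config ell k. cnj (\<eta> k x) * \<phi> k x)"
    unfolding fock_inner_def by (rule suminf_finite) (use assms in \<open>auto simp: fock_sector_def\<close>)
  then show ?thesis by simp
qed

lemma integral_inner_simplex:
  assumes "\<eta> \<in> fock ell" "\<phi> \<in> fock ell"
  shows "(LINT x|config ell n. cnj (\<eta> n x) * \<phi> n x) = fact n * (LINT x:chamber n|config ell n. cnj (\<eta> n x) * \<phi> n x)"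
proof (rule integral_config_symmetric[OF fock_integrable[OF assms(2,1)]])
  fix p assume p: "p permutes {..<n}"
  show "AE x in config ell n. cnj (\<eta> n (x \<circ> p)) * \<phi> n (x \<circ> p) = cnj (\<eta> n x) * \<phi> n x"
    using fockD(3)[OF assms(1) p] fockD(3)[OF assms(2) p] by eventually_elim simp
qed

section \<open>The identity\<close>

lemma path_word_zero:
  assumes "\<And>w. w \<in> set ws \<Longrightarrow> snd w \<in> carrier_mat D D" "\<exists>w\<in>set ws. snd w = 0\<^sub>m D D"
  shows "path_word D Q a b ws = 0\<^sub>m D D"
  using assms
proof (induction ws arbitrary: a)
  case (Cons w ws)
  obtain t K where w: "w = (t, K)" by (cases w)
  have K: "K \<in> carrier_mat D D" using Cons.prems(1)[of w] w by simp
  have W: "path_word D Q t b ws \<in> carrier_mat D D" using Cons.prems(1) by (intro path_word_carrier) auto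
  show ?case
  proof (cases "K = 0\<^sub>m D D")
    case True
    then show ?thesis using W by (simp add: w right_mult_zero_mat[OF path_exp_carrier])
  next
    case False
    then have "path_word D Q t b ws = 0\<^sub>m D D" using Cons w by (intro Cons.IH) auto
    then show ?thesis by (simp add: w right_mult_zero_mat[OF mult_carrier_mat[OF path_exp_carrier K]])
  qed
qed simp

lemma cmpo_amplitude_zero:
  assumes W: "cmpo_tensors ell D W" and "i < length \<alpha>" "\<And>t. leg_mat W (\<alpha> ! i) t = 0\<^sub>m D D"
  shows "cmpo_amplitude ell D W \<alpha> x = 0"
proof -
  have "path_word D (cmpo_Q W) (- ell / 2) (ell / 2) (map (\<lambda>i. (x i, leg_mat W (\<alpha> ! i) (x i))) [0..<length \<alpha>]) = 0\<^sub>m D D"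
  proof (rule path_word_zero)
    have "(x i, leg_mat W (\<alpha> ! i) (x i)) \<in> set (map (\<lambda>i. (x i, leg_mat W (\<alpha> ! i) (x i))) [0..<length \<alpha>])"
      using assms(2) by simp
    then show "\<exists>w\<in>set (map (\<lambda>i. (x i, leg_mat W (\<alpha> ! i) (x i))) [0..<length \<alpha>]). snd w = 0\<^sub>m D D"
      by (rule bexI[rotated]) (simp add: assms(3))
  qed (use cmpo_tensorsD(3)[OF W] in auto)
  then show ?thesis
    using right_mult_zero_mat[OF cmpo_tensorsD(1)[OF W]] by (simp add: cmpo_amplitude_def mat_trace_def)
qed

lemma cmpo_tensors_id: "cmpo_tensors ell 1 id_cmpo"
  by (auto simp: cmpo_tensors_def id_cmpo_def mat_integrable_def mat_sq_integrable_def mat_bounded_def)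

lemma path_exp_zero: "path_exp D (\<lambda>_. 0\<^sub>m D D) a b = 1\<^sub>m D"
proof (rule eq_matI)
  fix i j assume "i < dim_row (1\<^sub>m D :: complex mat)" "j < dim_col (1\<^sub>m D :: complex mat)"
  then have ij: "i < D" "j < D" by auto
  have d: "dyson_term D (\<lambda>_. 0\<^sub>m D D) n a b $$ (i, j) = 0" if "n \<noteq> 0" for n
  proof (cases n)
    case (Suc k)
    have "(dyson_term D (\<lambda>_. 0\<^sub>m D D) k a z * 0\<^sub>m D D) $$ (i, j) = 0" for z
      using ij by (simp add: right_mult_zero_mat[OF dyson_carrier] del: index_mult_mat)
    then show ?thesis using ij Suc by (simp del: index_mult_mat)
  qed (use that in simp)
  have "path_exp D (\<lambda>_. 0\<^sub>m D D) a b $$ (i, j) = (\<Sum>n\<in>{0}. dyson_term D (\<lambda>_. 0\<^sub>m D D) n a b $$ (i, j))"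
    using ij suminf_finite[of "{0}" "\<lambda>n. dyson_term D (\<lambda>_. 0\<^sub>m D D) n a b $$ (i, j)"] d by (simp add: path_exp_def)
  then show "path_exp D (\<lambda>_. 0\<^sub>m D D) a b $$ (i, j) = 1\<^sub>m D $$ (i, j)" by simp
qed (auto simp: path_exp_def)

lemma cmpo_amplitude_id: "cmpo_amplitude ell 1 id_cmpo (replicate n Adj) x = 1"
proof -
  have w: "path_word 1 (\<lambda>_. 0\<^sub>m 1 1) a b (map (\<lambda>i. (x i, 1\<^sub>m 1)) ks) = 1\<^sub>m 1" for a b ks
    by (induction ks arbitrary: a) (simp_all add: path_exp_zero)
  have m: "map (\<lambda>i. (x i, leg_mat id_cmpo (replicate n Adj ! i) (x i))) [0..<n] = map (\<lambda>i. (x i, 1\<^sub>m 1)) [0..<n]"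
    by (auto simp: id_cmpo_def)
  have QB: "cmpo_Q id_cmpo = (\<lambda>_. 0\<^sub>m 1 1)" "cmpo_B id_cmpo = 1\<^sub>m 1"
    by (simp_all add: id_cmpo_def)
  show ?thesis
    unfolding cmpo_amplitude_def length_replicate m QB w by (simp add: mat_trace_def)
qed

context
  fixes ell :: real and \<eta> \<phi> :: fockvec and N M :: nat
  assumes \<eta>: "\<eta> \<in> fock_sector ell N" and \<phi>: "\<phi> \<in> fock_sector ell M"
begin

lemma sector_fock: "\<eta> \<in> fock ell" "\<phi> \<in> fock ell"
  using \<eta> \<phi> by (auto simp: fock_sector_def)

text \<open>A leg other than \<open>Adj\<close> carries a zero tensor, and a word of
  \<open>Adj\<close> legs removes as many particles as it has letters.\<close>

lemma cmpo_integrand_id_zero: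
  assumes "\<alpha> \<noteq> replicate N Adj"
  shows "cmpo_integrand ell 1 id_cmpo \<eta> \<phi> \<alpha> x = 0"
proof (cases "\<exists>i<length \<alpha>. \<alpha> ! i \<noteq> Adj")
  case True
  then obtain i where i: "i < length \<alpha>" "\<alpha> ! i \<noteq> Adj" by blast
  then have "leg_mat id_cmpo (\<alpha> ! i) t = 0\<^sub>m 1 1" for t by (cases "\<alpha> ! i") (auto simp: id_cmpo_def)
  from cmpo_amplitude_zero[OF cmpo_tensors_id i(1) this] show ?thesis by (simp add: cmpo_integrand_def)
next
  case False
  then have "\<alpha> = replicate (length \<alpha>) Adj" by (intro nth_equalityI) auto
  then have "kets \<alpha> = [0..<length \<alpha>]" using False by (simp add: kets_def filter_id_conv)
  moreover have "length \<alpha> \<noteq> N" using assms \<open>\<alpha> = replicate (length \<alpha>) Adj\<close> by auto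
  ultimately show ?thesis
    using supermap_form_nonzero(1)[OF \<eta> \<phi>, of \<alpha> x] by (auto simp: cmpo_integrand_def)
qed

text \<open>No distinction between equal and different sectors is necessary: for different ones the
  component \<open>\<phi> N\<close> vanishes on both sides.\<close>

lemma cmpo_integrand_id:
  assumes "x \<in> space (config ell N)"
  shows "cmpo_integrand ell 1 id_cmpo \<eta> \<phi> (replicate N Adj) x = fact N * (cnj (\<eta> N x) * \<phi> N x)"
proof -
  have p: "kets (replicate N Adj) = [0..<N]" "bras (replicate N Adj) = [0..<N]"
    by (auto simp: kets_def bras_def filter_id_conv)
  have x: "(\<lambda>i\<in>{..<N}. x ([0..<N] ! i)) = x"
    using assms by (auto simp: space_config PiE_def extensional_def restrict_def fun_eq_iff)
  show ?thesis
    by (simp add: cmpo_integrand_def cmpo_amplitude_id supermap_form_eq p x del: One_nat_def flip: of_real_mult)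
qed

lemma cmpo_terms_integrable_id: "cmpo_terms_integrable ell 1 id_cmpo \<eta> \<phi>"
  unfolding cmpo_terms_integrable_def
proof
  fix \<alpha>
  show "simplex_integrable ell (length \<alpha>) (cmpo_integrand ell 1 id_cmpo \<eta> \<phi> \<alpha>)"
  proof (cases "\<alpha> = replicate N Adj")
    case True
    have "integrable (config ell N) (cmpo_integrand ell 1 id_cmpo \<eta> \<phi> \<alpha>)"
      unfolding True using fock_integrable[OF sector_fock(2,1), of N]
      by (subst Bochner_Integration.integrable_cong[OF refl cmpo_integrand_id]) auto
    then show ?thesis using True by (intro set_integrable_simplex) simp
  next
    case False
    then show ?thesis by (simp add: set_integrable_def cmpo_integrand_id_zero del: One_nat_def)
  qed
qed

lemma cmpo_form_id: "cmpo_form ell 1 id_cmpo \<eta> \<phi> = fock_inner ell \<eta> \<phi>"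
proof -
  have "cmpo_form ell 1 id_cmpo \<eta> \<phi> = (\<Sum>\<alpha>\<in>{replicate N Adj}. cmpo_term ell 1 id_cmpo \<eta> \<phi> \<alpha>)"
    by (rule cmpo_form_eq) (simp_all add: cmpo_term_def cmpo_integrand_id_zero set_lebesgue_integral_def del: One_nat_def)
  also have "\<dots> = (LINT x:chamber N|config ell N. fact N * (cnj (\<eta> N x) * \<phi> N x))"
    unfolding set_lebesgue_integral_def cmpo_term_def
    by (simp del: One_nat_def, rule Bochner_Integration.integral_cong[OF refl]) (simp add: cmpo_integrand_id del: One_nat_def)
  also have "\<dots> = (LINT x|config ell N. cnj (\<eta> N x) * \<phi> N x)"
    by (simp only: set_integral_mult_right integral_inner_simplex[OF sector_fock])
  finally show ?thesis by (simp add: fock_inner_sector[OF disjI1[OF \<eta>]])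
qed

end

section \<open>The projector onto a continuous matrix product state\<close>

lemma positions_sort:
  assumes "Adj \<notin> set \<alpha>"
  shows "positions Left \<alpha> = kets \<alpha>" "positions Right \<alpha> = bras \<alpha>"
proof -
  have "\<alpha> ! i \<noteq> Adj" if "i < length \<alpha>" for i using assms nth_mem[OF that] by auto
  then have "\<alpha> ! i = Left \<longleftrightarrow> \<alpha> ! i \<noteq> Right" "\<alpha> ! i = Right \<longleftrightarrow> \<alpha> ! i \<noteq> Left" if "i < length \<alpha>" for i
    using leg_exhaust[of "\<alpha> ! i"] that by auto
  then show "positions Left \<alpha> = kets \<alpha>" "positions Right \<alpha> = bras \<alpha>"
    by (auto simp: positions_def kets_def bras_def intro!: filter_cong)
qed

lemma mat_sq_integrable_kron:
  assumes L: "mat_sq_integrable ell D L"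
  shows "mat_sq_integrable ell (D * E) (\<lambda>x. kron (L x) (1\<^sub>m E))"
    and "mat_sq_integrable ell (E * D) (\<lambda>x. kron (1\<^sub>m E) (mat_cnj (L x)))"
proof -
  have c: "L x \<in> carrier_mat D D" for x using L by (simp add: mat_sq_integrable_def)
  then have c': "mat_cnj (L x) \<in> carrier_mat D D" for x by simp
  have m: "(\<lambda>x. L x $$ (i, j)) \<in> borel_measurable (interval_measure ell)"
    "integrable (interval_measure ell) (\<lambda>x. (cmod (L x $$ (i, j)))\<^sup>2)" if "i < D" "j < D" for i j
    using L that by (auto simp: mat_sq_integrable_def)
  have m': "(\<lambda>x. cnj (L x $$ (i, j))) \<in> borel_measurable (interval_measure ell)" if "i < D" "j < D" for i j
    using m(1)[OF that] by (rule borel_measurable_continuous_on[OF continuous_on_cnj[OF continuous_on_id], simplified])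
  show "mat_sq_integrable ell (D * E) (\<lambda>x. kron (L x) (1\<^sub>m E))"
    unfolding mat_sq_integrable_def
  proof (intro conjI allI impI)
    fix i j assume ij: "i < D * E" "j < D * E"
    note dm = div_mod_less[OF ij(1)] div_mod_less[OF ij(2)]
    show "(\<lambda>x. kron (L x) (1\<^sub>m E) $$ (i, j)) \<in> borel_measurable (interval_measure ell)"
      "integrable (interval_measure ell) (\<lambda>x. (cmod (kron (L x) (1\<^sub>m E) $$ (i, j)))\<^sup>2)"
      using m[OF dm(1,3)] by (simp_all add: kron_entry[OF c one_carrier_mat ij] norm_mult power_mult_distrib)
  qed (use c in simp)
  show "mat_sq_integrable ell (E * D) (\<lambda>x. kron (1\<^sub>m E) (mat_cnj (L x)))"
    unfolding mat_sq_integrable_def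
  proof (intro conjI allI impI)
    fix i j assume ij: "i < E * D" "j < E * D"
    note dm = div_mod_less[OF ij(1)] div_mod_less[OF ij(2)]
    have e: "mat_cnj (L x) $$ (i mod D, j mod D) = cnj (L x $$ (i mod D, j mod D))" for x
      using carrier_matD[OF c[of x]] dm by simp
    show "(\<lambda>x. kron (1\<^sub>m E) (mat_cnj (L x)) $$ (i, j)) \<in> borel_measurable (interval_measure ell)"
      "integrable (interval_measure ell) (\<lambda>x. (cmod (kron (1\<^sub>m E) (mat_cnj (L x)) $$ (i, j)))\<^sup>2)"
      using m[OF dm(2,4)] m'[OF dm(2,4)] by (simp_all add: kron_entry[OF one_carrier_mat c' ij] e norm_mult power_mult_distrib)
  qed (use c in simp)
qed

context
  fixes ell :: real and D :: nat and B :: "complex mat" and Q L :: "real \<Rightarrow> complex mat" and c :: complex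
  assumes tensors: "cmps_tensors ell D B Q L" and ell: "0 < ell"
begin

abbreviation proj_W :: cmpo where
  "proj_W \<equiv> scale_cmpo c (proj_cmpo D B Q L)"

lemma cmpo_tensors_proj: "cmpo_tensors ell (D\<^sup>2) proj_W"
proof -
  note cc = cmps_tensors_carrier[OF tensors]
  have L: "mat_sq_integrable ell D L" and Q: "mat_integrable ell D Q"
    using tensors by (auto simp: cmps_tensors_def)
  have "mat_integrable ell (D * D) (\<lambda>x. kron (Q x) (1\<^sub>m D) + kron (1\<^sub>m D) (mat_cnj (Q x)))"
    unfolding mat_integrable_def
  proof (intro conjI allI impI)
    have Qc: "mat_cnj (Q x) \<in> carrier_mat D D" for x using cc by simp
    show "kron (Q x) (1\<^sub>m D) + kron (1\<^sub>m D) (mat_cnj (Q x)) \<in> carrier_mat (D * D) (D * D)" for x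
      by (intro add_carrier_mat kron_carrier[OF one_carrier_mat Qc])
    fix i j assume ij: "i < D * D" "j < D * D"
    note dm = div_mod_less[OF ij(1)] div_mod_less[OF ij(2)]
    have "(kron (Q x) (1\<^sub>m D) + kron (1\<^sub>m D) (mat_cnj (Q x))) $$ (i, j)
        = Q x $$ (i div D, j div D) * 1\<^sub>m D $$ (i mod D, j mod D) + 1\<^sub>m D $$ (i div D, j div D) * cnj (Q x $$ (i mod D, j mod D))" for x
      using ij dm carrier_matD[OF kron_carrier[OF one_carrier_mat Qc[of x]], of D] carrier_matD[OF cc(2)[of x]]
      by (simp add: kron_entry[OF cc(2) one_carrier_mat ij] kron_entry[OF one_carrier_mat Qc ij] del: index_one_mat)
    then show "integrable (interval_measure ell) (\<lambda>x. (kron (Q x) (1\<^sub>m D) + kron (1\<^sub>m D) (mat_cnj (Q x))) $$ (i, j))"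
      using Q dm by (simp add: mat_integrable_def integrable_cnj)
  qed
  moreover have "kron B (mat_cnj B) \<in> carrier_mat (D * D) (D * D)"
    using cc(1) by (intro kron_carrier) auto
  ultimately show ?thesis
    using mat_sq_integrable_kron[OF L, of D]
    by (auto simp: cmpo_tensors_def scale_cmpo_def proj_cmpo_def power2_eq_square mat_bounded_def)
qed

text \<open>With the boundary matrix included, the word is \<open>c\<close> times the Kronecker
  product of a ket matrix and a conjugated bra matrix, and the trace of a Kronecker product is the
  product of the traces. The positions have to be increasing for
  \<open>path_word_kron\<close>.\<close>

lemma cmpo_amplitude_proj:
  assumes x: "x \<in> space (config ell (length \<alpha>))" "strict_mono_on {..<length \<alpha>} x" and adj: "Adj \<notin> set \<alpha>"
  defines "r \<equiv> \<lambda>ks. \<lambda>i\<in>{..<length ks}. x (ks ! i)"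
  shows "cmpo_amplitude ell (D\<^sup>2) proj_W \<alpha> x
    = c * (cmps_amplitude ell D B Q L (length (kets \<alpha>)) (r (kets \<alpha>))
         * cnj (cmps_amplitude ell D B Q L (length (bras \<alpha>)) (r (bras \<alpha>))))"
proof -
  note cc = cmps_tensors_carrier[OF tensors]
  let ?n = "length \<alpha>" and ?Q = "cut_off ell D Q"
  let ?a = "- ell / 2" and ?b = "ell / 2"
  interpret Q: path_ordered D ?Q by (rule path_ordered_cmps[OF tensors])
  have R: "path_ordered D (\<lambda>x. mat_cnj (?Q x))" by (rule Q.path_ordered_cnj)
  have xI: "x i \<in> {?a..?b}" if "i < ?n" for i by (rule space_configD[OF x(1) that])
  have Lc: "mat_cnj (L t) \<in> carrier_mat D D" for t using cc by simp
  let ?ws = "\<lambda>ks. map (\<lambda>i. (x i, L (x i))) ks"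
  let ?wsc = "\<lambda>ks. map (\<lambda>i. (x i, mat_cnj (L (x i)))) ks"
  have leg: "leg_mat proj_W (\<alpha> ! i) t = (if \<alpha> ! i = Left then kron (L t) (1\<^sub>m D) else kron (1\<^sub>m D) (mat_cnj (L t)))"
    if "i < ?n" for i t
  proof -
    have "\<alpha> ! i \<noteq> Adj" using adj nth_mem[OF that] by auto
    then show ?thesis by (cases "\<alpha> ! i") (auto simp: scale_cmpo_def proj_cmpo_def)
  qed
  have sorted: "sorted (?a # map x [0..<?n] @ [?b])"
  proof -
    have "sorted (map x [0..<?n])"
      using x(2) by (auto simp: sorted_iff_nth_mono strict_mono_on_def le_less)
    then show ?thesis using xI ell by (auto simp: sorted_append)
  qed
  \<comment> \<open>All positions lie in the interval, so the tensors may be cut off outside, which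
    gives the integrability on the line that the factorization requires.\<close>
  have "path_word (D\<^sup>2) (cmpo_Q proj_W) ?a ?b (map (\<lambda>i. (x i, leg_mat proj_W (\<alpha> ! i) (x i))) [0..<?n])
      = path_word (D * D) (\<lambda>x. kron (?Q x) (1\<^sub>m D) + kron (1\<^sub>m D) (mat_cnj (?Q x))) ?a ?b
        (map (\<lambda>i. (x i, if \<alpha> ! i = Left then kron (L (x i)) (1\<^sub>m D) else kron (1\<^sub>m D) (mat_cnj (L (x i))))) [0..<?n])"
  proof -
    have ws: "map (\<lambda>i. (x i, leg_mat proj_W (\<alpha> ! i) (x i))) [0..<?n]
        = map (\<lambda>i. (x i, if \<alpha> ! i = Left then kron (L (x i)) (1\<^sub>m D) else kron (1\<^sub>m D) (mat_cnj (L (x i))))) [0..<?n]"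
      using leg by simp
    show ?thesis
      unfolding ws power2_eq_square
      by (rule path_word_cong[of ?a ?b]) (use xI in \<open>auto simp: cut_off_def scale_cmpo_def proj_cmpo_def\<close>)
  qed
  also have "\<dots> = kron (path_word D ?Q ?a ?b (?ws (kets \<alpha>)))
      (path_word D (\<lambda>x. mat_cnj (?Q x)) ?a ?b (?wsc (bras \<alpha>)))"
    using path_word_kron[OF Q.path_ordered_axioms R cc(3) Lc sorted, of "\<lambda>i. \<alpha> ! i = Left"]
    by (simp add: positions_sort[OF adj, symmetric] positions_def bras_def[symmetric])
  also have "path_word D (\<lambda>x. mat_cnj (?Q x)) ?a ?b (?wsc (bras \<alpha>)) = mat_cnj (path_word D ?Q ?a ?b (?ws (bras \<alpha>)))"
  proof -
    have "snd w \<in> carrier_mat D D" if "w \<in> set (?ws (bras \<alpha>))" for w using that cc(3) by auto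
    from Q.path_word_cnj[where ws = "?ws (bras \<alpha>)" and x = ?a and y = ?b, OF this] show ?thesis by (simp add: o_def)
  qed
  finally have word: "path_word (D\<^sup>2) (cmpo_Q proj_W) ?a ?b (map (\<lambda>i. (x i, leg_mat proj_W (\<alpha> ! i) (x i))) [0..<?n])
     = kron (path_word D ?Q ?a ?b (?ws (kets \<alpha>))) (mat_cnj (path_word D ?Q ?a ?b (?ws (bras \<alpha>))))" .
  have amp: "cmps_amplitude ell D B Q L (length ks) (r ks) = mat_trace (B * path_word D ?Q ?a ?b (?ws ks))"
    if ks: "set ks \<subseteq> {..<?n}" for ks
  proof -
    have "map (\<lambda>i. (r ks i, L (r ks i))) [0..<length ks] = ?ws ks"
      by (rule nth_equalityI) (auto simp: r_def)
    moreover have "path_word D Q ?a ?b (?ws ks) = path_word D ?Q ?a ?b (?ws ks)"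
      using ks xI ell by (intro path_word_cut) auto
    ultimately show ?thesis by (simp add: cmps_amplitude_def)
  qed
  have W: "path_word D ?Q ?a ?b (?ws ks) \<in> carrier_mat D D" for ks
    by (auto intro!: path_word_carrier cc)
  have Bc: "mat_cnj B \<in> carrier_mat D D" and Wc: "mat_cnj (path_word D ?Q ?a ?b (?ws ks)) \<in> carrier_mat D D" for ks
    using cc(1) W[of ks] by simp_all
  have BW: "B * path_word D ?Q ?a ?b (?ws ks) \<in> carrier_mat D D" for ks
    by (rule mult_carrier_mat[OF cc(1) W])
  have tr: "mat_trace (c \<cdot>\<^sub>m A) = c * mat_trace A" if "A \<in> carrier_mat n n" for A n
    using that by (auto simp: mat_trace_def sum_distrib_left)
  let ?wk = "path_word D ?Q ?a ?b (?ws (kets \<alpha>))" and ?wb = "path_word D ?Q ?a ?b (?ws (bras \<alpha>))"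
  have "cmpo_amplitude ell (D\<^sup>2) proj_W \<alpha> x = mat_trace ((c \<cdot>\<^sub>m kron B (mat_cnj B)) * kron ?wk (mat_cnj ?wb))"
    unfolding cmpo_amplitude_def word by (simp add: scale_cmpo_def proj_cmpo_def)
  also have "\<dots> = mat_trace (c \<cdot>\<^sub>m kron (B * ?wk) (mat_cnj (B * ?wb)))"
    by (simp only: mult_smult_assoc_mat[OF kron_carrier[OF cc(1) Bc] kron_carrier[OF W Wc]]
        kron_mult[OF cc(1) W Bc Wc] mat_cnj_mult[OF cc(1) W])
  also have "\<dots> = c * (mat_trace (B * ?wk) * cnj (mat_trace (B * ?wb)))"
  proof -
    have BWc: "mat_cnj (B * ?wb) \<in> carrier_mat D D" using BW by simp
    show ?thesis
      by (simp only: tr[OF kron_carrier[OF BW BWc]] mat_trace_kron[OF BW BWc] mat_trace_cnj[OF BW])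
  qed
  finally show ?thesis
    by (subst (1 2) amp) (auto simp: kets_def bras_def)
qed

context
  fixes \<eta> \<phi> :: fockvec and N M :: nat
  assumes \<eta>: "\<eta> \<in> fock_sector ell N" and \<phi>: "\<phi> \<in> fock_sector ell M"
begin

abbreviation (input) "ket_density \<equiv> \<lambda>x. cnj (\<eta> N x) * cmps ell D B Q L N x"
abbreviation (input) "bra_density \<equiv> \<lambda>x. cnj (cmps ell D B Q L M x) * \<phi> M x"

abbreviation (input) "pair_density \<equiv> \<lambda>\<alpha> x.
  ket_density (\<lambda>i\<in>{..<N}. x (positions Left \<alpha> ! i)) * bra_density (\<lambda>i\<in>{..<M}. x (positions Right \<alpha> ! i))"

text \<open>\<open>Adj\<close> legs carry a zero tensor; without them the two particle numbers fix
  how many legs of each kind occur.\<close>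

lemma cmpo_integrand_proj_zero:
  assumes "\<alpha> \<notin> shuffles_of N M"
  shows "cmpo_integrand ell (D\<^sup>2) proj_W \<eta> \<phi> \<alpha> x = 0"
proof (cases "Adj \<in> set \<alpha>")
  case True
  then obtain i where i: "i < length \<alpha>" "\<alpha> ! i = Adj" by (auto simp: in_set_conv_nth)
  then have "leg_mat proj_W (\<alpha> ! i) t = 0\<^sub>m (D\<^sup>2) (D\<^sup>2)" for t by (simp add: scale_cmpo_def proj_cmpo_def)
  from cmpo_amplitude_zero[OF cmpo_tensors_proj i(1) this] show ?thesis by (simp add: cmpo_integrand_def)
next
  case False
  have "supermap_form \<alpha> x \<eta> \<phi> = 0"
  proof (rule ccontr)
    assume nz: "supermap_form \<alpha> x \<eta> \<phi> \<noteq> 0"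
    note p = supermap_form_nonzero(1,2)[OF \<eta> \<phi> nz, folded positions_sort[OF False]]
    then have "\<alpha> \<in> shuffles_of N M" using positions_append(3)[OF False] False by (simp add: shuffles_of_def)
    with assms show False by blast
  qed
  then show ?thesis by (simp add: cmpo_integrand_def)
qed

text \<open>The factor \<open>sqrt (fact N) * sqrt (fact M)\<close> occurs twice: from the
  annihilators acting on the test vectors, and from expressing the amplitudes by the normalized wave
  functions of the cMPS.\<close>

lemma cmpo_integrand_proj:
  assumes \<alpha>: "\<alpha> \<in> shuffles_of N M" and x: "x \<in> space (config ell (N + M))" "strict_mono_on {..<N + M} x"
  shows "cmpo_integrand ell (D\<^sup>2) proj_W \<eta> \<phi> \<alpha> x = c * fact N * fact M *
    pair_density \<alpha> x"
proof -
  let ?r = "complex_of_real (sqrt (fact N) * sqrt (fact M))"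
  have len: "length \<alpha> = N + M" and adj: "Adj \<notin> set \<alpha>" and LN: "length (positions Left \<alpha>) = N"
    using \<alpha> by (auto simp: shuffles_of_def)
  have RM: "length (positions Right \<alpha>) = M" by (rule shuffles_of_right[OF \<alpha>])
  define xl where "xl = (\<lambda>i\<in>{..<N}. x (positions Left \<alpha> ! i))"
  define xr where "xr = (\<lambda>i\<in>{..<M}. x (positions Right \<alpha> ! i))"
  \<comment> \<open>The ket positions and the bra positions are increasing subfamilies of an
    increasing family, so \<open>smeared_creation_simplex\<close> applies to each group.\<close>
  have mono: "strict_mono_on {..<length (positions s \<alpha>)} (\<lambda>i\<in>{..<length (positions s \<alpha>)}. x (positions s \<alpha> ! i))" for s
  proof -
    have "x (positions s \<alpha> ! i) < x (positions s \<alpha> ! j)" if "i < j" "j < length (positions s \<alpha>)" for i j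
    proof -
      have "positions s \<alpha> ! i < positions s \<alpha> ! j" using sorted_wrt_nth_less[OF sorted_positions that] .
      moreover have "positions s \<alpha> ! j < N + M"
        using nth_mem[OF that(2)] by (simp add: set_positions len)
      ultimately show ?thesis using x(2) by (auto simp: strict_mono_on_def)
    qed
    then show ?thesis by (auto simp: strict_mono_on_def)
  qed
  have sl: "strict_mono_on {..<N} xl" and sr: "strict_mono_on {..<M} xr"
    using mono[of Left] mono[of Right] by (simp_all add: LN RM xl_def xr_def)
  have amp: "cmps_amplitude ell D B Q L n y = complex_of_real (sqrt (fact n)) * cmps ell D B Q L n y"
    if "strict_mono_on {..<n} y" for n y
    using smeared_creation_simplex[OF that, of "cmps_amplitude ell D B Q L n"] by (simp add: cmps_eq)
  have "cmpo_amplitude ell (D\<^sup>2) proj_W \<alpha> x = c * (cmps_amplitude ell D B Q L N xl * cnj (cmps_amplitude ell D B Q L M xr))"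
    using cmpo_amplitude_proj[of x \<alpha>] x adj
    by (simp add: len positions_sort[OF adj, symmetric] LN RM xl_def xr_def)
  also have "\<dots> = c * ?r * (cmps ell D B Q L N xl * cnj (cmps ell D B Q L M xr))"
    by (simp add: amp[OF sl] amp[OF sr])
  finally have A: "cmpo_amplitude ell (D\<^sup>2) proj_W \<alpha> x
      = c * ?r * (cmps ell D B Q L N xl * cnj (cmps ell D B Q L M xr))" .
  have S: "supermap_form \<alpha> x \<eta> \<phi> = ?r * (cnj (\<eta> N xl) * \<phi> M xr)"
    by (simp add: supermap_form_eq positions_sort[OF adj, symmetric] LN RM xl_def xr_def)
  have sq: "?r * ?r = fact N * fact M"
  proof -
    have "sqrt (fact N) * sqrt (fact M) * (sqrt (fact N) * sqrt (fact M)) = fact N * fact M"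
      by (simp add: mult.assoc mult.left_commute)
    then show ?thesis by (simp only: of_real_mult[symmetric]) simp
  qed
  have "cmpo_integrand ell (D\<^sup>2) proj_W \<eta> \<phi> \<alpha> x
      = c * (?r * ?r)
        * (ket_density xl * bra_density xr)"
    unfolding cmpo_integrand_def A S by (simp only: mult_ac)
  then show ?thesis unfolding sq xl_def xr_def by (simp only: mult.assoc)
qed

lemma density_integrable: "integrable (config ell N) ket_density" "integrable (config ell M) bra_density"
  using \<eta> \<phi> cmps_in_fock[OF tensors ell] by (auto simp: fock_sector_def intro!: fock_integrable)

lemma set_integrand_proj:
  assumes "\<alpha> \<in> shuffles_of N M" "x \<in> space (config ell (N + M))"
  shows "indicat_real (chamber (N + M)) x *\<^sub>R cmpo_integrand ell (D\<^sup>2) proj_W \<eta> \<phi> \<alpha> x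
    = indicat_real (chamber (N + M)) x *\<^sub>R (c * fact N * fact M *
      pair_density \<alpha> x)"
  using cmpo_integrand_proj[OF assms] by (cases "x \<in> chamber (N + M)") simp_all

lemma cmpo_terms_integrable_proj: "cmpo_terms_integrable ell (D\<^sup>2) proj_W \<eta> \<phi>"
  unfolding cmpo_terms_integrable_def
proof
  fix \<alpha>
  show "simplex_integrable ell (length \<alpha>) (cmpo_integrand ell (D\<^sup>2) proj_W \<eta> \<phi> \<alpha>)"
  proof (cases "\<alpha> \<in> shuffles_of N M")
    case True
    then have len: "length \<alpha> = N + M" by (simp add: shuffles_of_def)
    have "simplex_integrable ell (N + M) (\<lambda>x. c * fact N * fact M *
      pair_density \<alpha> x)"
      using integral_shuffles(1)[OF density_integrable True] by (intro set_integrable_mult_right)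
    then show ?thesis
      unfolding len set_integrable_def
      by (subst Bochner_Integration.integrable_cong[OF refl set_integrand_proj[OF True]])
  next
    case False
    then show ?thesis by (simp add: set_integrable_def cmpo_integrand_proj_zero)
  qed
qed

text \<open>The sum over shuffles is a product of two simplex integrals, and \<open>fact N\<close>
  and \<open>fact M\<close> are what extends these to the full cubes by bosonic symmetry.\<close>

lemma cmpo_form_proj:
  "cmpo_form ell (D\<^sup>2) proj_W \<eta> \<phi>
    = c * (fock_inner ell (cmps ell D B Q L) \<phi> * fock_inner ell \<eta> (cmps ell D B Q L))"
proof -
  let ?\<psi> = "cmps ell D B Q L"
  have psi: "?\<psi> \<in> fock ell" by (rule cmps_in_fock[OF tensors ell])
  let ?g = "pair_density"
  have fin: "finite (shuffles_of N M)"
    by (rule finite_subset[OF _ finite_legs_of_length[of "N + M"]]) (auto simp: shuffles_of_def)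
  have "cmpo_form ell (D\<^sup>2) proj_W \<eta> \<phi> = (\<Sum>\<alpha>\<in>shuffles_of N M. cmpo_term ell (D\<^sup>2) proj_W \<eta> \<phi> \<alpha>)"
    by (rule cmpo_form_eq[OF fin]) (simp add: cmpo_term_def cmpo_integrand_proj_zero set_lebesgue_integral_def)
  also have "\<dots> = (\<Sum>\<alpha>\<in>shuffles_of N M. c * fact N * fact M * (LINT x:chamber (N + M)|config ell (N + M). ?g \<alpha> x))"
  proof (rule sum.cong[OF refl])
    fix \<alpha> assume \<alpha>: "\<alpha> \<in> shuffles_of N M"
    then have len: "length \<alpha> = N + M" by (simp add: shuffles_of_def)
    have "cmpo_term ell (D\<^sup>2) proj_W \<eta> \<phi> \<alpha> = (LINT x:chamber (N + M)|config ell (N + M). c * fact N * fact M * ?g \<alpha> x)"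
      unfolding cmpo_term_def len set_lebesgue_integral_def
      by (rule Bochner_Integration.integral_cong[OF refl set_integrand_proj[OF \<alpha>]])
    then show "cmpo_term ell (D\<^sup>2) proj_W \<eta> \<phi> \<alpha> = c * fact N * fact M * (LINT x:chamber (N + M)|config ell (N + M). ?g \<alpha> x)"
      by (simp only: set_integral_mult_right)
  qed
  also have "\<dots> = c * fact N * fact M * ((LINT x:chamber N|config ell N. ket_density x) * (LINT x:chamber M|config ell M. bra_density x))"
    unfolding sum_distrib_left[symmetric] integral_shuffles(2)[OF density_integrable] by (rule refl)
  also have "\<dots> = c * ((fact M * (LINT x:chamber M|config ell M. bra_density x)) * (fact N * (LINT x:chamber N|config ell N. ket_density x)))"
    by (simp only: mult_ac)
  also have "fact M * (LINT x:chamber M|config ell M. bra_density x) = fock_inner ell ?\<psi> \<phi>"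
    using \<phi> psi integral_inner_simplex[of ?\<psi> ell \<phi> M] fock_inner_sector[OF disjI2[OF \<phi>]] by (simp add: fock_sector_def)
  also have "fact N * (LINT x:chamber N|config ell N. ket_density x) = fock_inner ell \<eta> ?\<psi>"
    using \<eta> psi integral_inner_simplex[of \<eta> ell ?\<psi> N] fock_inner_sector[OF disjI1[OF \<eta>]] by (simp add: fock_sector_def)
  finally show ?thesis .
qed

end

end

section \<open>Unitaries from orthonormal continuous matrix product states\<close>

lemma cmpo_represents_id: "cmpo_represents ell 1 id_cmpo (\<lambda>\<phi>. \<phi>)"
  unfolding cmpo_represents_def
  by (intro conjI allI ballI cmpo_tensors_id fock_operator_id) (simp only: cmpo_form_id)

lemma cmpo_represents_proj:
  assumes "0 < ell" "cmps_tensors ell D B Q L"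
  shows "cmpo_represents ell (D\<^sup>2) (scale_cmpo c (proj_cmpo D B Q L)) (fock_scale c (rank_one_proj ell (cmps ell D B Q L)))"
  unfolding cmpo_represents_def
proof (intro conjI allI ballI)
  let ?\<psi> = "cmps ell D B Q L"
  have psi: "?\<psi> \<in> fock ell" by (rule cmps_in_fock[OF assms(2,1)])
  show "cmpo_tensors ell (D\<^sup>2) (scale_cmpo c (proj_cmpo D B Q L))" by (rule cmpo_tensors_proj[OF assms(2,1)])
  show "fock_operator ell (fock_scale c (rank_one_proj ell ?\<psi>))" by (rule fock_operator_rank_one[OF psi])
  fix N M \<eta> \<phi> assume s: "\<eta> \<in> fock_sector ell N" "\<phi> \<in> fock_sector ell M"
  have "fock_scale c (rank_one_proj ell ?\<psi>) \<phi> = (\<lambda>N x. (c * fock_inner ell ?\<psi> \<phi>) * ?\<psi> N x)"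
    by (simp add: fock_scale_def rank_one_proj_def mult.assoc)
  then have "fock_inner ell \<eta> (fock_scale c (rank_one_proj ell ?\<psi>) \<phi>) = c * (fock_inner ell ?\<psi> \<phi> * fock_inner ell \<eta> ?\<psi>)"
    using fock_inner_scaled_right[OF psi, of \<eta> "c * fock_inner ell ?\<psi> \<phi>"] s by (simp add: fock_sector_def mult.assoc)
  then show "fock_inner ell \<eta> (fock_scale c (rank_one_proj ell ?\<psi>) \<phi>) = cmpo_form ell (D\<^sup>2) (scale_cmpo c (proj_cmpo D B Q L)) \<eta> \<phi>"
    using cmpo_form_proj[OF assms(2,1) s] by simp
qed

lemma cmpo_represents_phase:
  fixes ell :: real and m :: nat and D :: "nat \<Rightarrow> nat"
    and B :: "nat \<Rightarrow> complex mat" and Q L :: "nat \<Rightarrow> real \<Rightarrow> complex mat"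
    and a :: "nat \<Rightarrow> real"
  defines "\<psi> \<equiv> \<lambda>j. cmps ell (D j) (B j) (Q j) (L j)" and "c \<equiv> \<lambda>j. exp (\<i> * complex_of_real (a j)) - 1"
  assumes ell: "0 < ell" and tensors: "\<And>j. j < m \<Longrightarrow> cmps_tensors ell (D j) (B j) (Q j) (L j)"
  shows "cmpo_represents ell (1 + (\<Sum>j<m. (D j)\<^sup>2))
        (direct_sum_cmpo (id_cmpo # map (\<lambda>j. scale_cmpo (c j) (proj_cmpo (D j) (B j) (Q j) (L j))) [0..<m]))
        (phase_operator ell m a \<psi>)"
proof -
  define W where "W j = scale_cmpo (c j) (proj_cmpo (D j) (B j) (Q j) (L j))" for j
  \<comment> \<open>Each tensor is paired with its bond dimension, so that the dimensions add up
    along with the direct sum.\<close>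
  define ps where "ps = (1, id_cmpo) # map (\<lambda>j. ((D j)\<^sup>2, W j)) [0..<m]"
  have psi: "\<psi> j \<in> fock ell" if "j < m" for j unfolding \<psi>_def by (rule cmps_in_fock[OF tensors[OF that] ell])
  have dims: "sum_list (map fst ps) = 1 + (\<Sum>j<m. (D j)\<^sup>2)"
    by (simp add: ps_def o_def sum_list_distinct_conv_sum_set atLeast0LessThan)
  have snds: "map snd ps = id_cmpo # map W [0..<m]" by (simp add: ps_def o_def)
  have ps: "p = (1, id_cmpo) \<or> (\<exists>j<m. p = ((D j)\<^sup>2, W j))" if "p \<in> set ps" for p
    using that by (auto simp: ps_def)
  have tens: "cmpo_tensors ell (fst p) (snd p)" if "p \<in> set ps" for p
    using ps[OF that] cmpo_tensors_id cmpo_tensors_proj[OF tensors ell] by (auto simp: W_def)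
  let ?D = "sum_list (map fst ps)" and ?W = "direct_sum_cmpo (map snd ps)"
  have "cmpo_represents ell ?D ?W (phase_operator ell m a \<psi>)"
    unfolding cmpo_represents_def
  proof (intro conjI allI ballI)
    show "cmpo_tensors ell ?D ?W"
      using cmpo_tensors_direct_sum[OF tens] by blast
    show "fock_operator ell (phase_operator ell m a \<psi>)" by (rule fock_operator_phase[OF psi])
    fix N M \<eta> \<phi> assume s: "\<eta> \<in> fock_sector ell N" "\<phi> \<in> fock_sector ell M"
    have f: "\<eta> \<in> fock ell" "\<phi> \<in> fock ell" using s by (auto simp: fock_sector_def)
    have int: "cmpo_terms_integrable ell (fst p) (snd p) \<eta> \<phi>" if "p \<in> set ps" for p
      using ps[OF that] cmpo_terms_integrable_id[OF s] cmpo_terms_integrable_proj[OF tensors ell s] by (auto simp: W_def)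
    have "cmpo_form ell ?D ?W \<eta> \<phi> = (\<Sum>p\<leftarrow>ps. cmpo_form ell (fst p) (snd p) \<eta> \<phi>)"
      by (rule cmpo_form_direct_sum[OF tens int s])
    also have "\<dots> = fock_inner ell \<eta> \<phi> + (\<Sum>j<m. cmpo_form ell ((D j)\<^sup>2) (W j) \<eta> \<phi>)"
      using cmpo_form_id[OF s] by (simp add: ps_def o_def sum_list_distinct_conv_sum_set atLeast0LessThan)
    also have "\<dots> = fock_inner ell \<eta> \<phi> + (\<Sum>j<m. (c j * fock_inner ell (\<psi> j) \<phi>) * fock_inner ell \<eta> (\<psi> j))"
      by (intro arg_cong2[where f = "(+)"] sum.cong refl)
        (simp add: W_def \<psi>_def cmpo_form_proj[OF tensors ell s] mult.assoc)
    also have "\<dots> = fock_inner ell \<eta> (phase_operator ell m a \<psi> \<phi>)"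
      unfolding phase_operator_eq c_def[symmetric]
      using f psi by (simp add: fock_inner_add_right fock_sum fock_inner_sum_right c_def)
    finally show "fock_inner ell \<eta> (phase_operator ell m a \<psi> \<phi>)
        = cmpo_form ell ?D ?W \<eta> \<phi>" by (rule sym)
  qed
  then show ?thesis unfolding dims snds W_def .
qed

theorem proposition6:
  fixes ell :: real and m :: nat and D :: "nat \<Rightarrow> nat"
    and B :: "nat \<Rightarrow> complex mat" and Q L :: "nat \<Rightarrow> real \<Rightarrow> complex mat"
    and a :: "nat \<Rightarrow> real"
  defines "\<psi> \<equiv> \<lambda>j. cmps ell (D j) (B j) (Q j) (L j)"
    and "c \<equiv> \<lambda>j. exp (\<i> * complex_of_real (a j)) - 1"
  assumes "0 < ell"
    and "\<forall>j<m. cmps_tensors ell (D j) (B j) (Q j) (L j)"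
    and "\<forall>i<m. \<forall>j<m. fock_inner ell (\<psi> i) (\<psi> j) = (if i = j then 1 else 0)"
  shows "is_cmpu ell (1 + (\<Sum>j<m. (D j)\<^sup>2)) (phase_operator ell m a \<psi>)
    \<and> cmpo_represents ell (1 + (\<Sum>j<m. (D j)\<^sup>2))
        (direct_sum_cmpo
          (id_cmpo # map (\<lambda>j. scale_cmpo (c j) (proj_cmpo (D j) (B j) (Q j) (L j))) [0..<m]))
        (phase_operator ell m a \<psi>)
    \<and> cmpo_represents ell 1 id_cmpo (\<lambda>\<phi>. \<phi>)
    \<and> (\<forall>j<m. cmpo_represents ell ((D j)\<^sup>2)
        (scale_cmpo (c j) (proj_cmpo (D j) (B j) (Q j) (L j)))
        (fock_scale (c j) (rank_one_proj ell (\<psi> j))))"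
proof -
  have tensors: "cmps_tensors ell (D j) (B j) (Q j) (L j)" if "j < m" for j using assms(4) that by blast
  have "\<psi> j \<in> fock ell" if "j < m" for j
    unfolding \<psi>_def by (rule cmps_in_fock[OF tensors[OF that] assms(3)])
  then have "fock_unitary ell (phase_operator ell m a \<psi>)"
    using assms(5) by (intro fock_unitary_phase) auto
  moreover have "cmpo_represents ell (1 + (\<Sum>j<m. (D j)\<^sup>2))
        (direct_sum_cmpo (id_cmpo # map (\<lambda>j. scale_cmpo (c j) (proj_cmpo (D j) (B j) (Q j) (L j))) [0..<m]))
        (phase_operator ell m a \<psi>)"
    unfolding \<psi>_def c_def by (rule cmpo_represents_phase[OF assms(3) tensors])
  moreover have "\<forall>j<m. cmpo_represents ell ((D j)\<^sup>2)
        (scale_cmpo (c j) (proj_cmpo (D j) (B j) (Q j) (L j)))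
        (fock_scale (c j) (rank_one_proj ell (\<psi> j)))"
    unfolding \<psi>_def using cmpo_represents_proj[OF assms(3) tensors] by blast
  ultimately show ?thesis
    using cmpo_represents_id unfolding is_cmpu_def by blast
qed

end
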